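(* Let $f:[0,1]\to[0,1]$ be a non-decreasing function. The following are equivalent: (i) there exists a self-converse tournament limit $\Gamma$ whose outdegree distribution $\nu^+(\Gamma)$ equals the push-forward of Lebesgue measure under $f$ (the law of $f(U)$, $U\sim U[0,1]$); (ii) there exists a self-converse tournament kernel $W$ with score function $f$, i.e. $\int_0^1W(x,y)\,dy=f(x)$ for all $x$; (iii) $f$ satisfies condition I (for every measurable $B\subseteq[0,1]$, $\int_Bf(x)\,dx\ge\mu(B)^2/2$, with equality when $\mu(B)=1$, $\mu$ Lebesgue measure) and condition II ($f(x)+f(1-x)=1$ for almost every $x\in[0,1]$).
   Context: A digraph $F$ has a finite vertex set and an edge set $E(F)$ of ordered pairs of distinct vertices; its converse $F'$ reverses all edges. A tournament is a digraph in which each pair of distinct vertices carries exactly one of the two ordered pairs as an edge. For digraphs $F,G$, $t(F,G)=\hom(F,G)/|V(G)|^{|V(F)|}$, $\hom(F,G)$ counting maps $V(F)\to V(G)$ sending edges to edges. A sequence of tournaments with $|V(G_n)|\to\infty$ is convergent if $t(F,G_n)$ converges for all $F$; a tournament limit $\Gamma$ is the family $t(F,\Gamma)=\lim_nt(F,G_n)$; $\Gamma$ is self-converse if $t(F,\Gamma)=t(F',\Gamma)$ for all digraphs $F$. A tournament kernel is a measurable $W:[0,1]^2\to[0,1]$ with $W(x,y)+W(y,x)=1$ a.e.; $t(F,W)=\int\prod_{(i,j)\in E(F)}W(x_i,x_j)\prod_idx_i$; kernels $W_1,W_2$ are equivalent if $t(F,W_1)=t(F,W_2)$ for all $F$; $W$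 is self-converse if it is equivalent to $W'(x,y)=W(y,x)$. For $m,n\ge0$, $\mathsf{S}_{m,n}$ is the digraph on disjoint sets $A_1\cup A_2\cup A_3$, $|A_1|=m,|A_2|=1,|A_3|=n$, with edges $(u,v)$ for $u\in A_i,v\in A_j,i<j$. The degree distribution $\nu(\Gamma)$ is the probability distribution on $[0,1]^2$ with $\int x^my^n\,d\nu(\Gamma)=t(\mathsf{S}_{m,n},\Gamma)$; its second marginal $\nu^+(\Gamma)$ is the outdegree distribution.
   Formalization: In S_{m,n} only the edges from A_1 to A_2 and from A_2 to A_3 are taken, not those from A_1 to A_3; with the latter included the degree distribution need not exist and the equivalence fails, e.g. for f = 1/2. *)

theory Defs
  imports "HOL-Probability.Probability" "Graph_Theory.Pair_Digraph"
begin

text \<open>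
  Digraphs are graphs \<open>F\<close> with \<open>pair_digraph F\<close> (finite, loop-free, edges a set of ordered
  pairs).  All the notions below are invariant under isomorphism, so it is enough to let the
  vertices be natural numbers.
\<close>

type_synonym dgraph = "nat pair_pre_digraph"

definition converse_digraph :: "dgraph \<Rightarrow> dgraph" where
  "converse_digraph F = \<lparr> pverts = pverts F, parcs = (parcs F)\<inverse> \<rparr>"

definition tournament :: "dgraph \<Rightarrow> bool" where
  "tournament G \<longleftrightarrow> pair_digraph G \<and>
     (\<forall>u\<in>pverts G. \<forall>v\<in>pverts G. u \<noteq> v \<longrightarrow> ((u, v) \<in> parcs G \<longleftrightarrow> (v, u) \<notin> parcs G))"

definition hom_set :: "dgraph \<Rightarrow> dgraph \<Rightarrow> (nat \<Rightarrow> nat) set" where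
  "hom_set F G = {\<phi> \<in> pverts F \<rightarrow>\<^sub>E pverts G. \<forall>(u, v)\<in>parcs F. (\<phi> u, \<phi> v) \<in> parcs G}"

definition hom_density :: "dgraph \<Rightarrow> dgraph \<Rightarrow> real" where
  "hom_density F G = real (card (hom_set F G)) / real (card (pverts G)) ^ card (pverts F)"


text \<open>
  A tournament limit is the family \<open>F \<mapsto> t(F, \<Gamma>)\<close>, here the function \<open>\<Gamma>\<close> itself.  Only its
  values on digraphs \<open>F\<close> matter.
\<close>

definition tournament_limit :: "(dgraph \<Rightarrow> real) \<Rightarrow> bool" where
  "tournament_limit \<Gamma> \<longleftrightarrow> (\<exists>G :: nat \<Rightarrow> dgraph.
     (\<forall>n. tournament (G n)) \<and>
     filterlim (\<lambda>n. card (pverts (G n))) at_top sequentially \<and>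
     (\<forall>F. pair_digraph F \<longrightarrow> (\<lambda>n. hom_density F (G n)) \<longlonglongrightarrow> \<Gamma> F))"

definition self_converse_limit :: "(dgraph \<Rightarrow> real) \<Rightarrow> bool" where
  "self_converse_limit \<Gamma> \<longleftrightarrow> (\<forall>F. pair_digraph F \<longrightarrow> \<Gamma> F = \<Gamma> (converse_digraph F))"

text \<open>
  The vertex \<open>m\<close> is the centre of \<open>S_digraph m n\<close>: it has \<open>m\<close> in-neighbours, forming \<open>A\<^sub>1\<close>, and
  \<open>n\<close> out-neighbours, forming \<open>A\<^sub>3\<close>.  Edges join consecutive classes only, \<open>A\<^sub>1 \<times> A\<^sub>2\<close> and
  \<open>A\<^sub>2 \<times> A\<^sub>3\<close>.  If \<open>A\<^sub>1 \<times> A\<^sub>3\<close> were included as well, its densities would not be the moments of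
  the joint (indegree, outdegree) distribution: for the constant kernel 1/2 the marginal moments
  would force the point mass at (1/2, 1/2), but the (1,1) moment would be 1/8.
\<close>

definition S_digraph :: "nat \<Rightarrow> nat \<Rightarrow> dgraph" where
  "S_digraph m n =
     (let A1 = {..<m}; A2 = {m}; A3 = {m<..m + n}
      in \<lparr> pverts = A1 \<union> A2 \<union> A3, parcs = A1 \<times> A2 \<union> A2 \<times> A3 \<rparr>)"

text \<open>\<open>degree_distribution \<Gamma> \<nu>\<close>: the measure \<open>\<nu>\<close> is \<open>\<nu>(\<Gamma>)\<close>; its moments determine it uniquely.\<close>

definition degree_distribution :: "(dgraph \<Rightarrow> real) \<Rightarrow> (real \<times> real) measure \<Rightarrow> bool" where
  "degree_distribution \<Gamma> \<nu> \<longleftrightarrow>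
     prob_space \<nu> \<and> sets \<nu> = sets borel \<and>
     (AE p in \<nu>. p \<in> {0..1} \<times> {0..1}) \<and>
     (\<forall>m n. (LINT p|\<nu>. fst p ^ m * snd p ^ n) = \<Gamma> (S_digraph m n))"

definition outdegree_distribution :: "(dgraph \<Rightarrow> real) \<Rightarrow> real measure \<Rightarrow> bool" where
  "outdegree_distribution \<Gamma> M \<longleftrightarrow> (\<exists>\<nu>. degree_distribution \<Gamma> \<nu> \<and> M = distr \<nu> borel snd)"


abbreviation unit_lebesgue :: "real measure" where
  "unit_lebesgue \<equiv> lebesgue_on {0..1}"

text \<open>
  Measurability of kernels is with respect to the product of the Lebesgue sigma-algebras, so
  that all sections, and the integrands of \<open>kernel_density\<close>, are measurable.
\<close>

definition tournament_kernel :: "(real \<Rightarrow> real \<Rightarrow> real) \<Rightarrow> bool" where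
  "tournament_kernel W \<longleftrightarrow>
     (\<lambda>(x, y). W x y) \<in> borel_measurable (unit_lebesgue \<Otimes>\<^sub>M unit_lebesgue) \<and>
     (\<forall>x\<in>{0..1}. \<forall>y\<in>{0..1}. W x y \<in> {0..1}) \<and>
     (AE (x, y) in unit_lebesgue \<Otimes>\<^sub>M unit_lebesgue. W x y + W y x = 1)"

definition kernel_density :: "dgraph \<Rightarrow> (real \<Rightarrow> real \<Rightarrow> real) \<Rightarrow> real" where
  "kernel_density F W =
     (LINT x|PiM (pverts F) (\<lambda>_. unit_lebesgue). (\<Prod>(i, j)\<in>parcs F. W (x i) (x j)))"

definition equivalent_kernels ::
    "(real \<Rightarrow> real \<Rightarrow> real) \<Rightarrow> (real \<Rightarrow> real \<Rightarrow> real) \<Rightarrow> bool" where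
  "equivalent_kernels W1 W2 \<longleftrightarrow>
     (\<forall>F. pair_digraph F \<longrightarrow> kernel_density F W1 = kernel_density F W2)"

definition self_converse_kernel :: "(real \<Rightarrow> real \<Rightarrow> real) \<Rightarrow> bool" where
  "self_converse_kernel W \<longleftrightarrow> equivalent_kernels W (\<lambda>x y. W y x)"

definition score_function :: "(real \<Rightarrow> real \<Rightarrow> real) \<Rightarrow> (real \<Rightarrow> real) \<Rightarrow> bool" where
  "score_function W f \<longleftrightarrow> (\<forall>x\<in>{0..1}. (LINT y|unit_lebesgue. W x y) = f x)"


definition condition_I :: "(real \<Rightarrow> real) \<Rightarrow> bool" where
  "condition_I f \<longleftrightarrow>
     (\<forall>B\<in>sets lebesgue. B \<subseteq> {0..1} \<longrightarrow>
        (LINT x:B|lebesgue. f x) \<ge> (measure lebesgue B)\<^sup>2 / 2 \<and>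
        (measure lebesgue B = 1 \<longrightarrow> (LINT x:B|lebesgue. f x) = (measure lebesgue B)\<^sup>2 / 2))"

definition condition_II :: "(real \<Rightarrow> real) \<Rightarrow> bool" where
  "condition_II f \<longleftrightarrow> (AE x in unit_lebesgue. f x + f (1 - x) = 1)"

end

(*
  Sampling and degrees: the vertices of a large W-random tournament have outdegree frequencies
  distributed like f(U), and converses exchange in- and outdegrees, so a self-converse limit forces
  f and 1 - f(1 - .) to have the same law, hence to agree almost everywhere.  Condition I is the
  limit of Landau's inequalities, in the dual form  E max(0, c - f(U)) <= c^2 / 2.

  Conversely, condition I says that f(U) is below U in convex order.  The inverse transform
  martingale coupling then provides, for every x, a random point Z_x of [0,1] with mean f(x) such
  that Z_x is uniform when x is.  The kernel W(x,y) = P(Z_x > Z_y) + P(Z_x = Z_y) / 2 therefore has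
  score function f, and averaging it with W(1 - y, 1 - x) makes it self-converse by condition II.
*)
theory Submission
  imports Defs
begin

section \<open>The unit interval\<close>

text \<open>The implications run in a cycle: limit, conditions, kernel, limit. Passing from the
  limit directly to the conditions avoids representing a limit by a kernel: both conditions are read
  off averages over finite tournaments, whose moments are star densities. In the coupling,
  \<open>Z_x\<close> has only the two values x and \<open>partner x\<close>, so all reduces to a
  mass-preserving exchange between points with f x > x and points with f x < x; condition I puts f x
  between x and its partner. The score must equal f at every x, while condition II holds almost
  everywhere, so rows of the kernel at exceptional x are replaced by the constant f x. A 2-cycle has
  density 0 in every tournament but may have positive density in a kernel; the limit of the sampled
  tournaments is therefore the kernel density on digraphs without 2-cycles and 0 on all others.
  Sampling stays finite: expectations are weighted sums over orientations, and at each stage a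
  second-moment bound, for finitely many digraphs and a large order, yields one good
  tournament.\<close>

interpretation unit: prob_space unit_lebesgue
  by (rule prob_spaceI) (simp add: emeasure_restrict_space)

interpretation unit_pair: pair_prob_space unit_lebesgue unit_lebesgue ..

lemma measurable_id_unit_lebesgue: "(\<lambda>x. x) \<in> unit_lebesgue \<rightarrow>\<^sub>M borel"
  using id_borel_measurable_lebesgue_on by (simp add: id_def)

text \<open>The kernels and couplings built below are Borel; this moves them to the Lebesgue
  sigma-algebra in which the notions are phrased.\<close>

lemma borel_imp_unit_measurable: "h \<in> borel \<rightarrow>\<^sub>M N \<Longrightarrow> h \<in> unit_lebesgue \<rightarrow>\<^sub>M N"
  using measurable_compose[OF measurable_id_unit_lebesgue] by blast

lemma integrable_unit_bounded:
  fixes h :: "real \<Rightarrow> real"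
  assumes "h \<in> borel_measurable unit_lebesgue" "\<And>x. x \<in> {0..1} \<Longrightarrow> \<bar>h x\<bar> \<le> B"
  shows "integrable unit_lebesgue h"
  by (rule unit.integrable_const_bound[where B = B]) (use assms in \<open>auto intro!: AE_I2\<close>)

lemma AE_unit_I: "(\<And>x. x \<in> {0..1} \<Longrightarrow> P x) \<Longrightarrow> AE x in unit_lebesgue. P x"
  by (rule AE_I2) simp

lemma measurable_reflect_unit [measurable]: "(\<lambda>x. 1 - x) \<in> unit_lebesgue \<rightarrow>\<^sub>M unit_lebesgue"
  and distr_reflect_unit: "distr unit_lebesgue unit_lebesgue (\<lambda>x. 1 - x) = unit_lebesgue"
proof -
  \<comment> \<open>The reflection is an involution of [0,1], so a preimage is an image under an
    affine map, the form in which Lebesgue measure is known to be invariant.\<close>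
  have im: "(\<lambda>x. 1 - x) -` A \<inter> {0..1} = (\<lambda>x. (-1) *\<^sub>R x + 1) ` A" if "A \<subseteq> {0..1}" for A :: "real set"
    using that by (force simp: image_iff intro: bexI[of _ "1 - x" for x])
  have "(\<lambda>x. 1 - x :: real) \<in> lebesgue \<rightarrow>\<^sub>M lebesgue"
    using lebesgue_affine_measurable[of "\<lambda>_::real. -1" 1] by simp
  then show m: "(\<lambda>x. 1 - x) \<in> unit_lebesgue \<rightarrow>\<^sub>M unit_lebesgue"
    by (rule measurable_restrict_space3) auto
  show "distr unit_lebesgue unit_lebesgue (\<lambda>x. 1 - x) = unit_lebesgue"
  proof (rule measure_eqI)
    fix A assume "A \<in> sets (distr unit_lebesgue unit_lebesgue (\<lambda>x. 1 - x))"
    then have A: "A \<in> sets lebesgue" "A \<subseteq> {0..1}" "A \<in> sets unit_lebesgue" by (auto simp: sets_restrict_space)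
    have "emeasure (distr unit_lebesgue unit_lebesgue (\<lambda>x. 1 - x)) A = emeasure lebesgue ((\<lambda>x. (-1) *\<^sub>R x + 1) ` A)"
      using A m im[OF A(2)] image_subset_iff[of "\<lambda>x. 1 - x" A "{0..1}"] by (subst emeasure_distr) (auto simp: emeasure_restrict_space)
    also have "\<dots> = emeasure lebesgue A"
      using emeasure_lebesgue_affine[of "-1" 1 A] by simp
    finally show "emeasure (distr unit_lebesgue unit_lebesgue (\<lambda>x. 1 - x)) A = emeasure unit_lebesgue A"
      using A by (simp add: emeasure_restrict_space)
  qed simp
qed

lemma integral_reflect_unit:
  fixes h :: "real \<Rightarrow> real"
  assumes "h \<in> borel_measurable unit_lebesgue"
  shows "(LINT x|unit_lebesgue. h (1 - x)) = (LINT x|unit_lebesgue. h x)"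
  using integral_distr[OF measurable_reflect_unit assms] by (simp add: distr_reflect_unit)

lemma emeasure_unit_Ioc:
  assumes "0 \<le> s" "s \<le> t" "t \<le> 1"
  shows "emeasure unit_lebesgue {s<..t} = t - s"
proof -
  have "{s<..t} \<subseteq> {0..1}" using assms by auto
  then show ?thesis using assms by (simp add: emeasure_restrict_space)
qed

section \<open>Kernel densities\<close>

text \<open>A rectangle in the coordinates i and j is a box whose other sides are the whole space,
  each of mass 1.\<close>

lemma distr_PiM_pair:
  assumes M: "prob_space M" and I: "finite I" "i \<in> I" "j \<in> I" "i \<noteq> j"
  shows "distr (PiM I (\<lambda>_. M)) (M \<Otimes>\<^sub>M M) (\<lambda>\<omega>. (\<omega> i, \<omega> j)) = M \<Otimes>\<^sub>M M"
proof (rule pair_measure_eqI[symmetric])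
  interpret prob_space M by fact
  interpret P: product_sigma_finite "\<lambda>_. M" ..
  show "sigma_finite_measure M" "sigma_finite_measure M" ..
  have m [measurable]: "(\<lambda>\<omega>. (\<omega> i, \<omega> j)) \<in> PiM I (\<lambda>_. M) \<rightarrow>\<^sub>M M \<Otimes>\<^sub>M M"
    using I by measurable
  fix A B assume AB: "A \<in> sets M" "B \<in> sets M"
  define X where "X k = (if k = i then A else if k = j then B else space M)" for k
  have X: "X k \<in> sets M" for k using AB by (simp add: X_def)
  have "(\<lambda>\<omega>. (\<omega> i, \<omega> j)) -` (A \<times> B) \<inter> space (PiM I (\<lambda>_. M)) = PiE I X"
  proof (intro equalityI subsetI)
    fix \<omega> assume "\<omega> \<in> (\<lambda>\<omega>. (\<omega> i, \<omega> j)) -` (A \<times> B) \<inter> space (PiM I (\<lambda>_. M))"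
    then show "\<omega> \<in> PiE I X" by (auto simp: X_def space_PiM PiE_iff)
  next
    fix \<omega> assume *: "\<omega> \<in> PiE I X"
    then have "\<omega> k \<in> space M" if "k \<in> I" for k
      using PiE_mem[OF * that] X[of k] sets.sets_into_space by blast
    moreover have "\<omega> i \<in> A" "\<omega> j \<in> B"
      using PiE_mem[OF * I(2)] PiE_mem[OF * I(3)] I(4) by (auto simp: X_def)
    ultimately show "\<omega> \<in> (\<lambda>\<omega>. (\<omega> i, \<omega> j)) -` (A \<times> B) \<inter> space (PiM I (\<lambda>_. M))"
      using * by (auto simp: space_PiM PiE_iff)
  qed
  then have "emeasure (distr (PiM I (\<lambda>_. M)) (M \<Otimes>\<^sub>M M) (\<lambda>\<omega>. (\<omega> i, \<omega> j))) (A \<times> B)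
      = (\<Prod>k\<in>I. emeasure M (X k))"
    using AB X I by (simp add: emeasure_distr P.emeasure_PiM)
  also have "\<dots> = (\<Prod>k\<in>{i, j}. emeasure M (X k))"
    using I by (intro prod.mono_neutral_right) (auto simp: X_def emeasure_space_1)
  also have "\<dots> = emeasure M A * emeasure M B"
    using I by (simp add: X_def)
  finally show "emeasure M A * emeasure M B
      = emeasure (distr (PiM I (\<lambda>_. M)) (M \<Otimes>\<^sub>M M) (\<lambda>\<omega>. (\<omega> i, \<omega> j))) (A \<times> B)" by simp
qed simp

text \<open>Carries null sets of the square over to the product indexed by the vertices. With i = j
  the pair would live on the diagonal, which for Lebesgue measure is itself a null set; this is
  where loop-freeness of digraphs matters.\<close>

lemma AE_PiM_pair:
  assumes "prob_space M" "finite I" "i \<in> I" "j \<in> I" "i \<noteq> j"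
    and AE: "AE (x, y) in M \<Otimes>\<^sub>M M. P x y"
  shows "AE \<omega> in PiM I (\<lambda>_. M). P (\<omega> i) (\<omega> j)"
proof -
  have m: "(\<lambda>\<omega>. (\<omega> i, \<omega> j)) \<in> PiM I (\<lambda>_. M) \<rightarrow>\<^sub>M M \<Otimes>\<^sub>M M"
    using assms by measurable
  have "AE z in distr (PiM I (\<lambda>_. M)) (M \<Otimes>\<^sub>M M) (\<lambda>\<omega>. (\<omega> i, \<omega> j)). case z of (x, y) \<Rightarrow> P x y"
    unfolding distr_PiM_pair[OF assms(1-5)] by (rule AE)
  from AE_distrD[OF m this] show ?thesis by simp
qed

lemma borel_imp_unit_pair_measurable:
  assumes "(\<lambda>(x, y). W x y) \<in> borel_measurable (borel \<Otimes>\<^sub>M borel)"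
  shows "(\<lambda>(x, y). W x y) \<in> borel_measurable (unit_lebesgue \<Otimes>\<^sub>M unit_lebesgue)"
proof -
  have "(\<lambda>z. (fst z, snd z)) \<in> unit_lebesgue \<Otimes>\<^sub>M unit_lebesgue \<rightarrow>\<^sub>M borel \<Otimes>\<^sub>M borel"
    by (intro measurable_Pair measurable_compose[OF measurable_fst measurable_id_unit_lebesgue]
        measurable_compose[OF measurable_snd measurable_id_unit_lebesgue])
  from measurable_compose[OF this assms] show ?thesis by (simp add: case_prod_beta')
qed

text \<open>Both marginals of the product are uniform, the second one by swapping, so a property of
  almost every point holds for both points of almost every pair.\<close>

lemma AE_unit_pair_I:
  assumes "AE x in unit_lebesgue. P x"
    and "\<And>x y. x \<in> {0..1} \<Longrightarrow> y \<in> {0..1} \<Longrightarrow> P x \<Longrightarrow> P y \<Longrightarrow> Q x y"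
  shows "AE (x, y) in unit_lebesgue \<Otimes>\<^sub>M unit_lebesgue. Q x y"
proof -
  have 1: "AE z in unit_lebesgue \<Otimes>\<^sub>M unit_lebesgue. P (fst z)"
  proof (rule AE_distrD[OF measurable_fst, where P = P])
    show "AE x in distr (unit_lebesgue \<Otimes>\<^sub>M unit_lebesgue) unit_lebesgue fst. P x"
      by (subst unit.distr_pair_fst) (rule assms(1))
  qed
  from 1 have "AE z in distr (unit_lebesgue \<Otimes>\<^sub>M unit_lebesgue) (unit_lebesgue \<Otimes>\<^sub>M unit_lebesgue) (\<lambda>(x, y). (y, x)). P (fst z)"
    by (rule subst[OF unit_pair.distr_pair_swap, where P = "\<lambda>M. AE z in M. P (fst z)"])
  from AE_distrD[OF measurable_pair_swap' this]
  have 2: "AE z in unit_lebesgue \<Otimes>\<^sub>M unit_lebesgue. P (snd z)" by (simp add: case_prod_beta')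
  show ?thesis
    using 1 2 AE_space by eventually_elim (auto simp: space_pair_measure intro: assms(2))
qed

lemma kernel_integrand_measurable:
  fixes W :: "real \<Rightarrow> real \<Rightarrow> real"
  assumes W: "(\<lambda>(x, y). W x y) \<in> borel_measurable (unit_lebesgue \<Otimes>\<^sub>M unit_lebesgue)"
    and E: "E \<subseteq> I \<times> I"
  shows "(\<lambda>\<omega>. \<Prod>(i, j)\<in>E. W (\<omega> i) (\<omega> j)) \<in> borel_measurable (PiM I (\<lambda>_. unit_lebesgue))"
proof (rule borel_measurable_prod)
  fix e assume "e \<in> E"
  then obtain i j where e: "e = (i, j)" "i \<in> I" "j \<in> I" using E by auto
  have "(\<lambda>\<omega>. (\<omega> i, \<omega> j)) \<in> PiM I (\<lambda>_. unit_lebesgue) \<rightarrow>\<^sub>M unit_lebesgue \<Otimes>\<^sub>M unit_lebesgue"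
    using e by measurable
  from measurable_compose[OF this W]
  show "(\<lambda>\<omega>. case e of (i, j) \<Rightarrow> W (\<omega> i) (\<omega> j)) \<in> borel_measurable (PiM I (\<lambda>_. unit_lebesgue))"
    by (simp add: e)
qed

lemma kernel_integral_cong_AE:
  fixes W W' :: "real \<Rightarrow> real \<Rightarrow> real"
  assumes W: "(\<lambda>(x, y). W x y) \<in> borel_measurable (unit_lebesgue \<Otimes>\<^sub>M unit_lebesgue)"
      "(\<lambda>(x, y). W' x y) \<in> borel_measurable (unit_lebesgue \<Otimes>\<^sub>M unit_lebesgue)"
    and AE: "AE (x, y) in unit_lebesgue \<Otimes>\<^sub>M unit_lebesgue. W x y = W' x y"
    and I: "finite I" "E \<subseteq> I \<times> I" "\<And>i. (i, i) \<notin> E"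
  shows "(LINT \<omega>|PiM I (\<lambda>_. unit_lebesgue). (\<Prod>(i, j)\<in>E. W (\<omega> i) (\<omega> j)))
       = (LINT \<omega>|PiM I (\<lambda>_. unit_lebesgue). (\<Prod>(i, j)\<in>E. W' (\<omega> i) (\<omega> j)))"
proof (rule integral_cong_AE)
  have "finite E" using I by (meson finite_SigmaI finite_subset)
  moreover have "AE \<omega> in PiM I (\<lambda>_. unit_lebesgue). (case e of (i, j) \<Rightarrow> W (\<omega> i) (\<omega> j)) = (case e of (i, j) \<Rightarrow> W' (\<omega> i) (\<omega> j))"
    if "e \<in> E" for e
  proof -
    obtain i j where e: "e = (i, j)" by (cases e)
    then have "i \<in> I" "j \<in> I" "i \<noteq> j" using that I(2) I(3)[of i] by auto
    from AE_PiM_pair[OF unit.prob_space_axioms I(1) this AE] show ?thesis by (simp add: e)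
  qed
  ultimately have "AE \<omega> in PiM I (\<lambda>_. unit_lebesgue). \<forall>e\<in>E. (case e of (i, j) \<Rightarrow> W (\<omega> i) (\<omega> j)) = (case e of (i, j) \<Rightarrow> W' (\<omega> i) (\<omega> j))"
    by (rule AE_finite_allI)
  then show "AE \<omega> in PiM I (\<lambda>_. unit_lebesgue). (\<Prod>(i, j)\<in>E. W (\<omega> i) (\<omega> j)) = (\<Prod>(i, j)\<in>E. W' (\<omega> i) (\<omega> j))"
    by eventually_elim (auto intro: prod.cong)
qed (intro kernel_integrand_measurable W I)+

lemma kernel_density_cong_AE:
  assumes "(\<lambda>(x, y). W x y) \<in> borel_measurable (unit_lebesgue \<Otimes>\<^sub>M unit_lebesgue)"
      "(\<lambda>(x, y). W' x y) \<in> borel_measurable (unit_lebesgue \<Otimes>\<^sub>M unit_lebesgue)"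
    and "AE (x, y) in unit_lebesgue \<Otimes>\<^sub>M unit_lebesgue. W x y = W' x y"
    and "pair_digraph F"
  shows "kernel_density F W = kernel_density F W'"
proof -
  interpret pair_digraph F by fact
  show ?thesis unfolding kernel_density_def
    using assms(1-3) by (rule kernel_integral_cong_AE) (auto dest: wellformed no_loops)
qed

text \<open>Reflecting all vertex coordinates at once preserves the product measure. This is the
  tool for comparing the constructed kernel with its converse.\<close>

lemma kernel_density_reflect:
  assumes W: "(\<lambda>(x, y). W x y) \<in> borel_measurable (unit_lebesgue \<Otimes>\<^sub>M unit_lebesgue)"
    and "pair_digraph F"
  shows "kernel_density F (\<lambda>x y. W (1 - x) (1 - y)) = kernel_density F W"
proof -
  interpret pair_digraph F by fact
  let ?P = "PiM (pverts F) (\<lambda>_. unit_lebesgue)" and ?g = "\<lambda>\<omega>. \<Prod>(i, j)\<in>parcs F. W (\<omega> i) (\<omega> j)"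
  have sub: "parcs F \<subseteq> pverts F \<times> pverts F" by (auto dest: wellformed)
  have d: "distr ?P ?P (compose (pverts F) (\<lambda>x. 1 - x)) = ?P"
    by (subst distr_PiM_finite_prob_space') (auto simp: distr_reflect_unit unit.prob_space_axioms)
  have m: "compose (pverts F) (\<lambda>x. 1 - x) \<in> ?P \<rightarrow>\<^sub>M ?P"
    unfolding compose_def
    by (intro measurable_restrict measurable_compose[OF _ measurable_reflect_unit] measurable_component_singleton)
  have "kernel_density F W = (LINT \<omega>|distr ?P ?P (compose (pverts F) (\<lambda>x. 1 - x)). ?g \<omega>)"
    unfolding d kernel_density_def ..
  also have "\<dots> = (LINT \<omega>|?P. ?g (compose (pverts F) (\<lambda>x. 1 - x) \<omega>))"
    by (rule integral_distr[OF m kernel_integrand_measurable[OF W sub]])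
  also have "\<dots> = kernel_density F (\<lambda>x y. W (1 - x) (1 - y))"
    unfolding kernel_density_def
    by (intro Bochner_Integration.integral_cong refl prod.cong) (use sub in \<open>auto simp: compose_def\<close>)
  finally show ?thesis by simp
qed

section \<open>The martingale coupling\<close>

locale density_on_unit =
  fixes k :: "real \<Rightarrow> real" and C :: real
  assumes k_measurable [measurable]: "k \<in> borel_measurable borel"
    and nonneg: "0 \<le> x \<Longrightarrow> x \<le> 1 \<Longrightarrow> 0 \<le> k x"
    and bound: "0 \<le> x \<Longrightarrow> x \<le> 1 \<Longrightarrow> k x \<le> C"
begin

definition K :: "real \<Rightarrow> real" where
  "K t = (LINT s|unit_lebesgue. k s * indicator {..t} s)"

lemma k_measurable_unit [measurable]: "k \<in> borel_measurable unit_lebesgue"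
  by (rule borel_imp_unit_measurable) measurable

lemma C_nonneg: "0 \<le> C"
  using nonneg[of 0] bound[of 0] by simp

lemma integrable_k_indicator:
  assumes "A \<in> sets borel"
  shows "integrable unit_lebesgue (\<lambda>s. k s * indicator A s)"
proof (rule integrable_unit_bounded[where B = C])
  have [measurable]: "indicator A \<in> borel_measurable unit_lebesgue"
    using assms by (intro borel_imp_unit_measurable) auto
  show "(\<lambda>s. k s * indicator A s) \<in> borel_measurable unit_lebesgue"
    by measurable
qed (use nonneg bound C_nonneg in \<open>auto simp: indicator_def\<close>)

lemma K_diff:
  assumes "s \<le> t"
  shows "K t - K s = (LINT x|unit_lebesgue. k x * indicator {s<..t} x)"
proof -
  have "K t - K s = (LINT x|unit_lebesgue. k x * indicator {..t} x - k x * indicator {..s} x)"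
    unfolding K_def by (rule Bochner_Integration.integral_diff[symmetric]) (auto intro: integrable_k_indicator)
  also have "\<dots> = (LINT x|unit_lebesgue. k x * indicator {s<..t} x)"
    using assms by (intro Bochner_Integration.integral_cong) (auto simp: indicator_def)
  finally show ?thesis .
qed

lemma K_mono: "s \<le> t \<Longrightarrow> K s \<le> K t"
proof -
  assume "s \<le> t"
  have "0 \<le> (LINT x|unit_lebesgue. k x * indicator {s<..t} x)"
    by (rule integral_nonneg_AE, rule AE_unit_I) (use nonneg in \<open>auto simp: indicator_def\<close>)
  then show ?thesis using K_diff[OF \<open>s \<le> t\<close>] by simp
qed

lemma K_lipschitz:
  assumes "0 \<le> s" "s \<le> t" "t \<le> 1"
  shows "K t - K s \<le> C * (t - s)"
proof -
  have st: "{s<..t} \<in> sets unit_lebesgue"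
    using assms by (auto simp: sets_restrict_space_iff)
  have "K t - K s = (LINT x|unit_lebesgue. k x * indicator {s<..t} x)"
    by (rule K_diff) fact
  also have "\<dots> \<le> (LINT x|unit_lebesgue. C * indicator {s<..t} x)"
  proof (rule integral_mono_AE)
    show "integrable unit_lebesgue (\<lambda>x. C * indicator {s<..t} x)"
      using st unit.emeasure_finite by (intro integrable_mult_right integrable_real_indicator) (auto simp: less_top[symmetric])
    show "AE x in unit_lebesgue. k x * indicator {s<..t} x \<le> C * indicator {s<..t} x"
      by (rule AE_unit_I) (use bound C_nonneg in \<open>auto simp: indicator_def\<close>)
  qed (auto intro: integrable_k_indicator)
  also have "\<dots> = C * (t - s)"
  proof -
    have "{s<..t} \<inter> {0..1} = {s<..t}" using assms by auto
    then show ?thesis using emeasure_unit_Ioc[OF assms] st assms by (simp add: measure_def)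
  qed
  finally show ?thesis .
qed

lemma K_0: "K 0 = 0"
proof -
  have "AE x in lebesgue. x \<noteq> (0::real)"
    by (rule AE_completion) (rule AE_lborel_singleton)
  then have "AE x in unit_lebesgue. x \<noteq> 0"
    by (auto simp: AE_restrict_space_iff)
  then have "AE x in unit_lebesgue. k x * indicator {..0} x = 0"
    using AE_space by eventually_elim (auto simp: indicator_def)
  then show ?thesis unfolding K_def by (rule integral_eq_zero_AE)
qed

lemma K_continuous: "continuous_on {0..1} K"
proof (rule lipschitz_on_continuous_on)
  show "C-lipschitz_on {0..1} K"
  proof (rule lipschitz_onI)
    fix x y :: real assume xy: "x \<in> {0..1}" "y \<in> {0..1}"
    show "dist (K x) (K y) \<le> C * dist x y"
      using xy K_lipschitz[of x y] K_lipschitz[of y x] K_mono[of x y] K_mono[of y x]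
      by (cases "x \<le> y") (auto simp: dist_real_def abs_if)
  qed (rule C_nonneg)
qed

lemma K_measurable [measurable]: "K \<in> borel_measurable borel"
  by (rule borel_measurable_mono) (auto intro: monoI K_mono)

lemmas K_measurable_unit [measurable] = K_measurable[THEN borel_imp_unit_measurable]

text \<open>\<open>K\<close> may be flat at height c. The largest point at that height turns the
  sublevel set of \<open>K\<close> into an initial segment.\<close>

lemma K_level:
  assumes "0 \<le> c" "c \<le> K 1"
  shows "\<exists>T\<in>{0..1}. K T = c \<and> (\<forall>y\<in>{0..1}. K y \<le> c \<longleftrightarrow> y \<le> T)"
proof -
  define S where "S = {0..1} \<inter> K -` {c}"
  have "\<exists>x\<ge>0. x \<le> 1 \<and> K x = c"
    using assms K_0 K_continuous by (intro IVT') auto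
  then have ne: "S \<noteq> {}" by (auto simp: S_def)
  have "closed S" unfolding S_def
    by (rule continuous_closed_preimage[OF K_continuous]) auto
  moreover have bd: "bdd_above S" by (auto simp: S_def bdd_above_def)
  ultimately have SS: "Sup S \<in> S" using ne closed_contains_Sup by blast
  show ?thesis
  proof (intro bexI conjI ballI)
    show "Sup S \<in> {0..1}" "K (Sup S) = c" using SS by (auto simp: S_def)
    fix y :: real assume y: "y \<in> {0..1}"
    show "K y \<le> c \<longleftrightarrow> y \<le> Sup S"
    proof
      assume "y \<le> Sup S" then show "K y \<le> c" using K_mono \<open>K (Sup S) = c\<close> by metis
    next
      assume 1: "K y \<le> c"
      show "y \<le> Sup S"
      proof (rule ccontr)
        assume "\<not> y \<le> Sup S"
        then have "K y = c" using 1 K_mono[of "Sup S" y] \<open>K (Sup S) = c\<close> by simp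
        then have "y \<in> S" using y by (auto simp: S_def)
        then show False using cSup_upper[OF _ bd] \<open>\<not> y \<le> Sup S\<close> by blast
      qed
    qed
  qed
qed

lemma nn_integral_k_atMost: "(\<integral>\<^sup>+ y. ennreal (k y) * indicator {..t} y \<partial>unit_lebesgue) = ennreal (K t)"
proof -
  have "(\<integral>\<^sup>+ y. ennreal (k y) * indicator {..t} y \<partial>unit_lebesgue)
      = (\<integral>\<^sup>+ y. ennreal (k y * indicator {..t} y) \<partial>unit_lebesgue)"
    by (intro nn_integral_cong) (auto simp: indicator_def)
  also have "\<dots> = ennreal (K t)"
    unfolding K_def
  proof (rule nn_integral_eq_integral)
    show "AE y in unit_lebesgue. 0 \<le> k y * indicator {..t} y"
      by (rule AE_unit_I) (auto simp: nonneg indicator_def)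
  qed (auto intro: integrable_k_indicator)
  finally show ?thesis .
qed

text \<open>The probability integral transform: under the measure with density \<open>k\<close>, the
  cumulative mass is uniform on [0, \<open>K 1\<close>]. The distribution functions agree because,
  by \<open>K_level\<close>, the set where \<open>K\<close> is at most c is an initial segment of
  mass c.\<close>

lemma distr_K:
  "distr (density unit_lebesgue k) borel K = density lborel (indicator {0..K 1})"
proof (rule cdf_unique')
  let ?A = "distr (density unit_lebesgue k) borel K" and ?B = "density lborel (indicator {0..K 1} :: real \<Rightarrow> ennreal)"
  have K1: "0 \<le> K 1" using K_mono[of 0 1] K_0 by simp
  have eA: "emeasure ?A {..c} = (\<integral>\<^sup>+ y. ennreal (k y) * indicator {y. K y \<le> c} y \<partial>unit_lebesgue)" for c
  proof -
    have "emeasure ?A {..c} = emeasure (density unit_lebesgue k) (K -` {..c} \<inter> space unit_lebesgue)"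
      by (subst emeasure_distr) auto
    also have "\<dots> = (\<integral>\<^sup>+ y. ennreal (k y) * indicator (K -` {..c} \<inter> space unit_lebesgue) y \<partial>unit_lebesgue)"
      by (rule emeasure_density) measurable
    also have "\<dots> = (\<integral>\<^sup>+ y. ennreal (k y) * indicator {y. K y \<le> c} y \<partial>unit_lebesgue)"
      by (intro nn_integral_cong) (auto simp: indicator_def)
    finally show ?thesis .
  qed
  have eB: "emeasure ?B {..c} = emeasure lborel ({0..K 1} \<inter> {..c})" for c
    by (subst emeasure_density) (auto simp: indicator_inter_arith[symmetric] simp del: Int_atLeastAtMostR2)
  have eq: "emeasure ?A {..c} = emeasure ?B {..c}" for c
  proof -
    consider "c < 0" | "0 \<le> c" "c \<le> K 1" | "c > K 1" by linarith
    then show ?thesis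
    proof cases
      case 1
      have "emeasure ?A {..c} = (\<integral>\<^sup>+ y. 0 \<partial>unit_lebesgue)"
        unfolding eA by (intro nn_integral_cong) (use 1 K_0 K_mono[of 0] in \<open>force simp: indicator_def\<close>)
      moreover have "{0..K 1} \<inter> {..c} = {}" using 1 by auto
      ultimately show ?thesis unfolding eB by simp
    next
      case 2
      then obtain T where T: "T \<in> {0..1}" "K T = c" "\<forall>y\<in>{0..1}. K y \<le> c \<longleftrightarrow> y \<le> T"
        using K_level[of c] by blast
      have "emeasure ?A {..c} = (\<integral>\<^sup>+ y. ennreal (k y) * indicator {..T} y \<partial>unit_lebesgue)"
        unfolding eA by (intro nn_integral_cong) (use T in \<open>auto simp: indicator_def\<close>)
      also have "\<dots> = ennreal c" using nn_integral_k_atMost T by simp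
      finally have "emeasure ?A {..c} = ennreal c" .
      moreover have "{0..K 1} \<inter> {..c} = {0..c}" using 2 by auto
      ultimately show ?thesis unfolding eB using 2 by simp
    next
      case 3
      have "emeasure ?A {..c} = (\<integral>\<^sup>+ y. ennreal (k y) * indicator {..1} y \<partial>unit_lebesgue)"
        unfolding eA by (intro nn_integral_cong) (use 3 K_mono[of _ 1] in \<open>force simp: indicator_def\<close>)
      also have "\<dots> = ennreal (K 1)" using nn_integral_k_atMost by simp
      finally have "emeasure ?A {..c} = ennreal (K 1)" .
      moreover have "{0..K 1} \<inter> {..c} = {0..K 1}" using 3 by auto
      ultimately show ?thesis unfolding eB using K1 by simp
    qed
  qed
  show "finite_borel_measure ?A"
  proof (intro finite_borel_measure.intro finite_measureI finite_borel_measure_axioms.intro)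
    have "emeasure ?A (space ?A) = (\<integral>\<^sup>+ y. ennreal (k y) \<partial>unit_lebesgue)"
      by (simp add: emeasure_distr emeasure_density cong: nn_integral_cong_simp)
    also have "\<dots> < \<infinity>"
      by (rule order.strict_trans1[OF nn_integral_mono[of _ _ "\<lambda>_. ennreal C"]])
        (auto intro!: ennreal_leI bound simp: unit.emeasure_space_1[simplified])
    finally show "emeasure ?A (space ?A) \<noteq> \<infinity>" by simp
  qed auto
  show "finite_borel_measure ?B"
    by (intro finite_borel_measure.intro finite_measureI finite_borel_measure_axioms.intro)
      (simp_all add: emeasure_density K1)
  show "cdf ?A = cdf ?B"
    unfolding cdf_def measure_def eq ..
qed

lemma nn_integral_K:
  assumes [measurable]: "\<Phi> \<in> borel_measurable borel"
  shows "(\<integral>\<^sup>+ y. ennreal (k y) * \<Phi> (K y) \<partial>unit_lebesgue) = (\<integral>\<^sup>+ l. indicator {0..K 1} l * \<Phi> l \<partial>lborel)"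
proof -
  have "(\<integral>\<^sup>+ y. ennreal (k y) * \<Phi> (K y) \<partial>unit_lebesgue) = (\<integral>\<^sup>+ y. \<Phi> (K y) \<partial>density unit_lebesgue k)"
    by (subst nn_integral_density) auto
  also have "\<dots> = (\<integral>\<^sup>+ l. \<Phi> l \<partial>distr (density unit_lebesgue k) borel K)"
    by (subst nn_integral_distr) auto
  also have "\<dots> = (\<integral>\<^sup>+ l. indicator {0..K 1} l * \<Phi> l \<partial>lborel)"
    unfolding distr_K by (subst nn_integral_density) auto
  finally show ?thesis .
qed

text \<open>If \<open>K\<close> agrees at y and u, it is constant between them and so takes its
  value at a rational. Such values form a countable set, whose preimage has no mass under
  \<open>k\<close> because by \<open>nn_integral_K\<close> the levels are distributed as Lebesgue
  measure.\<close>

lemma AE_K_inj: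
  "AE y in unit_lebesgue. k y > 0 \<longrightarrow> (\<forall>u\<in>{0..1}. K u = K y \<longrightarrow> u = y)"
proof -
  define Q where "Q = K ` (\<rat> \<inter> {0..1})"
  have Q: "countable Q" unfolding Q_def by (intro countable_image countable_Int1 countable_rat)
  have [measurable]: "Q \<in> sets borel" by (rule sets.countable) (simp_all add: Q)
  have "(\<integral>\<^sup>+ y. ennreal (k y) * indicator Q (K y) \<partial>unit_lebesgue)
      = (\<integral>\<^sup>+ l. indicator {0..K 1} l * indicator Q l \<partial>lborel)"
    by (rule nn_integral_K) measurable
  also have "\<dots> \<le> (\<integral>\<^sup>+ l. indicator Q l \<partial>lborel)"
    by (intro nn_integral_mono) (auto simp: indicator_def)
  also have "\<dots> = 0" using Q by (simp add: emeasure_lborel_countable)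
  finally have "AE y in unit_lebesgue. ennreal (k y) * indicator Q (K y) = 0"
    by (subst (asm) le_zero_eq, subst (asm) nn_integral_0_iff_AE) auto
  then show ?thesis
    using AE_space
  proof eventually_elim
    case (elim y)
    show ?case
    proof (intro impI ballI, rule ccontr)
      fix u assume *: "k y > 0" "u \<in> {0..1}" "K u = K y" "u \<noteq> y"
      then have "min u y < max u y" by auto
      then obtain r where r: "r \<in> \<rat>" "min u y < r" "r < max u y"
        using Rats_dense_in_real by blast
      have "r \<in> {0..1}" using r * elim by auto
      moreover have "K r = K y"
        using r * K_mono[of "min u y" r] K_mono[of r "max u y"] by (auto simp: min_def max_def split: if_splits)
      ultimately have "K y \<in> Q" using r unfolding Q_def by (metis IntI image_eqI)
      then show False using elim * by simp
    qed
  qed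
qed

end


section \<open>Pairing excess with deficit\<close>

locale subuniform =
  fixes f :: "real \<Rightarrow> real"
  assumes mono: "mono f"
    and range: "0 \<le> f x" "f x \<le> 1"
    and partial: "t \<in> {0..1} \<Longrightarrow> t\<^sup>2 / 2 \<le> (LINT s|unit_lebesgue. f s * indicator {..t} s)"
    and total: "(LINT s|unit_lebesgue. f s * indicator {..1} s) = 1 / 2"
begin

lemma f_measurable [measurable]: "f \<in> borel_measurable borel"
  by (rule borel_measurable_mono) (rule mono)

definition excess :: "real \<Rightarrow> real" where "excess x = max 0 (f x - x)"
definition deficit :: "real \<Rightarrow> real" where "deficit x = max 0 (x - f x)"

sublocale up: density_on_unit excess 1
proof
  show "excess \<in> borel_measurable borel" unfolding excess_def[abs_def] by measurable
  show "excess x \<le> 1" if "0 \<le> x" for x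
    using range(2)[of x] that by (auto simp: excess_def)
qed (simp add: excess_def)

sublocale down: density_on_unit deficit 1
proof
  show "deficit \<in> borel_measurable borel" unfolding deficit_def[abs_def] by measurable
  show "deficit x \<le> 1" if "x \<le> 1" for x
    using range(1)[of x] that by (auto simp: deficit_def)
qed (simp add: deficit_def)

lemma integral_id_atMost:
  assumes "t \<in> {0..1}"
  shows "(LINT s|unit_lebesgue. s * indicator {..t} s) = t\<^sup>2 / 2"
proof -
  have "(LINT s|unit_lebesgue. s * indicator {..t} s) = (LINT s|lebesgue. s ^ 1 * indicator {0..t} s)"
    using assms by (subst integral_restrict_space) (auto intro!: Bochner_Integration.integral_cong simp: indicator_def)
  also have "\<dots> = (LINT s|lborel. s ^ 1 * indicator {0..t} s)"
    by (rule integral_completion) (simp add: borel_measurable_times)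
  also have "\<dots> = t\<^sup>2 / 2"
    using assms by (subst integral_power) (auto simp: power2_eq_square)
  finally show ?thesis .
qed

text \<open>Since \<open>excess x - deficit x = f x - x\<close>, the gap between the two cumulated
  masses is exactly the slack of condition I on the initial segment [0,t].\<close>

lemma up_minus_down:
  assumes "t \<in> {0..1}"
  shows "up.K t - down.K t = (LINT s|unit_lebesgue. f s * indicator {..t} s) - t\<^sup>2 / 2"
proof -
  have int: "integrable unit_lebesgue (\<lambda>s. h s * indicator {..t} s)"
    if "h \<in> borel_measurable borel" "\<And>x. x \<in> {0..1} \<Longrightarrow> \<bar>h x\<bar> \<le> 1" for h :: "real \<Rightarrow> real"
  proof (rule integrable_unit_bounded[where B = 1])
    show "(\<lambda>s. h s * indicator {..t} s) \<in> borel_measurable unit_lebesgue"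
      by (intro borel_imp_unit_measurable borel_measurable_times that) auto
  qed (use that in \<open>auto simp: indicator_def\<close>)
  have "up.K t - down.K t = (LINT s|unit_lebesgue. excess s * indicator {..t} s - deficit s * indicator {..t} s)"
    unfolding up.K_def down.K_def
    by (rule Bochner_Integration.integral_diff[symmetric]) (auto intro: up.integrable_k_indicator down.integrable_k_indicator)
  also have "\<dots> = (LINT s|unit_lebesgue. f s * indicator {..t} s - s * indicator {..t} s)"
    by (intro Bochner_Integration.integral_cong) (auto simp: excess_def deficit_def max_def indicator_def)
  also have "\<dots> = (LINT s|unit_lebesgue. f s * indicator {..t} s) - (LINT s|unit_lebesgue. s * indicator {..t} s)"
    using range by (intro Bochner_Integration.integral_diff int) auto
  finally show ?thesis using integral_id_atMost[OF assms] by simp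
qed

lemma down_le_up: "t \<in> {0..1} \<Longrightarrow> down.K t \<le> up.K t"
  using up_minus_down[of t] partial[of t] by simp

lemma down_eq_up: "down.K 1 = up.K 1"
  using up_minus_down[of 1] total by simp

text \<open>Generalized inverses of \<open>up.K\<close> and, next, of \<open>down.K\<close>. The
  leftmost point is taken for the excess and the rightmost one for the deficit: these choices bound
  \<open>partner\<close> at every point and not just almost everywhere. The inserted 1 and 0 keep
  the values in [0,1] at all levels.\<close>

definition up_inv :: "real \<Rightarrow> real" where
  "up_inv l = Inf (insert 1 {u \<in> {0..1}. l \<le> up.K u})"

definition down_inv :: "real \<Rightarrow> real" where
  "down_inv l = Sup (insert 0 {u \<in> {0..1}. down.K u \<le> l})"

lemma up_inv_le: "u \<in> {0..1} \<Longrightarrow> l \<le> up.K u \<Longrightarrow> up_inv l \<le> u"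
  unfolding up_inv_def by (rule cInf_lower) (auto intro!: bdd_belowI[of _ 0])

lemma down_inv_ge: "u \<in> {0..1} \<Longrightarrow> down.K u \<le> l \<Longrightarrow> u \<le> down_inv l"
  unfolding down_inv_def by (rule cSup_upper) (auto intro!: bdd_aboveI[of _ 1])

lemma up_inv_range: "up_inv l \<in> {0..1}"
proof -
  have "0 \<le> up_inv l" unfolding up_inv_def by (rule cInf_greatest) auto
  moreover have "up_inv l \<le> 1" unfolding up_inv_def by (rule cInf_lower) (auto intro!: bdd_belowI[of _ 0])
  ultimately show ?thesis by simp
qed

lemma down_inv_range: "down_inv l \<in> {0..1}"
proof -
  have "down_inv l \<le> 1" unfolding down_inv_def by (rule cSup_least) auto
  moreover have "0 \<le> down_inv l" unfolding down_inv_def by (rule cSup_upper) (auto intro!: bdd_aboveI[of _ 1])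
  ultimately show ?thesis by simp
qed

lemma up_inv_measurable [measurable]: "up_inv \<in> borel_measurable borel"
  by (rule borel_measurable_mono, rule monoI, unfold up_inv_def, rule cInf_superset_mono)
    (auto intro!: bdd_belowI[of _ 0])

lemma down_inv_measurable [measurable]: "down_inv \<in> borel_measurable borel"
  by (rule borel_measurable_mono, rule monoI, unfold down_inv_def, rule cSup_subset_mono)
    (auto intro!: bdd_aboveI[of _ 1])

lemma up_inv_K:
  assumes y: "y \<in> {0..1}" and inj: "\<forall>u\<in>{0..1}. up.K u = up.K y \<longrightarrow> u = y"
  shows "up_inv (up.K y) = y"
proof -
  define S where "S = {u \<in> {0..1}. up.K y \<le> up.K u}"
  have S: "S = {0..1} \<inter> up.K -` {up.K y..}" by (auto simp: S_def)
  have "y \<in> S" using y by (simp add: S_def)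
  have "closed S" unfolding S by (rule continuous_closed_preimage[OF up.K_continuous]) auto
  moreover have "bdd_below S" by (auto simp: S_def bdd_below_def)
  ultimately have I: "Inf S \<in> S" "Inf S \<le> y"
    using \<open>y \<in> S\<close> closed_contains_Inf cInf_lower by blast+
  then have "up.K (Inf S) = up.K y" using up.K_mono[of "Inf S" y] by (auto simp: S_def)
  then have "Inf S = y" using inj I by (auto simp: S_def)
  moreover have "Inf (insert 1 S) = Inf S"
    using \<open>y \<in> S\<close> y I \<open>bdd_below S\<close> by (subst cInf_insert) (auto simp: inf_real_def)
  ultimately show ?thesis unfolding up_inv_def S_def by simp
qed

lemma down_inv_K:
  assumes y: "y \<in> {0..1}" and inj: "\<forall>u\<in>{0..1}. down.K u = down.K y \<longrightarrow> u = y"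
  shows "down_inv (down.K y) = y"
proof -
  define S where "S = {u \<in> {0..1}. down.K u \<le> down.K y}"
  have S: "S = {0..1} \<inter> down.K -` {..down.K y}" by (auto simp: S_def)
  have "y \<in> S" using y by (simp add: S_def)
  have "closed S" unfolding S by (rule continuous_closed_preimage[OF down.K_continuous]) auto
  moreover have "bdd_above S" by (auto simp: S_def bdd_above_def)
  ultimately have I: "Sup S \<in> S" "y \<le> Sup S"
    using \<open>y \<in> S\<close> closed_contains_Sup cSup_upper by blast+
  then have "down.K (Sup S) = down.K y" using down.K_mono[of y "Sup S"] by (auto simp: S_def)
  then have "Sup S = y" using inj I by (auto simp: S_def)
  moreover have "Sup (insert 0 S) = Sup S"
    using \<open>y \<in> S\<close> y I \<open>bdd_above S\<close> by (subst cSup_insert) (auto simp: sup_real_def)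
  ultimately show ?thesis unfolding down_inv_def S_def by simp
qed

text \<open>\<open>Z\<^sub>x\<close> is \<open>partner x\<close> with probability \<open>jump x\<close> and \<open>x\<close> otherwise.  The partner of a point
  with excess is the point with deficit at the same level of cumulated excess and deficit, so mass
  moved away from a point is replaced by its partner.  If \<open>f x = x\<close>, then \<open>jump x = 0 / 0 = 0\<close>.\<close>

definition partner :: "real \<Rightarrow> real" where
  "partner x = (if x < f x then down_inv (up.K x) else if f x < x then up_inv (down.K x) else x)"

definition jump :: "real \<Rightarrow> real" where
  "jump x = (f x - x) / (partner x - x)"

lemma partner_measurable [measurable]: "partner \<in> borel_measurable borel"
  unfolding partner_def[abs_def] by measurable

lemma jump_measurable [measurable]: "jump \<in> borel_measurable borel"
  unfolding jump_def[abs_def] by measurable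

lemma up_K_const:
  assumes "s \<le> t" "\<And>u. s < u \<Longrightarrow> u \<le> t \<Longrightarrow> f u \<le> u"
  shows "up.K s = up.K t"
proof -
  have "(LINT x|unit_lebesgue. excess x * indicator {s<..t} x) = (LINT x|unit_lebesgue. 0)"
  proof (rule Bochner_Integration.integral_cong)
    fix x show "excess x * indicator {s<..t} x = 0"
      using assms(2)[of x] by (cases "x \<in> {s<..t}") (auto simp: excess_def)
  qed simp
  then show ?thesis using up.K_diff[OF assms(1)] by simp
qed

lemma down_K_const:
  assumes "s \<le> t" "\<And>u. s < u \<Longrightarrow> u \<le> t \<Longrightarrow> u \<le> f u"
  shows "down.K s = down.K t"
proof -
  have "(LINT x|unit_lebesgue. deficit x * indicator {s<..t} x) = (LINT x|unit_lebesgue. 0)"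
  proof (rule Bochner_Integration.integral_cong)
    fix x show "deficit x * indicator {s<..t} x = 0"
      using assms(2)[of x] by (cases "x \<in> {s<..t}") (auto simp: deficit_def)
  qed simp
  then show ?thesis using down.K_diff[OF assms(1)] by simp
qed

text \<open>For u in (x, f x] monotonicity gives u \<le> f x \<le> f u, so no deficit accumulates
  there, and \<open>down.K (f x) = down.K x \<le> up.K x\<close> by condition I. The rightmost point
  whose cumulated deficit stays within \<open>up.K x\<close> is thus at or beyond f x.\<close>

lemma partner_up:
  assumes "x \<in> {0..1}" "x < f x"
  shows "f x \<le> partner x"
proof -
  have "down.K x = down.K (f x)"
    using assms monoD[OF mono] by (intro down_K_const) (auto intro: order.trans)
  then have "down.K (f x) \<le> up.K x" using down_le_up[OF assms(1)] by simp
  then have "f x \<le> down_inv (up.K x)" using range by (intro down_inv_ge) auto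
  then show ?thesis using assms by (simp add: partner_def)
qed

text \<open>The mirror image: for u in (f x, x] monotonicity gives f u \<le> f x < u, so no excess
  accumulates there.\<close>

lemma partner_down:
  assumes "x \<in> {0..1}" "f x < x"
  shows "partner x \<le> f x"
proof -
  have "f u \<le> u" if "f x < u" "u \<le> x" for u
    using monoD[OF mono that(2)] that by simp
  then have "up.K (f x) = up.K x" using assms by (intro up_K_const) auto
  then have "down.K x \<le> up.K (f x)" using down_le_up[OF assms(1)] by simp
  then have "up_inv (down.K x) \<le> f x" using range by (intro up_inv_le) auto
  then show ?thesis using assms by (simp add: partner_def)
qed

lemma partner_range: "x \<in> {0..1} \<Longrightarrow> partner x \<in> {0..1}"
  using up_inv_range down_inv_range by (auto simp: partner_def)

lemma jump_range:
  assumes "x \<in> {0..1}"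
  shows "jump x \<in> {0..1}"
  using partner_up[OF assms] partner_down[OF assms]
  by (cases "x < f x"; cases "f x < x") (auto simp: jump_def divide_simps)

lemma jump_mean:
  assumes "x \<in> {0..1}"
  shows "(1 - jump x) * x + jump x * partner x = f x"
proof -
  have "jump x * (partner x - x) = f x - x"
    using partner_up[OF assms] partner_down[OF assms]
    by (cases "x < f x"; cases "f x < x") (auto simp: jump_def)
  then show ?thesis by (simp add: algebra_simps)
qed

text \<open>Both sides become an integral over the common level l. Excess and deficit push forward
  to Lebesgue measure on the same interval, by \<open>down_eq_up\<close>, and at level l a point and
  its partner are \<open>up_inv l\<close> and \<open>down_inv l\<close>, except at levels of no
  mass.\<close>

lemma nn_integral_up_down:
  fixes \<Theta> :: "real \<Rightarrow> real \<Rightarrow> ennreal"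
  assumes [measurable]: "(\<lambda>l. \<Theta> (up_inv l) (down_inv l)) \<in> borel_measurable borel"
  shows "(\<integral>\<^sup>+ y. ennreal (excess y) * \<Theta> y (partner y) \<partial>unit_lebesgue)
       = (\<integral>\<^sup>+ y. ennreal (deficit y) * \<Theta> (partner y) y \<partial>unit_lebesgue)"
proof -
  let ?\<Phi> = "\<lambda>l. \<Theta> (up_inv l) (down_inv l)"
  have "(\<integral>\<^sup>+ y. ennreal (excess y) * \<Theta> y (partner y) \<partial>unit_lebesgue)
      = (\<integral>\<^sup>+ y. ennreal (excess y) * ?\<Phi> (up.K y) \<partial>unit_lebesgue)"
  proof (rule nn_integral_cong_AE)
    show "AE y in unit_lebesgue. ennreal (excess y) * \<Theta> y (partner y) = ennreal (excess y) * ?\<Phi> (up.K y)"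
      using up.AE_K_inj AE_space
    proof eventually_elim
      case (elim y)
      show ?case
      proof (cases "y < f y")
        case True
        then have "up_inv (up.K y) = y" using elim by (intro up_inv_K) (auto simp: excess_def)
        then show ?thesis using True by (simp add: partner_def)
      qed (simp add: excess_def)
    qed
  qed
  also have "\<dots> = (\<integral>\<^sup>+ y. ennreal (deficit y) * ?\<Phi> (down.K y) \<partial>unit_lebesgue)"
    unfolding up.nn_integral_K[OF assms] down.nn_integral_K[OF assms] down_eq_up ..
  also have "\<dots> = (\<integral>\<^sup>+ y. ennreal (deficit y) * \<Theta> (partner y) y \<partial>unit_lebesgue)"
  proof (rule nn_integral_cong_AE)
    show "AE y in unit_lebesgue. ennreal (deficit y) * ?\<Phi> (down.K y) = ennreal (deficit y) * \<Theta> (partner y) y"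
      using down.AE_K_inj AE_space
    proof eventually_elim
      case (elim y)
      show ?case
      proof (cases "f y < y")
        case True
        then have "down_inv (down.K y) = y" using elim by (intro down_inv_K) (auto simp: deficit_def)
        then show ?thesis using True by (simp add: partner_def)
      qed (simp add: deficit_def)
    qed
  qed
  finally show ?thesis .
qed

text \<open>Brings \<open>jump\<close> into the two forms to which
  \<open>nn_integral_up_down\<close> applies; at each y at most one of the summands is
  nonzero.\<close>

lemma ennreal_jump_mult:
  assumes that: "y \<in> {0..1}" "0 \<le> H"
  shows "ennreal (jump y * H) = ennreal (excess y) * ennreal (H / (partner y - y)) + ennreal (deficit y) * ennreal (H / (y - partner y))"
proof -
  consider "y < f y" | "f y < y" | "f y = y" by linarith
  then show ?thesis
  proof cases
    case 1
    then have d: "deficit y = 0" "excess y = f y - y" by (auto simp: excess_def deficit_def)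
    then have "jump y * H = excess y * (H / (partner y - y))" by (simp add: jump_def)
    moreover have "0 \<le> H / (partner y - y)" "0 \<le> excess y"
      using 1 partner_up[OF that(1)] that d by simp_all
    ultimately have "ennreal (jump y * H) = ennreal (excess y) * ennreal (H / (partner y - y))"
      by (simp only: ennreal_mult)
    then show ?thesis unfolding d(1) by simp
  next
    case 2
    then have d: "excess y = 0" "deficit y = y - f y" by (auto simp: excess_def deficit_def)
    have "jump y = deficit y / (y - partner y)"
      unfolding jump_def d by (subst minus_divide_divide[symmetric]) simp
    then have "jump y * H = deficit y * (H / (y - partner y))" by simp
    moreover have "0 \<le> H / (y - partner y)" "0 \<le> deficit y"
      using 2 partner_down[OF that(1)] that d by simp_all
    ultimately have "ennreal (jump y * H) = ennreal (deficit y) * ennreal (H / (y - partner y))"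
      by (simp only: ennreal_mult)
    then show ?thesis unfolding d(1) by simp
  qed (simp add: jump_def excess_def deficit_def)
qed

text \<open>This says that \<open>Z_y\<close> is uniform when y is. At a level with excess point a
  and deficit point b, mass moves from a to b and from b to a at the same rate 1/(b - a), so nothing
  is gained or lost at either point.\<close>

lemma mixture:
  fixes h :: "real \<Rightarrow> real"
  assumes h[measurable]: "h \<in> borel_measurable borel" and h01: "\<And>x. x \<in> {0..1} \<Longrightarrow> h x \<in> {0..1}"
  shows "(LINT y|unit_lebesgue. (1 - jump y) * h y + jump y * h (partner y)) = (LINT y|unit_lebesgue. h y)"
proof -
  have [measurable]: "excess \<in> borel_measurable borel" "deficit \<in> borel_measurable borel"
    by (rule up.k_measurable, rule down.k_measurable)
  have h0: "0 \<le> h x" if "x \<in> {0..1}" for x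
    using h01[OF that] by simp
  let ?up = "\<lambda>y. ennreal (excess y)" and ?down = "\<lambda>y. ennreal (deficit y)"
  have "(\<integral>\<^sup>+ y. ennreal (jump y * h (partner y)) \<partial>unit_lebesgue)
     = (\<integral>\<^sup>+ y. ?up y * ennreal (h (partner y) / (partner y - y)) + ?down y * ennreal (h (partner y) / (y - partner y)) \<partial>unit_lebesgue)"
    by (intro nn_integral_cong ennreal_jump_mult h0 partner_range) simp_all
  also have "\<dots> = (\<integral>\<^sup>+ y. ?up y * ennreal (h (partner y) / (partner y - y)) \<partial>unit_lebesgue)
      + (\<integral>\<^sup>+ y. ?down y * ennreal (h (partner y) / (y - partner y)) \<partial>unit_lebesgue)"
    by (rule nn_integral_add) (rule borel_imp_unit_measurable, measurable)+
  \<comment> \<open>Mass sent by excess points equals the mass that deficit points send away; the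
    next step is the same exchange in the other direction.\<close>
  also have "(\<integral>\<^sup>+ y. ?up y * ennreal (h (partner y) / (partner y - y)) \<partial>unit_lebesgue)
      = (\<integral>\<^sup>+ y. ?down y * ennreal (h y / (y - partner y)) \<partial>unit_lebesgue)"
    by (rule nn_integral_up_down[of "\<lambda>a b. ennreal (h b / (b - a))"]) measurable
  also have "(\<integral>\<^sup>+ y. ?down y * ennreal (h (partner y) / (y - partner y)) \<partial>unit_lebesgue)
      = (\<integral>\<^sup>+ y. ?up y * ennreal (h y / (partner y - y)) \<partial>unit_lebesgue)"
    by (rule nn_integral_up_down[of "\<lambda>a b. ennreal (h a / (b - a))", symmetric]) measurable
  also have "(\<integral>\<^sup>+ y. ?down y * ennreal (h y / (y - partner y)) \<partial>unit_lebesgue)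
      + (\<integral>\<^sup>+ y. ?up y * ennreal (h y / (partner y - y)) \<partial>unit_lebesgue)
      = (\<integral>\<^sup>+ y. ?down y * ennreal (h y / (y - partner y)) + ?up y * ennreal (h y / (partner y - y)) \<partial>unit_lebesgue)"
    by (rule nn_integral_add[symmetric]) (rule borel_imp_unit_measurable, measurable)+
  also have "\<dots> = (\<integral>\<^sup>+ y. ennreal (jump y * h y) \<partial>unit_lebesgue)"
    by (intro nn_integral_cong, subst add.commute, intro ennreal_jump_mult[symmetric] h0) simp_all
  finally have nn: "(\<integral>\<^sup>+ y. ennreal (jump y * h (partner y)) \<partial>unit_lebesgue) = (\<integral>\<^sup>+ y. ennreal (jump y * h y) \<partial>unit_lebesgue)" .
  have bnd: "0 \<le> jump y * h z \<and> \<bar>jump y * h z\<bar> \<le> 1" if "y \<in> {0..1}" "z \<in> {0..1}" for y z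
    using jump_range[OF that(1)] h01[OF that(2)] mult_le_one[of "jump y" "h z"] by simp
  have m1: "(\<lambda>y. jump y * h (partner y)) \<in> borel_measurable unit_lebesgue"
    and m2: "(\<lambda>y. jump y * h y) \<in> borel_measurable unit_lebesgue"
    by (rule borel_imp_unit_measurable, measurable)+
  have i1: "integrable unit_lebesgue (\<lambda>y. jump y * h (partner y))"
    by (rule integrable_unit_bounded[OF m1, where B = 1]) (use bnd partner_range in blast)
  have i2: "integrable unit_lebesgue (\<lambda>y. jump y * h y)"
    by (rule integrable_unit_bounded[OF m2, where B = 1]) (use bnd in blast)
  have i3: "integrable unit_lebesgue h"
    by (rule integrable_unit_bounded[OF borel_imp_unit_measurable[OF h], where B = 1]) (use h01 in force)
  have n1: "AE y in unit_lebesgue. 0 \<le> jump y * h (partner y)"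
    by (rule AE_unit_I) (use bnd partner_range in blast)
  have n2: "AE y in unit_lebesgue. 0 \<le> jump y * h y"
    by (rule AE_unit_I) (use bnd in blast)
  have eq: "(LINT y|unit_lebesgue. jump y * h (partner y)) = (LINT y|unit_lebesgue. jump y * h y)"
    unfolding integral_eq_nn_integral[OF m1 n1] integral_eq_nn_integral[OF m2 n2] nn ..
  have "(LINT y|unit_lebesgue. (1 - jump y) * h y + jump y * h (partner y))
      = (LINT y|unit_lebesgue. (h y - jump y * h y) + jump y * h (partner y))"
    by (simp only: left_diff_distrib mult_1_left)
  also have "\<dots> = (LINT y|unit_lebesgue. h y)"
    using i1 i2 i3 eq by simp
  finally show ?thesis .
qed

end

section \<open>A self-converse kernel with given score function\<close>

text \<open>The value 1/2 at a tie makes \<open>win_flip\<close> an identity for every pair of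
  points, so \<open>kernel_flip\<close> holds without an exceptional null set.\<close>

definition win :: "real \<Rightarrow> real" where
  "win d = (if 0 < d then 1 else if d = 0 then 1 / 2 else 0)"

lemma win_measurable [measurable]: "win \<in> borel_measurable borel"
  unfolding win_def[abs_def] by measurable

lemma win_range: "win d \<in> {0..1}"
  by (simp add: win_def)

lemma win_flip: "win (a - b) + win (b - a) = 1"
  by (simp add: win_def)

lemma integral_win:
  assumes "z \<in> {0..1}"
  shows "(LINT y|unit_lebesgue. win (z - y)) = z"
proof -
  have m: "(\<lambda>y. win (z - y)) \<in> borel_measurable unit_lebesgue"
      "(\<lambda>y. indicator {0<..z} y :: real) \<in> borel_measurable unit_lebesgue"
    by (rule borel_imp_unit_measurable, measurable)+
  have "AE y in lebesgue. y \<noteq> z \<and> y \<noteq> 0"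
    by (rule AE_completion) (use AE_lborel_singleton[of z] AE_lborel_singleton[of 0] in eventually_elim, simp)
  then have "AE y in unit_lebesgue. y \<noteq> z \<and> y \<noteq> 0"
    by (auto simp: AE_restrict_space_iff elim: eventually_mono)
  then have "AE y in unit_lebesgue. win (z - y) = indicator {0<..z} y"
    using AE_space by eventually_elim (auto simp: win_def)
  then have "(LINT y|unit_lebesgue. win (z - y)) = (LINT y|unit_lebesgue. indicator {0<..z} y)"
    by (intro integral_cong_AE m)
  also have "\<dots> = z"
  proof -
    have "{0<..z} \<inter> {0..1} = {0<..z}" using assms by auto
    then show ?thesis using emeasure_unit_Ioc[of 0 z] assms by (simp add: measure_def)
  qed
  finally show ?thesis .
qed

context subuniform
begin

text \<open>The probability that z exceeds \<open>Z_y\<close>, ties counting one half;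
  \<open>kernel\<close> averages this over \<open>Z_x\<close>, drawn independently of
  \<open>Z_y\<close>.\<close>

definition beats :: "real \<Rightarrow> real \<Rightarrow> real" where
  "beats z y = (1 - jump y) * win (z - y) + jump y * win (z - partner y)"

definition kernel :: "real \<Rightarrow> real \<Rightarrow> real" where
  "kernel x y = (1 - jump x) * beats x y + jump x * beats (partner x) y"

lemma kernel_borel: "(\<lambda>(x, y). kernel x y) \<in> borel_measurable (borel \<Otimes>\<^sub>M borel)"
  unfolding kernel_def beats_def by measurable

lemma convex_range:
  fixes a b t :: real
  assumes "a \<in> {0..1}" "b \<in> {0..1}" "t \<in> {0..1}"
  shows "(1 - t) * a + t * b \<in> {0..1}"
  using assms convex_bound_le[of a 1 b "1 - t" t] by simp

lemma beats_range: "y \<in> {0..1} \<Longrightarrow> beats z y \<in> {0..1}"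
  unfolding beats_def by (intro convex_range win_range jump_range)

lemma kernel_range: "x \<in> {0..1} \<Longrightarrow> y \<in> {0..1} \<Longrightarrow> kernel x y \<in> {0..1}"
  unfolding kernel_def by (intro convex_range beats_range jump_range)

lemma kernel_flip: "kernel x y + kernel y x = 1"
proof -
  have w: "win (b - a) = 1 - win (a - b)" for a b using win_flip[of a b] by simp
  show ?thesis unfolding kernel_def beats_def
    by (subst w[of x y], subst w[of "partner x" y], subst w[of x "partner y"], subst w[of "partner x" "partner y"])
      algebra
qed

lemma beats_measurable: "beats z \<in> borel_measurable unit_lebesgue"
  by (rule borel_imp_unit_measurable) (unfold beats_def[abs_def], measurable)

lemma integrable_beats: "integrable unit_lebesgue (beats z)"
  by (rule integrable_unit_bounded[OF beats_measurable, where B = 1]) (use beats_range in force)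

lemma integral_beats:
  assumes "z \<in> {0..1}"
  shows "(LINT y|unit_lebesgue. beats z y) = z"
proof -
  have "(LINT y|unit_lebesgue. beats z y) = (LINT y|unit_lebesgue. win (z - y))"
    unfolding beats_def by (rule mixture) (measurable, rule win_range)
  then show ?thesis using integral_win[OF assms] by simp
qed

text \<open>Against the uniform opponent \<open>Z_y\<close> a point z wins with probability z;
  averaging z over \<open>Z_x\<close> leaves its mean f x.\<close>

lemma kernel_score:
  assumes "x \<in> {0..1}"
  shows "(LINT y|unit_lebesgue. kernel x y) = f x"
  using integral_beats[OF assms] integral_beats[OF partner_range[OF assms]] jump_mean[OF assms]
  unfolding kernel_def by (simp add: integrable_beats)

lemma kernel_coscore:
  assumes "x \<in> {0..1}"
  shows "(LINT y|unit_lebesgue. kernel y x) = 1 - f x"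
proof -
  have "integrable unit_lebesgue (kernel x)"
    unfolding kernel_def[abs_def] by (simp add: integrable_beats)
  moreover have "kernel y x = 1 - kernel x y" for y using kernel_flip[of x y] by simp
  ultimately show ?thesis
    using kernel_score[OF assms] unit.prob_space by simp
qed

section \<open>Symmetrization by reversal combined with reflection\<close>

definition balanced :: "real set" where
  "balanced = {x. f x + f (1 - x) = 1}"

text \<open>The kernel (x, y) \<mapsto> \<open>kernel (1 - y) (1 - x)\<close> has score 1 - f (1 -
  x), which equals f x exactly on \<open>balanced\<close>. Elsewhere the constant row f x still
  gives the right score; under condition II this changes a null set of rows.\<close>

definition sym_kernel :: "real \<Rightarrow> real \<Rightarrow> real" where
  "sym_kernel x y = (if x \<in> balanced then (kernel x y + kernel (1 - y) (1 - x)) / 2 else f x)"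

lemma sym_kernel_borel: "(\<lambda>(x, y). sym_kernel x y) \<in> borel_measurable (borel \<Otimes>\<^sub>M borel)"
proof -
  note kernel_borel[measurable]
  have [measurable]: "(\<lambda>z. kernel (fst z) (snd z)) \<in> borel_measurable (borel \<Otimes>\<^sub>M borel)"
    using kernel_borel by (simp add: case_prod_beta')
  have "(\<lambda>z::real\<times>real. (1 - snd z, 1 - fst z)) \<in> borel \<Otimes>\<^sub>M borel \<rightarrow>\<^sub>M borel \<Otimes>\<^sub>M borel"
    by measurable
  from measurable_compose[OF this kernel_borel]
  have [measurable]: "(\<lambda>z. kernel (1 - snd z) (1 - fst z)) \<in> borel_measurable (borel \<Otimes>\<^sub>M borel)"
    by simp
  show ?thesis unfolding sym_kernel_def balanced_def case_prod_beta' mem_Collect_eq by measurable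
qed

lemma sym_kernel_score: "score_function sym_kernel f"
  unfolding score_function_def
proof
  fix x :: real assume x: "x \<in> {0..1}"
  then have x': "1 - x \<in> {0..1}" by simp
  show "(LINT y|unit_lebesgue. sym_kernel x y) = f x"
  proof (cases "x \<in> balanced")
    case True
    have i1: "integrable unit_lebesgue (kernel x)"
      unfolding kernel_def[abs_def] by (simp add: integrable_beats)
    have "(\<lambda>y. kernel y (1 - x)) = (\<lambda>y. 1 - kernel (1 - x) y)"
      using kernel_flip by (auto simp: eq_diff_eq)
    then have i2: "integrable unit_lebesgue (\<lambda>y. kernel y (1 - x))"
      unfolding kernel_def[abs_def] by (simp add: integrable_beats)
    have i3: "integrable unit_lebesgue (\<lambda>y. kernel (1 - y) (1 - x))"
      using integrable_distr[OF measurable_reflect_unit, of "\<lambda>y. kernel y (1 - x)"] i2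
      by (simp add: distr_reflect_unit)
    have "(LINT y|unit_lebesgue. kernel (1 - y) (1 - x)) = (LINT y|unit_lebesgue. kernel y (1 - x))"
      using i2 by (intro integral_reflect_unit[of "\<lambda>y. kernel y (1 - x)"]) auto
    then have "(LINT y|unit_lebesgue. kernel x y + kernel (1 - y) (1 - x)) = f x + (1 - f (1 - x))"
      using kernel_score[OF x] kernel_coscore[OF x'] i1 i3 by simp
    moreover have "1 - f (1 - x) = f x" using True by (simp add: balanced_def)
    ultimately show ?thesis using True by (simp add: sym_kernel_def)
  qed (simp add: sym_kernel_def unit.prob_space[simplified])
qed

context
  assumes bal: "AE x in unit_lebesgue. f x + f (1 - x) = 1"
begin

lemma AE_balanced: "AE x in unit_lebesgue. x \<in> balanced"
  using bal by (simp add: balanced_def)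

lemma sym_kernel_tournament: "tournament_kernel sym_kernel"
  unfolding tournament_kernel_def
proof (intro conjI ballI)
  show "(\<lambda>(x, y). sym_kernel x y) \<in> borel_measurable (unit_lebesgue \<Otimes>\<^sub>M unit_lebesgue)"
    by (rule borel_imp_unit_pair_measurable) (rule sym_kernel_borel)
  show "sym_kernel x y \<in> {0..1}" if "x \<in> {0..1}" "y \<in> {0..1}" for x y
    using kernel_range[OF that] kernel_range[of "1 - y" "1 - x"] that range by (auto simp: sym_kernel_def)
  show "AE (x, y) in unit_lebesgue \<Otimes>\<^sub>M unit_lebesgue. sym_kernel x y + sym_kernel y x = 1"
  proof (rule AE_unit_pair_I[OF AE_balanced])
    fix x y assume "x \<in> balanced" "y \<in> balanced"
    then show "sym_kernel x y + sym_kernel y x = 1"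
      using kernel_flip[of x y] kernel_flip[of "1 - x" "1 - y"] by (simp add: sym_kernel_def field_simps)
  qed
qed

text \<open>For balanced x and y, reflecting both arguments of \<open>sym_kernel\<close> has the
  same effect as swapping them, and reflection leaves all densities unchanged.\<close>

lemma sym_kernel_self_converse: "self_converse_kernel sym_kernel"
  unfolding self_converse_kernel_def equivalent_kernels_def
proof (intro allI impI)
  fix F :: dgraph assume F: "pair_digraph F"
  have m: "(\<lambda>(x, y). sym_kernel x y) \<in> borel_measurable (unit_lebesgue \<Otimes>\<^sub>M unit_lebesgue)"
    by (rule borel_imp_unit_pair_measurable) (rule sym_kernel_borel)
  have "(\<lambda>z::real\<times>real. (1 - fst z, 1 - snd z)) \<in> borel \<Otimes>\<^sub>M borel \<rightarrow>\<^sub>M borel \<Otimes>\<^sub>M borel"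
    by measurable
  from measurable_compose[OF this sym_kernel_borel]
  have m1: "(\<lambda>(x, y). sym_kernel (1 - x) (1 - y)) \<in> borel_measurable (unit_lebesgue \<Otimes>\<^sub>M unit_lebesgue)"
    by (intro borel_imp_unit_pair_measurable) (simp add: case_prod_beta')
  have "(\<lambda>z::real\<times>real. (snd z, fst z)) \<in> borel \<Otimes>\<^sub>M borel \<rightarrow>\<^sub>M borel \<Otimes>\<^sub>M borel"
    by measurable
  from measurable_compose[OF this sym_kernel_borel]
  have m2: "(\<lambda>(x, y). sym_kernel y x) \<in> borel_measurable (unit_lebesgue \<Otimes>\<^sub>M unit_lebesgue)"
    by (intro borel_imp_unit_pair_measurable) (simp add: case_prod_beta')
  have "kernel_density F sym_kernel = kernel_density F (\<lambda>x y. sym_kernel (1 - x) (1 - y))"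
    by (rule kernel_density_reflect[symmetric, OF m F])
  also have "\<dots> = kernel_density F (\<lambda>x y. sym_kernel y x)"
  proof (rule kernel_density_cong_AE[OF m1 m2 _ F], rule AE_unit_pair_I[OF AE_balanced])
    fix x y assume "x \<in> balanced" "y \<in> balanced"
    then show "sym_kernel (1 - x) (1 - y) = sym_kernel y x"
      by (simp add: sym_kernel_def balanced_def add.commute)
  qed
  finally show "kernel_density F sym_kernel = kernel_density F (\<lambda>x y. sym_kernel y x)" .
qed

end

end

lemma exists_self_converse_kernel:
  assumes range: "f \<in> {0..1} \<rightarrow> {0..1}" and mono: "mono_on {0..1} f"
    and I: "condition_I f" and II: "condition_II f"
  shows "\<exists>W. tournament_kernel W \<and> self_converse_kernel W \<and> score_function W f"
proof -
  \<comment> \<open>Clamping the argument extends f to a nondecreasing function on the whole line,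
    as \<open>subuniform\<close> demands.\<close>
  define g where "g x = f (max 0 (min 1 x))" for x :: real
  have g: "g x = f x" if "x \<in> {0..1}" for x using that by (simp add: g_def)
  have gm: "mono g" by (rule monoI, unfold g_def, rule mono_onD[OF mono]) auto
  have part: "(LINT s|unit_lebesgue. g s * indicator {..t} s) = (LINT x:{0..t}|lebesgue. f x)"
    if "t \<in> {0..1}" for t
    unfolding set_lebesgue_integral_def using that g
    by (subst integral_restrict_space) (auto intro!: Bochner_Integration.integral_cong simp: indicator_def)
  interpret subuniform g
  proof
    show "mono g" by (rule gm)
    show "0 \<le> g x" "g x \<le> 1" for x
      using range by (auto simp: g_def Pi_iff)
    show "t\<^sup>2 / 2 \<le> (LINT s|unit_lebesgue. g s * indicator {..t} s)" if t: "t \<in> {0..1}" for t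
    proof -
      \<comment> \<open>Condition I enters through the initial segments B = [0,t].\<close>
      have "{0..t} \<in> sets lebesgue" "{0..t} \<subseteq> {0..1}" using t by auto
      then have "(measure lebesgue {0..t})\<^sup>2 / 2 \<le> (LINT x:{0..t}|lebesgue. f x)"
        using I unfolding condition_I_def by blast
      then show ?thesis unfolding part[OF t] using t by simp
    qed
    show "(LINT s|unit_lebesgue. g s * indicator {..1} s) = 1 / 2"
    proof -
      have "{0..1::real} \<in> sets lebesgue" "{0..1::real} \<subseteq> {0..1}" "measure lebesgue {0..1::real} = 1" by auto
      then have "(LINT x:{0..1}|lebesgue. f x) = (measure lebesgue {0..1::real})\<^sup>2 / 2"
        using I unfolding condition_I_def by blast
      then show ?thesis using part[of 1] by simp
    qed
  qed
  have bal: "AE x in unit_lebesgue. g x + g (1 - x) = 1"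
    using II[unfolded condition_II_def] AE_space by eventually_elim (simp add: g)
  have "score_function sym_kernel f"
    using sym_kernel_score g by (simp add: score_function_def)
  then show ?thesis
    using sym_kernel_tournament[OF bal] sym_kernel_self_converse[OF bal] by blast
qed

section \<open>Sampling tournaments from a kernel\<close>

text \<open>The vertex type is arbitrary so that disjoint unions K <+> K are covered as well. The
  target digraph has vertices \<open>{..<n}\<close> and arc set A.\<close>

definition hom_maps :: "'a set \<Rightarrow> ('a \<times> 'a) set \<Rightarrow> nat \<Rightarrow> (nat \<times> nat) set \<Rightarrow> ('a \<Rightarrow> nat) set" where
  "hom_maps K E n A = {\<phi> \<in> K \<rightarrow>\<^sub>E {..<n}. \<forall>(u, v)\<in>E. (\<phi> u, \<phi> v) \<in> A}"

definition map_density :: "'a set \<Rightarrow> ('a \<times> 'a) set \<Rightarrow> nat \<Rightarrow> (nat \<times> nat) set \<Rightarrow> real" where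
  "map_density K E n A = real (card (hom_maps K E n A)) / real n ^ card K"

definition kernel_map_density :: "'a set \<Rightarrow> ('a \<times> 'a) set \<Rightarrow> (real \<Rightarrow> real \<Rightarrow> real) \<Rightarrow> real" where
  "kernel_map_density K E W = (LINT x|PiM K (\<lambda>_. unit_lebesgue). (\<Prod>(i, j)\<in>E. W (x i) (x j)))"

text \<open>No 2-cycles; the case u = v also excludes loops.\<close>

definition oriented :: "('a \<times> 'a) set \<Rightarrow> bool" where
  "oriented E \<longleftrightarrow> (\<forall>u v. (u, v) \<in> E \<longrightarrow> (v, u) \<notin> E)"

definition pairs :: "nat \<Rightarrow> (nat \<times> nat) set" where
  "pairs n = {(i, j). i < j \<and> j < n}"

text \<open>X holds the pairs directed from the smaller to the larger vertex, so subsets of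
  \<open>pairs n\<close> enumerate the tournaments on \<open>{..<n}\<close>.\<close>

definition orient :: "nat \<Rightarrow> (nat \<times> nat) set \<Rightarrow> (nat \<times> nat) set" where
  "orient n X = X \<union> (pairs n - X)\<inverse>"

section \<open>Counting orientations and vertex maps\<close>

lemma finite_pairs [simp]: "finite (pairs n)"
  by (rule finite_subset[of _ "{..<n} \<times> {..<n}"]) (auto simp: pairs_def)

lemma tournament_orient:
  assumes "X \<subseteq> pairs n"
  shows "tournament \<lparr>pverts = {..<n}, parcs = orient n X\<rparr>"
proof -
  have X: "i < j" "i < n" "j < n" if "(i, j) \<in> X" for i j
    using that assms by (auto simp: pairs_def)
  have "pair_digraph \<lparr>pverts = {..<n}, parcs = orient n X\<rparr>"
  proof
    have "finite X" using finite_subset[OF assms finite_pairs] .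
    then show "finite (parcs \<lparr>pverts = {..<n}, parcs = orient n X\<rparr>)" by (simp add: orient_def)
  qed (auto simp: orient_def pairs_def dest: X)
  moreover have "(v, u) \<notin> X" if "(u, v) \<in> X" for u v
    using X(1)[of u v] X(1)[of v u] that by auto
  ultimately show ?thesis
    by (auto simp: tournament_def orient_def pairs_def dest: X)
qed

text \<open>The probability that a tournament with independent arcs contains E. The event is
  absorbed into the factors by setting the probability of each forbidden direction to 0; the sum
  over all X then factors over the pairs, and a pair not touched by E contributes p + (1 - p) =
  1.\<close>

lemma orient_sum:
  fixes p :: "nat \<times> nat \<Rightarrow> real"
  assumes E: "E \<subseteq> {..<n} \<times> {..<n}" "oriented E"
  shows "(\<Sum>X\<in>Pow (pairs n). (\<Prod>e\<in>X. p e) * (\<Prod>e\<in>pairs n - X. 1 - p e) * of_bool (E \<subseteq> orient n X))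
       = (\<Prod>(i, j)\<in>E. if i < j then p (i, j) else 1 - p (j, i))"
proof -
  have fE: "finite E" using E(1) by (rule finite_subset) simp
  have nl: "(i, i) \<notin> E" for i using E(2) by (auto simp: oriented_def)
  \<comment> \<open>\<open>S\<close> collects the pairs that E forces upwards, \<open>T\<close>
    those that it forces downwards.\<close>
  define S where "S = pairs n \<inter> E"
  define T where "T = pairs n \<inter> E\<inverse>"
  have ST: "S \<inter> T = {}" using E(2) by (auto simp: S_def T_def oriented_def)
  have SS: "S \<subseteq> pairs n" "T \<subseteq> pairs n" by (auto simp: S_def T_def)
  have fin: "finite S" "finite T" using SS finite_subset finite_pairs by blast+
  have EST: "E = S \<union> T\<inverse>"
  proof (rule equalityI; rule subrelI)
    fix i j assume ij: "(i, j) \<in> E"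
    then have "i < n" "j < n" "i \<noteq> j" using E(1) nl by auto
    then show "(i, j) \<in> S \<union> T\<inverse>"
      using ij by (cases "i < j") (auto simp: S_def T_def pairs_def)
  qed (auto simp: S_def T_def)
  have iff: "E \<subseteq> orient n X \<longleftrightarrow> S \<subseteq> X \<and> T \<inter> X = {}" if "X \<in> Pow (pairs n)" for X
  proof -
    have lt: "i < j" if "(i, j) \<in> pairs n" for i j using that by (simp add: pairs_def)
    have XP: "X \<subseteq> pairs n" using that by simp
    show ?thesis
    proof (intro iffI conjI subrelI)
      fix i j assume sub: "E \<subseteq> orient n X" and ij: "(i, j) \<in> S"
      then have "(i, j) \<in> orient n X" "(j, i) \<notin> pairs n"
        using lt[of i j] lt[of j i] by (auto simp: S_def)
      then show "(i, j) \<in> X" by (simp add: orient_def)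
    next
      assume sub: "E \<subseteq> orient n X"
      have False if ij: "(i, j) \<in> T" "(i, j) \<in> X" for i j
      proof -
        have "(j, i) \<in> orient n X" "(j, i) \<notin> X"
          using ij sub lt[of i j] lt[of j i] XP by (auto simp: T_def)
        then show False using ij(2) by (simp add: orient_def)
      qed
      then show "T \<inter> X = {}" by auto
    next
      fix i j assume ST: "S \<subseteq> X \<and> T \<inter> X = {}" and ij: "(i, j) \<in> E"
      from ij have "(i, j) \<in> S \<or> (j, i) \<in> T" unfolding EST by simp
      then show "(i, j) \<in> orient n X"
        using ST SS by (auto simp: orient_def)
    qed
  qed
  define a where "a e = (if e \<in> T then 0 else p e)" for e
  define b where "b e = (if e \<in> S then 0 else 1 - p e)" for e
  have "(\<Prod>e\<in>X. p e) * (\<Prod>e\<in>pairs n - X. 1 - p e) * of_bool (E \<subseteq> orient n X) = (\<Prod>e\<in>X. a e) * (\<Prod>e\<in>pairs n - X. b e)"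
    if X: "X \<in> Pow (pairs n)" for X
  proof (cases "S \<subseteq> X \<and> T \<inter> X = {}")
    case True
    then have "(\<Prod>e\<in>X. a e) = (\<Prod>e\<in>X. p e)" "(\<Prod>e\<in>pairs n - X. b e) = (\<Prod>e\<in>pairs n - X. 1 - p e)"
      by (auto simp: a_def b_def intro!: prod.cong)
    then show ?thesis using True iff[OF X] by simp
  next
    case False
    have "finite X" using X finite_subset[OF _ finite_pairs] by blast
    have "(\<Prod>e\<in>X. a e) * (\<Prod>e\<in>pairs n - X. b e) = 0"
      using False SS \<open>finite X\<close> by (auto simp: a_def b_def)
    moreover have "of_bool (E \<subseteq> orient n X) = (0::real)" using False iff[OF X] by simp
    ultimately show ?thesis by (simp only: mult_zero_right)
  qed
  then have "(\<Sum>X\<in>Pow (pairs n). (\<Prod>e\<in>X. p e) * (\<Prod>e\<in>pairs n - X. 1 - p e) * of_bool (E \<subseteq> orient n X))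
      = (\<Prod>e\<in>pairs n. a e + b e)"
    by (simp add: prod_add)
  also have "\<dots> = (\<Prod>e\<in>S \<union> T. a e + b e)"
    using SS by (intro prod.mono_neutral_right) (auto simp: a_def b_def)
  also have "\<dots> = (\<Prod>e\<in>S. a e + b e) * (\<Prod>e\<in>T. a e + b e)"
    using ST fin by (intro prod.union_disjoint)
  also have "(\<Prod>e\<in>S. a e + b e) = (\<Prod>e\<in>S. p e)"
    using ST by (intro prod.cong) (auto simp: a_def b_def)
  also have "(\<Prod>e\<in>T. a e + b e) = (\<Prod>e\<in>T. 1 - p e)"
    using ST by (intro prod.cong) (auto simp: a_def b_def)
  also have "(\<Prod>e\<in>S. p e) = (\<Prod>(i, j)\<in>S. if i < j then p (i, j) else 1 - p (j, i))"
    by (intro prod.cong) (auto simp: S_def pairs_def)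
  also have "(\<Prod>e\<in>T. 1 - p e) = (\<Prod>(i, j)\<in>T\<inverse>. if i < j then p (i, j) else 1 - p (j, i))"
    by (rule prod.reindex_bij_witness[where i = prod.swap and j = prod.swap]) (auto simp: T_def pairs_def)
  also have "(\<Prod>(i, j)\<in>S. if i < j then p (i, j) else 1 - p (j, i)) * \<dots>
      = (\<Prod>(i, j)\<in>S \<union> T\<inverse>. if i < j then p (i, j) else 1 - p (j, i))"
    using fin by (intro prod.union_disjoint[symmetric]) (auto simp: S_def T_def pairs_def)
  finally show ?thesis unfolding EST[symmetric] .
qed

text \<open>A union bound over pairs u, v with equal images: such a map is determined by its
  restriction to K - {u}. The factor n on the left keeps the exponent \<open>card K - 1\<close> out
  of the statement.\<close>

lemma card_non_injective:
  assumes "finite K"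
  shows "card {\<phi> \<in> K \<rightarrow>\<^sub>E {..<n}. \<not> inj_on \<phi> K} * n \<le> (card K)\<^sup>2 * n ^ card K"
proof -
  let ?N = "{\<phi> \<in> K \<rightarrow>\<^sub>E {..<n}. \<not> inj_on \<phi> K}"
  let ?B = "\<lambda>(u, v). {\<phi> \<in> K \<rightarrow>\<^sub>E {..<n}. u \<noteq> v \<and> \<phi> u = \<phi> v}"
  have fin: "finite (K \<rightarrow>\<^sub>E {..<n})" using assms by (intro finite_PiE) auto
  have B: "card (?B e) * n \<le> n ^ card K" if "e \<in> K \<times> K" for e
  proof -
    from that obtain u v where e: "e = (u, v)" "u \<in> K" "v \<in> K" by auto
    show ?thesis
    proof (cases "u = v")
      case False
      let ?r = "\<lambda>\<phi>. restrict \<phi> (K - {u})"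
      have "inj_on ?r (?B e)"
      proof (rule inj_onI)
        fix \<phi> \<psi> assume *: "\<phi> \<in> ?B e" "\<psi> \<in> ?B e" "?r \<phi> = ?r \<psi>"
        have eq: "\<phi> k = \<psi> k" if "k \<in> K - {u}" for k
          using fun_cong[OF *(3), of k] that by simp
        have "\<phi> k = \<psi> k" if "k \<in> K" for k
          using eq[of k] eq[of v] that * e False by (cases "k = u") auto
        then show "\<phi> = \<psi>" using * by (intro PiE_ext[of _ K "\<lambda>_. {..<n}"]) (auto simp: e)
      qed
      moreover have "?r ` ?B e \<subseteq> (K - {u}) \<rightarrow>\<^sub>E {..<n}" by (auto simp: e PiE_iff split: if_splits)
      ultimately have "card (?B e) \<le> card ((K - {u}) \<rightarrow>\<^sub>E {..<n})"
        using assms by (intro card_inj_on_le finite_PiE) auto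
      also have "\<dots> = n ^ (card K - 1)" using assms e by (simp add: card_PiE)
      finally have "card (?B e) * n \<le> n ^ (card K - 1) * n" by simp
      also have "\<dots> = n ^ card K"
        using assms e by (metis card_gt_0_iff empty_iff mult.commute power_minus_mult)
      finally show ?thesis .
    qed (simp add: e)
  qed
  have "?N \<subseteq> (\<Union>e\<in>K \<times> K. ?B e)" by (auto simp: inj_on_def)
  then have "card ?N \<le> card (\<Union>e\<in>K \<times> K. ?B e)"
    using assms fin by (intro card_mono finite_UN_I) (auto intro: finite_subset[OF _ fin])
  also have "\<dots> \<le> (\<Sum>e\<in>K \<times> K. card (?B e))"
    using assms by (intro card_UN_le) auto
  finally have "card ?N * n \<le> (\<Sum>e\<in>K \<times> K. card (?B e) * n)"
    by (simp add: sum_distrib_right[symmetric])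
  also have "\<dots> \<le> (\<Sum>e\<in>K \<times> K. n ^ card K)" by (intro sum_mono B)
  also have "\<dots> = (card K)\<^sup>2 * n ^ card K"
    by (simp add: card_cartesian_product power2_eq_square)
  finally show ?thesis .
qed

text \<open>Two disjoint copies of a digraph: they turn second moments into densities.\<close>

definition sum_arcs :: "('a \<times> 'a) set \<Rightarrow> (('a + 'a) \<times> ('a + 'a)) set" where
  "sum_arcs E = map_prod Inl Inl ` E \<union> map_prod Inr Inr ` E"

lemma oriented_sum_arcs: "oriented E \<Longrightarrow> oriented (sum_arcs E)"
  by (auto simp: oriented_def sum_arcs_def)

lemma sum_arcs_subset: "E \<subseteq> K \<times> K \<Longrightarrow> sum_arcs E \<subseteq> (K <+> K) \<times> (K <+> K)"
  by (auto simp: sum_arcs_def)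

lemma ball_sum_arcs:
  "(\<forall>(u, v)\<in>sum_arcs E. P u v) \<longleftrightarrow>
   (\<forall>(u, v)\<in>E. P (Inl u) (Inl v)) \<and> (\<forall>(u, v)\<in>E. P (Inr u) (Inr v))"
  by (auto simp: sum_arcs_def)

lemma map_density_square:
  assumes "finite K" "E \<subseteq> K \<times> K"
  shows "map_density (K <+> K) (sum_arcs E) n A = (map_density K E n A)\<^sup>2"
proof -
  let ?f = "\<lambda>\<phi>. (\<lambda>k\<in>K. \<phi> (Inl k), \<lambda>k\<in>K. \<phi> (Inr k))"
  let ?g = "\<lambda>(\<phi>, \<psi>). \<lambda>z\<in>K <+> K. case z of Inl k \<Rightarrow> \<phi> k | Inr k \<Rightarrow> \<psi> k"
  have EK: "a \<in> K" "b \<in> K" if "(a, b) \<in> E" for a b using that assms(2) by auto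
  have "bij_betw ?f (hom_maps (K <+> K) (sum_arcs E) n A) (hom_maps K E n A \<times> hom_maps K E n A)"
  proof (rule bij_betw_byWitness[where f' = ?g])
    show "\<forall>\<phi>\<in>hom_maps (K <+> K) (sum_arcs E) n A. ?g (?f \<phi>) = \<phi>"
    proof
      fix \<phi> assume "\<phi> \<in> hom_maps (K <+> K) (sum_arcs E) n A"
      then have "\<phi> z = undefined" if "z \<notin> K <+> K" for z
        using that by (auto simp: hom_maps_def dest: PiE_arb)
      then show "?g (?f \<phi>) = \<phi>" by (auto simp: fun_eq_iff restrict_def split: sum.split)
    qed
    show "\<forall>z\<in>hom_maps K E n A \<times> hom_maps K E n A. ?f (?g z) = z"
    proof
      fix z assume z: "z \<in> hom_maps K E n A \<times> hom_maps K E n A"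
      obtain \<phi> \<psi> where [simp]: "z = (\<phi>, \<psi>)" by (cases z)
      have "\<phi> k = undefined" "\<psi> k = undefined" if "k \<notin> K" for k
        using that z by (auto simp: hom_maps_def dest: PiE_arb)
      then show "?f (?g z) = z" by (auto simp: fun_eq_iff restrict_def)
    qed
    show "?f ` hom_maps (K <+> K) (sum_arcs E) n A \<subseteq> hom_maps K E n A \<times> hom_maps K E n A"
      unfolding hom_maps_def ball_sum_arcs by (auto simp: EK)
    show "?g ` (hom_maps K E n A \<times> hom_maps K E n A) \<subseteq> hom_maps (K <+> K) (sum_arcs E) n A"
      unfolding hom_maps_def ball_sum_arcs by (auto simp: EK)
  qed
  then have "card (hom_maps (K <+> K) (sum_arcs E) n A) = card (hom_maps K E n A) * card (hom_maps K E n A)"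
    by (simp add: bij_betw_same_card card_cartesian_product)
  then show ?thesis
    using assms(1) by (simp add: map_density_def card_Plus power_add power2_eq_square)
qed

section \<open>Kernel densities over arbitrary vertex types\<close>

lemma PiM_reindex_integral:
  fixes h :: "('a \<Rightarrow> real) \<Rightarrow> real"
  assumes "inj_on \<phi> K" "\<phi> ` K \<subseteq> J" "h \<in> borel_measurable (PiM K (\<lambda>_. unit_lebesgue))"
  shows "(LINT x|PiM J (\<lambda>_. unit_lebesgue). h (\<lambda>k\<in>K. x (\<phi> k))) = (LINT x|PiM K (\<lambda>_. unit_lebesgue). h x)"
proof -
  have d: "distr (PiM J (\<lambda>_. unit_lebesgue)) (PiM K (\<lambda>_. unit_lebesgue)) (\<lambda>x. \<lambda>k\<in>K. x (\<phi> k)) = PiM K (\<lambda>_. unit_lebesgue)"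
    using distr_PiM_reindex[of J "\<lambda>_. unit_lebesgue" \<phi> K] assms(1,2) unit.prob_space_axioms by auto
  have "(\<lambda>x. \<lambda>k\<in>K. x (\<phi> k)) \<in> PiM J (\<lambda>_. unit_lebesgue) \<rightarrow>\<^sub>M PiM K (\<lambda>_. unit_lebesgue)"
    using assms(2) by (intro measurable_restrict measurable_component_singleton) auto
  from integral_distr[OF this assms(3)] show ?thesis unfolding d by simp
qed

text \<open>Instances are W and 1 - W in \<open>weight_integrand\<close>, and also tournament
  kernels, which are complementary only almost everywhere.\<close>

locale bounded_kernel =
  fixes W :: "real \<Rightarrow> real \<Rightarrow> real"
  assumes W_measurable: "(\<lambda>(x, y). W x y) \<in> borel_measurable (unit_lebesgue \<Otimes>\<^sub>M unit_lebesgue)"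
    and W_range: "x \<in> {0..1} \<Longrightarrow> y \<in> {0..1} \<Longrightarrow> W x y \<in> {0..1}"
begin

lemma prod_range:
  assumes "x \<in> space (PiM K (\<lambda>_. unit_lebesgue))" "E \<subseteq> K \<times> K"
  shows "0 \<le> (\<Prod>(i, j)\<in>E. W (x i) (x j))" "(\<Prod>(i, j)\<in>E. W (x i) (x j)) \<le> 1"
proof -
  have *: "W (x i) (x j) \<in> {0..1}" if "(i, j) \<in> E" for i j
  proof -
    have "i \<in> K" "j \<in> K" using assms(2) that by auto
    then have "x i \<in> {0..1}" "x j \<in> {0..1}" using assms(1) by (auto simp: space_PiM PiE_iff)
    then show ?thesis by (rule W_range)
  qed
  show "0 \<le> (\<Prod>(i, j)\<in>E. W (x i) (x j))" by (rule prod_nonneg) (use * in force)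
  show "(\<Prod>(i, j)\<in>E. W (x i) (x j)) \<le> 1" by (rule prod_le_1) (use * in force)
qed

lemma prod_integrable:
  assumes "E \<subseteq> K \<times> K"
  shows "integrable (PiM K (\<lambda>_. unit_lebesgue)) (\<lambda>x. \<Prod>(i, j)\<in>E. W (x i) (x j))"
proof -
  interpret P: prob_space "PiM K (\<lambda>_. unit_lebesgue)"
    by (intro prob_space_PiM unit.prob_space_axioms)
  show ?thesis
    by (rule P.integrable_const_bound[where B = 1])
      (use prod_range[OF _ assms] kernel_integrand_measurable[OF W_measurable assms] in \<open>auto intro!: AE_I2\<close>)
qed

lemma kernel_map_density_range:
  assumes "E \<subseteq> K \<times> K"
  shows "kernel_map_density K E W \<in> {0..1}"
proof -
  interpret P: prob_space "PiM K (\<lambda>_. unit_lebesgue)"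
    by (intro prob_space_PiM unit.prob_space_axioms)
  have "0 \<le> kernel_map_density K E W" unfolding kernel_map_density_def
    by (rule integral_nonneg_AE) (use prod_range[OF _ assms] in \<open>auto intro!: AE_I2\<close>)
  moreover have "kernel_map_density K E W \<le> 1" unfolding kernel_map_density_def
    by (rule P.integral_le_const[OF prod_integrable[OF assms]]) (use prod_range[OF _ assms] in \<open>auto intro!: AE_I2\<close>)
  ultimately show ?thesis by simp
qed

lemma kernel_map_density_reindex:
  assumes "inj_on \<phi> K" "\<phi> ` K \<subseteq> J" "E \<subseteq> K \<times> K"
  shows "(LINT x|PiM J (\<lambda>_. unit_lebesgue). (\<Prod>(i, j)\<in>E. W (x (\<phi> i)) (x (\<phi> j)))) = kernel_map_density K E W"
proof -
  have "(LINT x|PiM J (\<lambda>_. unit_lebesgue). (\<Prod>(i, j)\<in>E. W (x (\<phi> i)) (x (\<phi> j))))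
      = (LINT x|PiM J (\<lambda>_. unit_lebesgue). (\<Prod>(i, j)\<in>E. W ((\<lambda>k\<in>K. x (\<phi> k)) i) ((\<lambda>k\<in>K. x (\<phi> k)) j)))"
    using assms(3) by (intro Bochner_Integration.integral_cong prod.cong) auto
  also have "\<dots> = kernel_map_density K E W"
    unfolding kernel_map_density_def
    by (rule PiM_reindex_integral[OF assms(1,2), of "\<lambda>x. \<Prod>(i, j)\<in>E. W (x i) (x j)"])
      (rule kernel_integrand_measurable[OF W_measurable assms(3)])
  finally show ?thesis .
qed

text \<open>The points of the two copies are independent, so Fubini splits the integral into two
  equal factors.\<close>

lemma kernel_map_density_square:
  assumes K: "finite K" and E: "E \<subseteq> K \<times> K"
  shows "kernel_map_density (K <+> K) (sum_arcs E) W = (kernel_map_density K E W)\<^sup>2"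
proof -
  interpret P: product_sigma_finite "\<lambda>_::'a + 'a. unit_lebesgue" ..
  let ?I = "Inl ` K :: ('a + 'a) set" and ?J = "Inr ` K :: ('a + 'a) set"
  let ?g = "\<lambda>c x. \<Prod>(i, j)\<in>E. W (x (c i)) (x (c j))"
  have fE: "finite E" using K E by (meson finite_SigmaI finite_subset)
  have split: "(\<Prod>(i, j)\<in>sum_arcs E. W (x i) (x j)) = ?g Inl x * ?g Inr x" for x
  proof -
    have "(\<Prod>(i, j)\<in>sum_arcs E. W (x i) (x j))
        = (\<Prod>(i, j)\<in>map_prod Inl Inl ` E. W (x i) (x j)) * (\<Prod>(i, j)\<in>map_prod Inr Inr ` E. W (x i) (x j))"
      unfolding sum_arcs_def using fE by (intro prod.union_disjoint) auto
    also have "(\<Prod>(i, j)\<in>map_prod Inl Inl ` E. W (x i) (x j)) = ?g Inl x"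
      by (subst prod.reindex) (auto simp: inj_on_def case_prod_beta' intro!: prod.cong)
    also have "(\<Prod>(i, j)\<in>map_prod Inr Inr ` E. W (x i) (x j)) = ?g Inr x"
      by (subst prod.reindex) (auto simp: inj_on_def case_prod_beta' intro!: prod.cong)
    finally show ?thesis .
  qed
  have un: "K <+> K = ?I \<union> ?J" by (simp add: Plus_def)
  have "kernel_map_density (K <+> K) (sum_arcs E) W = (LINT x|PiM (?I \<union> ?J) (\<lambda>_. unit_lebesgue). ?g Inl x * ?g Inr x)"
    unfolding kernel_map_density_def split un ..
  also have "\<dots> = (LINT x|PiM ?I (\<lambda>_. unit_lebesgue). LINT y|PiM ?J (\<lambda>_. unit_lebesgue).
      ?g Inl (merge ?I ?J (x, y)) * ?g Inr (merge ?I ?J (x, y)))"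
  proof (rule P.product_integral_fold)
    show "integrable (PiM (?I \<union> ?J) (\<lambda>_. unit_lebesgue)) (\<lambda>x. ?g Inl x * ?g Inr x)"
      using prod_integrable[OF sum_arcs_subset[OF E]] unfolding split un .
  qed (use K in auto)
  also have "\<dots> = (LINT x|PiM ?I (\<lambda>_. unit_lebesgue). LINT y|PiM ?J (\<lambda>_. unit_lebesgue). ?g Inl x * ?g Inr y)"
  proof (intro Bochner_Integration.integral_cong refl arg_cong2[where f = "(*)"])
    fix x y :: "'a + 'a \<Rightarrow> real"
    show "?g Inl (merge ?I ?J (x, y)) = ?g Inl x"
      using E by (intro prod.cong) (auto simp: merge_def)
    show "?g Inr (merge ?I ?J (x, y)) = ?g Inr y"
      using E by (intro prod.cong) (auto simp: merge_def)
  qed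
  also have "\<dots> = kernel_map_density K E W * kernel_map_density K E W"
    using kernel_map_density_reindex[of Inl K ?I E] kernel_map_density_reindex[of Inr K ?J E] E by simp
  finally show ?thesis by (simp add: power2_eq_square)
qed

end

section \<open>The law of the random tournament and its densities\<close>

locale complementary_kernel = bounded_kernel +
  assumes W_flip: "x \<in> {0..1} \<Longrightarrow> y \<in> {0..1} \<Longrightarrow> W x y + W y x = 1"
begin

text \<open>The probability that the \<open>W\<close>-random tournament on \<open>{..<n}\<close> is \<open>orient n X\<close>.\<close>

definition weight :: "nat \<Rightarrow> (nat \<times> nat) set \<Rightarrow> real" where
  "weight n X = (LINT x|PiM {..<n} (\<lambda>_. unit_lebesgue).
     (\<Prod>(i, j)\<in>X. W (x i) (x j)) * (\<Prod>(i, j)\<in>pairs n - X. 1 - W (x i) (x j)))"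

lemma weight_integrand:
  assumes "X \<subseteq> pairs n"
  defines "h \<equiv> \<lambda>x. (\<Prod>(i, j)\<in>X. W (x i) (x j)) * (\<Prod>(i, j)\<in>pairs n - X. 1 - W (x i) (x j))"
  shows "integrable (PiM {..<n} (\<lambda>_. unit_lebesgue)) h"
    and "x \<in> space (PiM {..<n} (\<lambda>_. unit_lebesgue)) \<Longrightarrow> 0 \<le> h x"
proof -
  interpret P: prob_space "PiM {..<n} (\<lambda>_. unit_lebesgue)"
    by (intro prob_space_PiM unit.prob_space_axioms)
  interpret co: bounded_kernel "\<lambda>x y. 1 - W x y"
  proof
    show "(\<lambda>(x, y). 1 - W x y) \<in> borel_measurable (unit_lebesgue \<Otimes>\<^sub>M unit_lebesgue)"
      using borel_measurable_diff[OF borel_measurable_const W_measurable, of 1] by (simp add: case_prod_beta')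
    show "1 - W x y \<in> {0..1}" if "x \<in> {0..1}" "y \<in> {0..1}" for x y using W_range[OF that] by simp
  qed
  have sub: "X \<subseteq> {..<n} \<times> {..<n}" "pairs n - X \<subseteq> {..<n} \<times> {..<n}"
    using assms by (auto simp: pairs_def)
  show pos: "0 \<le> h x" if "x \<in> space (PiM {..<n} (\<lambda>_. unit_lebesgue))" for x
    unfolding h_def by (intro mult_nonneg_nonneg prod_range(1)[OF that sub(1)] co.prod_range(1)[OF that sub(2)])
  have le1: "h x \<le> 1" if "x \<in> space (PiM {..<n} (\<lambda>_. unit_lebesgue))" for x
    unfolding h_def using prod_range[OF that sub(1)] co.prod_range[OF that sub(2)] by (intro mult_le_one)
  show "integrable (PiM {..<n} (\<lambda>_. unit_lebesgue)) h"
  proof (rule P.integrable_const_bound[where B = 1])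
    show "h \<in> borel_measurable (PiM {..<n} (\<lambda>_. unit_lebesgue))"
      unfolding h_def
      by (intro borel_measurable_times kernel_integrand_measurable[OF W_measurable] kernel_integrand_measurable[OF co.W_measurable] sub)
  qed (use pos le1 in \<open>auto intro!: AE_I2\<close>)
qed

lemma weight_nonneg: "X \<subseteq> pairs n \<Longrightarrow> 0 \<le> weight n X"
  unfolding weight_def by (rule integral_nonneg_AE) (auto intro!: AE_I2 weight_integrand(2))

text \<open>Given the points x, the arcs are independent, and \<open>orient_sum\<close> yields the
  conditional probability that the tournament contains E; integrating over x gives the
  claim.\<close>

lemma weight_subset:
  assumes E: "E \<subseteq> {..<n} \<times> {..<n}" "oriented E"
  shows "(\<Sum>X\<in>Pow (pairs n). weight n X * of_bool (E \<subseteq> orient n X)) = kernel_map_density {..<n} E W"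
proof -
  let ?h = "\<lambda>X x. (\<Prod>(i, j)\<in>X. W (x i) (x j)) * (\<Prod>(i, j)\<in>pairs n - X. 1 - W (x i) (x j))"
  have "(\<Sum>X\<in>Pow (pairs n). weight n X * of_bool (E \<subseteq> orient n X))
      = (\<Sum>X\<in>Pow (pairs n). LINT x|PiM {..<n} (\<lambda>_. unit_lebesgue). ?h X x * of_bool (E \<subseteq> orient n X))"
    unfolding weight_def by simp
  also have "\<dots> = (LINT x|PiM {..<n} (\<lambda>_. unit_lebesgue). (\<Sum>X\<in>Pow (pairs n). ?h X x * of_bool (E \<subseteq> orient n X)))"
    using weight_integrand(1) by (intro Bochner_Integration.integral_sum[symmetric] integrable_mult_left) auto
  also have "\<dots> = kernel_map_density {..<n} E W"
    unfolding kernel_map_density_def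
  proof (rule Bochner_Integration.integral_cong[OF refl])
    fix x assume x: "x \<in> space (PiM {..<n} (\<lambda>_. unit_lebesgue))"
    have xi: "x i \<in> {0..1}" if "i < n" for i using x that by (auto simp: space_PiM PiE_iff)
    have "(\<Sum>X\<in>Pow (pairs n). ?h X x * of_bool (E \<subseteq> orient n X))
        = (\<Prod>(i, j)\<in>E. if i < j then W (x i) (x j) else 1 - W (x j) (x i))"
      using orient_sum[OF E, of "\<lambda>e. W (x (fst e)) (x (snd e))"] by (simp add: split_beta cong: if_cong)
    \<comment> \<open>For i > j the arc from i to j is the complement of the arc chosen with
      probability \<open>W (x j) (x i)\<close>; \<open>W_flip\<close> turns this back into
      \<open>W (x i) (x j)\<close>.\<close>
    also have "\<dots> = (\<Prod>(i, j)\<in>E. W (x i) (x j))"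
    proof (intro prod.cong refl, clarify)
      fix i j assume "(i, j) \<in> E"
      then have "i < n" "j < n" using E(1) by auto
      then show "(if i < j then W (x i) (x j) else 1 - W (x j) (x i)) = W (x i) (x j)"
        using W_flip[OF xi xi, of i j] by simp
    qed
    finally show "(\<Sum>X\<in>Pow (pairs n). ?h X x * of_bool (E \<subseteq> orient n X)) = (\<Prod>(i, j)\<in>E. W (x i) (x j))" .
  qed
  finally show ?thesis .
qed

lemma weight_sum: "(\<Sum>X\<in>Pow (pairs n). weight n X) = 1"
proof -
  interpret P: prob_space "PiM {..<n} (\<lambda>_. unit_lebesgue)"
    by (intro prob_space_PiM unit.prob_space_axioms)
  show ?thesis
    using weight_subset[of "{}" n] P.prob_space by (simp add: oriented_def kernel_map_density_def)
qed

text \<open>Injectivity gives every vertex of K its own independent point and keeps the image of E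
  oriented, so an injective map is a homomorphism with probability exactly the kernel
  density.\<close>

lemma weight_hom:
  assumes E: "E \<subseteq> K \<times> K" "oriented E" and \<phi>: "\<phi> \<in> K \<rightarrow> {..<n}" "inj_on \<phi> K"
  shows "(\<Sum>X\<in>Pow (pairs n). weight n X * of_bool (\<forall>(u, v)\<in>E. (\<phi> u, \<phi> v) \<in> orient n X)) = kernel_map_density K E W"
proof -
  let ?E = "map_prod \<phi> \<phi> ` E"
  have EK: "u \<in> K" "v \<in> K" if "(u, v) \<in> E" for u v using that E(1) by auto
  have inj: "inj_on (map_prod \<phi> \<phi>) E"
    using E(1) by (intro inj_on_subset[OF map_prod_inj_on[OF \<phi>(2) \<phi>(2)]])
  have sub: "?E \<subseteq> {..<n} \<times> {..<n}" using \<phi>(1) EK by fastforce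
  have "oriented ?E"
    unfolding oriented_def
  proof (intro allI impI notI)
    fix a b assume "(a, b) \<in> ?E" "(b, a) \<in> ?E"
    then obtain u v u' v' where *: "(u, v) \<in> E" "(u', v') \<in> E" "a = \<phi> u" "b = \<phi> v" "b = \<phi> u'" "a = \<phi> v'"
      by auto
    then have "v' = u" "u' = v" using \<phi>(2) EK by (auto dest: inj_onD)
    then show False using * E(2) by (auto simp: oriented_def)
  qed
  from weight_subset[OF sub this]
  have "(\<Sum>X\<in>Pow (pairs n). weight n X * of_bool (\<forall>(u, v)\<in>E. (\<phi> u, \<phi> v) \<in> orient n X)) = kernel_map_density {..<n} ?E W"
    by (simp add: image_subset_iff split_beta map_prod_def)
  also have "\<dots> = (LINT x|PiM {..<n} (\<lambda>_. unit_lebesgue). (\<Prod>(i, j)\<in>E. W (x (\<phi> i)) (x (\<phi> j))))"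
    unfolding kernel_map_density_def by (simp add: prod.reindex[OF inj] case_prod_beta' comp_def)
  also have "\<dots> = kernel_map_density K E W"
    using \<phi> E(1) by (intro kernel_map_density_reindex) auto
  finally show ?thesis .
qed

text \<open>Linearity of expectation over all maps: injective ones contribute the exact density, the
  others err by at most 1 each, and \<open>card_non_injective\<close> bounds their share.\<close>

lemma expected_map_density:
  assumes K: "finite K" and E: "E \<subseteq> K \<times> K" "oriented E" and n: "n > 0"
  shows "\<bar>(\<Sum>X\<in>Pow (pairs n). weight n X * map_density K E n (orient n X)) - kernel_map_density K E W\<bar> \<le> (real (card K))\<^sup>2 / n"
proof -
  let ?M = "K \<rightarrow>\<^sub>E {..<n}" and ?k = "card K" and ?t = "kernel_map_density K E W"
  let ?hom = "\<lambda>X \<phi>. of_bool (\<forall>(u, v)\<in>E. (\<phi> u, \<phi> v) \<in> orient n X) :: real"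
  define c where "c \<phi> = (\<Sum>X\<in>Pow (pairs n). weight n X * ?hom X \<phi>)" for \<phi>
  have fin: "finite ?M" using K by (intro finite_PiE) auto
  have cM: "real (card ?M) = real n ^ ?k" using K by (simp add: card_PiE)
  have t: "?t \<in> {0..1}" by (rule kernel_map_density_range[OF E(1)])
  have c: "c \<phi> \<in> {0..1}" for \<phi>
  proof -
    have "0 \<le> c \<phi>" unfolding c_def by (intro sum_nonneg mult_nonneg_nonneg weight_nonneg) auto
    moreover have "c \<phi> \<le> (\<Sum>X\<in>Pow (pairs n). weight n X)" unfolding c_def
      by (intro sum_mono) (use weight_nonneg in auto)
    ultimately show ?thesis using weight_sum by simp
  qed
  have hom: "real (card (hom_maps K E n A)) = (\<Sum>\<phi>\<in>?M. of_bool (\<forall>(u, v)\<in>E. (\<phi> u, \<phi> v) \<in> A))" for A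
    using fin unfolding hom_maps_def by (simp add: sum.If_cases of_bool_def Int_def)
  have "(\<Sum>X\<in>Pow (pairs n). weight n X * map_density K E n (orient n X))
      = (\<Sum>X\<in>Pow (pairs n). \<Sum>\<phi>\<in>?M. weight n X * ?hom X \<phi>) / real n ^ ?k"
    unfolding map_density_def hom by (simp add: sum_distrib_left sum_divide_distrib)
  also have "\<dots> = (\<Sum>\<phi>\<in>?M. c \<phi>) / real n ^ ?k"
    unfolding c_def by (subst sum.swap) simp
  finally have 1: "(\<Sum>X\<in>Pow (pairs n). weight n X * map_density K E n (orient n X)) = (\<Sum>\<phi>\<in>?M. c \<phi>) / real n ^ ?k" .
  have "(\<Sum>\<phi>\<in>?M. c \<phi> - ?t) = (\<Sum>\<phi>\<in>?M. c \<phi>) - real n ^ ?k * ?t"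
    by (simp add: sum_subtractf cM)
  then have "(\<Sum>\<phi>\<in>?M. c \<phi>) / real n ^ ?k - ?t = (\<Sum>\<phi>\<in>?M. c \<phi> - ?t) / real n ^ ?k"
    using n by (simp add: diff_divide_distrib)
  then have "\<bar>(\<Sum>\<phi>\<in>?M. c \<phi>) / real n ^ ?k - ?t\<bar> = \<bar>\<Sum>\<phi>\<in>?M. c \<phi> - ?t\<bar> / real n ^ ?k"
    by (simp add: abs_divide)
  also have "\<dots> \<le> (\<Sum>\<phi>\<in>?M. \<bar>c \<phi> - ?t\<bar>) / real n ^ ?k"
    by (intro divide_right_mono sum_abs) simp
  also have "(\<Sum>\<phi>\<in>?M. \<bar>c \<phi> - ?t\<bar>) \<le> (\<Sum>\<phi>\<in>?M. of_bool (\<not> inj_on \<phi> K))"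
  proof (rule sum_mono)
    fix \<phi> assume "\<phi> \<in> ?M"
    then have "inj_on \<phi> K \<Longrightarrow> c \<phi> = ?t" unfolding c_def by (intro weight_hom E) auto
    then show "\<bar>c \<phi> - ?t\<bar> \<le> of_bool (\<not> inj_on \<phi> K)" using c[of \<phi>] t by (auto simp: abs_le_iff)
  qed
  also have "\<dots> = real (card {\<phi> \<in> ?M. \<not> inj_on \<phi> K})"
    using fin by (simp add: sum.If_cases of_bool_def Int_def)
  also have "\<dots> / real n ^ ?k \<le> (real ?k)\<^sup>2 / n"
  proof -
    have "real (card {\<phi> \<in> ?M. \<not> inj_on \<phi> K}) * real n \<le> (real ?k)\<^sup>2 * real n ^ ?k"
      using card_non_injective[OF K, of n] by (simp flip: of_nat_mult of_nat_power)
    then show ?thesis using n by (simp add: field_simps)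
  qed
  finally show ?thesis unfolding 1 by (simp add: divide_right_mono)
qed

text \<open>The squared density is the density of two disjoint copies, so
  \<open>expected_map_density\<close> also controls the second moment. The constant is 6 = 4 + 2:
  the doubled digraph has \<open>2 * card K\<close> vertices, which gives 4, and the cross term
  carries the factor 2t with t \<le> 1.\<close>

lemma expected_deviation:
  assumes K: "finite K" and E: "E \<subseteq> K \<times> K" "oriented E" and n: "n > 0"
  shows "(\<Sum>X\<in>Pow (pairs n). weight n X * (map_density K E n (orient n X) - kernel_map_density K E W)\<^sup>2) \<le> 6 * (real (card K))\<^sup>2 / n"
proof -
  let ?t = "kernel_map_density K E W" and ?d = "\<lambda>X. map_density K E n (orient n X)" and ?k = "real (card K)"
  let ?S = "\<lambda>h. \<Sum>X\<in>Pow (pairs n). weight n X * h X"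
  have t: "?t \<in> {0..1}" by (rule kernel_map_density_range[OF E(1)])
  have "?S (\<lambda>X. (?d X - ?t)\<^sup>2) = ?S (\<lambda>X. (?d X)\<^sup>2) - 2 * ?t * ?S ?d + ?t\<^sup>2 * (\<Sum>X\<in>Pow (pairs n). weight n X)"
    unfolding sum_distrib_left sum_subtractf[symmetric] sum.distrib[symmetric]
    by (intro sum.cong) (auto simp: power2_eq_square algebra_simps)
  also have "\<dots> = (?S (\<lambda>X. (?d X)\<^sup>2) - ?t\<^sup>2) - 2 * ?t * (?S ?d - ?t)"
    by (simp add: weight_sum power2_eq_square algebra_simps)
  also have "\<dots> \<le> (2 * ?k)\<^sup>2 / n + 2 * (?k\<^sup>2 / n)"
  proof -
    have "\<bar>?S (\<lambda>X. (?d X)\<^sup>2) - ?t\<^sup>2\<bar> \<le> (2 * ?k)\<^sup>2 / n"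
      using expected_map_density[OF _ sum_arcs_subset[OF E(1)] oriented_sum_arcs[OF E(2)] n] K
      unfolding map_density_square[OF K E(1)] kernel_map_density_square[OF K E(1)] by (simp add: card_Plus)
    moreover have "- (2 * ?t * (?S ?d - ?t)) \<le> 2 * (?k\<^sup>2 / n)"
    proof -
      have aux: "- (2 * a * b) \<le> 2 * (a * \<bar>b\<bar>)" if "0 \<le> a" for a b :: real
        using mult_left_mono[of "- b" "\<bar>b\<bar>" a] that by simp
      have "- (2 * ?t * (?S ?d - ?t)) \<le> 2 * (?t * \<bar>?S ?d - ?t\<bar>)"
        using t by (intro aux) simp
      also have "\<dots> \<le> 2 * (1 * (?k\<^sup>2 / n))"
        using t expected_map_density[OF K E n] by (intro mult_left_mono mult_mono) auto
      finally show ?thesis by simp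
    qed
    ultimately show ?thesis by linarith
  qed
  also have "\<dots> = 6 * ?k\<^sup>2 / n" by (simp add: power2_eq_square field_simps)
  finally show ?thesis .
qed

lemma exists_good_sample:
  fixes Fs :: "('a set \<times> ('a \<times> 'a) set) set"
  assumes fin: "finite Fs" and Fs: "\<And>K E. (K, E) \<in> Fs \<Longrightarrow> finite K \<and> E \<subseteq> K \<times> K \<and> oriented E" and n: "n > 0"
  shows "\<exists>X\<subseteq>pairs n. (\<Sum>(K, E)\<in>Fs. (map_density K E n (orient n X) - kernel_map_density K E W)\<^sup>2) \<le> (\<Sum>(K, E)\<in>Fs. 6 * (real (card K))\<^sup>2) / n"
proof (rule ccontr)
  let ?D = "\<lambda>X. \<Sum>(K, E)\<in>Fs. (map_density K E n (orient n X) - kernel_map_density K E W)\<^sup>2"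
  let ?C = "(\<Sum>(K, E)\<in>Fs. 6 * (real (card K))\<^sup>2) / n"
  assume "\<not> ?thesis"
  then have gt: "?C < ?D X" if "X \<subseteq> pairs n" for X using that by (auto simp: not_le)
  \<comment> \<open>The weighted mean of a strict inequality is strict only if some orientation has
    positive weight.\<close>
  have pos: "\<exists>X\<in>Pow (pairs n). 0 < weight n X"
  proof (rule ccontr)
    assume "\<not> ?thesis"
    then have "(\<Sum>X\<in>Pow (pairs n). weight n X) \<le> 0" by (intro sum_nonpos) (auto simp: not_less)
    then show False using weight_sum by simp
  qed
  have "C = (\<Sum>X\<in>Pow (pairs n). weight n X * C)" for C
    using weight_sum[of n] by (metis mult_1_left sum_distrib_right)
  then have "?C = (\<Sum>X\<in>Pow (pairs n). weight n X * ?C)" .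
  also have "\<dots> < (\<Sum>X\<in>Pow (pairs n). weight n X * ?D X)"
  proof (rule sum_strict_mono_ex1)
    show "\<forall>X\<in>Pow (pairs n). weight n X * ?C \<le> weight n X * ?D X"
    proof
      fix X assume "X \<in> Pow (pairs n)"
      then have X: "X \<subseteq> pairs n" by simp
      show "weight n X * ?C \<le> weight n X * ?D X"
        by (rule mult_left_mono[OF less_imp_le[OF gt[OF X]] weight_nonneg[OF X]])
    qed
    show "\<exists>X\<in>Pow (pairs n). weight n X * ?C < weight n X * ?D X"
    proof -
      from pos obtain X where X: "X \<subseteq> pairs n" "0 < weight n X" by blast
      have "weight n X * ?C < weight n X * ?D X"
        by (rule mult_strict_left_mono[OF gt[OF X(1)] X(2)])
      then show ?thesis using X(1) by blast
    qed
  qed simp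
  also have "\<dots> = (\<Sum>(K, E)\<in>Fs. \<Sum>X\<in>Pow (pairs n). weight n X * (map_density K E n (orient n X) - kernel_map_density K E W)\<^sup>2)"
    by (simp add: sum_distrib_left case_prod_beta') (rule sum.swap)
  also have "\<dots> \<le> (\<Sum>(K, E)\<in>Fs. 6 * (real (card K))\<^sup>2 / n)"
  proof (intro sum_mono, clarify)
    fix K E assume "(K, E) \<in> Fs"
    then show "(\<Sum>X\<in>Pow (pairs n). weight n X * (map_density K E n (orient n X) - kernel_map_density K E W)\<^sup>2) \<le> 6 * (real (card K))\<^sup>2 / n"
      using Fs[of K E] by (intro expected_deviation n) simp_all
  qed
  also have "\<dots> = ?C" by (simp add: sum_divide_distrib case_prod_beta')
  finally show False by simp
qed

end

section \<open>A convergent sequence of sampled tournaments\<close>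

context complementary_kernel
begin

text \<open>There are countably many digraphs on the natural numbers. Stage m treats the first m + 1
  of an enumeration at once and chooses the order so large that their total squared deviation is at
  most 1/(m + 1); each fixed digraph is covered from some stage on.\<close>

lemma exists_sampled_sequence:
  "\<exists>G. (\<forall>m. tournament (G m)) \<and> filterlim (\<lambda>m. card (pverts (G m))) at_top sequentially \<and>
     (\<forall>F. pair_digraph F \<longrightarrow> oriented (parcs F) \<longrightarrow> (\<lambda>m. hom_density F (G m)) \<longlonglongrightarrow> kernel_density F W)"
proof -
  define D :: "(nat set \<times> (nat \<times> nat) set) set"
    where "D = {(K, E). finite K \<and> E \<subseteq> K \<times> K \<and> oriented E}"
  have "D \<subseteq> {K. finite K} \<times> {E. finite E}"
    by (auto simp: D_def intro: finite_subset[OF _ finite_cartesian_product])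
  then have D: "countable D"
    by (rule countable_subset) (intro countable_SIGMA countable_Collect_finite)
  have ne: "D \<noteq> {}" by (auto simp: D_def oriented_def)
  define e where "e = from_nat_into D"
  have eD: "e i \<in> D" for i unfolding e_def by (rule from_nat_into[OF ne])
  have e_surj: "\<exists>i. e i = d" if "d \<in> D" for d
    unfolding e_def using from_nat_into_surj[OF D that] .
  let ?dev = "\<lambda>N X d. case d of (K, E) \<Rightarrow> (map_density K E N (orient N X) - kernel_map_density K E W)\<^sup>2"
  define good where "good m N X \<longleftrightarrow> m < N \<and> X \<subseteq> pairs N \<and> (\<Sum>d\<in>e ` {..m}. ?dev N X d) \<le> 1 / real (Suc m)"
    for m N X
  have "\<exists>N X. good m N X" for m
  proof -
    define C where "C = (\<Sum>(K, E)\<in>e ` {..m}. 6 * (real (card K))\<^sup>2)"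
    have C: "0 \<le> C" unfolding C_def by (intro sum_nonneg) auto
    \<comment> \<open>Taking \<open>C + 1\<close> in place of \<open>C\<close> makes one inequality
      give both \<open>C / N \<le> 1 / real (Suc m)\<close> and \<open>m < N\<close>.\<close>
    obtain N :: nat where N: "real (Suc m) * (C + 1) < real N" using reals_Archimedean2 by blast
    have "real (Suc m) * 1 \<le> real (Suc m) * (C + 1)" using C by (intro mult_left_mono) auto
    from order.strict_trans1[OF this N] have mN: "m < N" by simp
    have le: "C / N \<le> 1 / real (Suc m)"
    proof -
      have "real (Suc m) * C \<le> real (Suc m) * (C + 1)" by (intro mult_left_mono) auto
      from order.strict_trans1[OF this N] have "C * real (Suc m) \<le> real N" by (simp only: mult.commute less_imp_le)
      then show ?thesis using mN by (simp add: divide_simps)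
    qed
    have "\<exists>X\<subseteq>pairs N. (\<Sum>d\<in>e ` {..m}. ?dev N X d) \<le> C / N"
      unfolding C_def
    proof (rule exists_good_sample)
      fix K E assume "(K, E) \<in> e ` {..m}"
      then have "(K, E) \<in> D" using eD by auto
      then show "finite K \<and> E \<subseteq> K \<times> K \<and> oriented E" by (simp add: D_def)
    qed (use mN in auto)
    then show ?thesis unfolding good_def using le mN by (meson order.trans)
  qed
  then obtain N X where "\<And>m. good m (N m) (X m)" by metis
  then have NX: "m < N m" "X m \<subseteq> pairs (N m)" "(\<Sum>d\<in>e ` {..m}. ?dev (N m) (X m) d) \<le> 1 / real (Suc m)" for m
    unfolding good_def by blast+
  define G :: "nat \<Rightarrow> dgraph" where "G m = \<lparr>pverts = {..<N m}, parcs = orient (N m) (X m)\<rparr>" for m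
  have "filterlim (\<lambda>m. card (pverts (G m))) at_top sequentially"
    using NX(1) by (auto simp: G_def intro!: filterlim_at_top_mono[OF filterlim_ident] always_eventually less_imp_le)
  moreover have "(\<lambda>m. hom_density F (G m)) \<longlonglongrightarrow> kernel_density F W"
    if F: "pair_digraph F" "oriented (parcs F)" for F
  proof -
    interpret pair_digraph F by fact
    have "(pverts F, parcs F) \<in> D" using F(2) by (auto simp: D_def dest: wellformed)
    then obtain i where i: "e i = (pverts F, parcs F)" using e_surj by blast
    have hd: "hom_density F (G m) = map_density (pverts F) (parcs F) (N m) (orient (N m) (X m))" for m
      by (simp add: hom_density_def map_density_def hom_set_def hom_maps_def G_def)
    have kd: "kernel_density F W = kernel_map_density (pverts F) (parcs F) W"
      by (simp add: kernel_density_def kernel_map_density_def)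
    have bound: "(hom_density F (G m) - kernel_density F W)\<^sup>2 \<le> 1 / real (Suc m)" if "i \<le> m" for m
    proof -
      have "?dev (N m) (X m) (e i) \<le> (\<Sum>d\<in>e ` {..m}. ?dev (N m) (X m) d)"
        using that by (intro member_le_sum) auto
      also have "\<dots> \<le> 1 / real (Suc m)" by (rule NX(3))
      finally show ?thesis by (simp add: i hd kd)
    qed
    have "(\<lambda>m. (hom_density F (G m) - kernel_density F W)\<^sup>2) \<longlonglongrightarrow> 0"
    proof (rule tendsto_sandwich[OF _ _ tendsto_const])
      show "(\<lambda>m. 1 / real (Suc m)) \<longlonglongrightarrow> 0"
        by (rule LIMSEQ_Suc[OF lim_1_over_n])
    qed (use bound in \<open>auto simp: eventually_at_top_linorder\<close>)
    from tendsto_real_sqrt[OF this]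
    have "(\<lambda>m. hom_density F (G m) - kernel_density F W) \<longlonglongrightarrow> 0"
      by (simp add: tendsto_rabs_zero_iff)
    then show ?thesis by (simp add: LIM_zero_iff)
  qed
  moreover have "tournament (G m)" for m unfolding G_def by (rule tournament_orient) (rule NX)
  ultimately show ?thesis by blast
qed

end

lemma hom_density_not_oriented:
  assumes F: "\<not> oriented (parcs F)" "pair_digraph F" and G: "tournament G"
  shows "hom_density F G = 0"
proof -
  interpret F: pair_digraph F by fact
  interpret G: pair_digraph G using G by (simp add: tournament_def)
  obtain u v where uv: "(u, v) \<in> parcs F" "(v, u) \<in> parcs F" using F by (auto simp: oriented_def)
  have "hom_set F G = {}"
  proof (rule ccontr)
    assume "hom_set F G \<noteq> {}"
    then obtain \<phi> where "\<phi> \<in> hom_set F G" by blast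
    then have "(\<phi> u, \<phi> v) \<in> parcs G" "(\<phi> v, \<phi> u) \<in> parcs G" using uv by (auto simp: hom_set_def)
    note arcs = this
    have "\<phi> u \<in> pverts G" "\<phi> v \<in> pverts G" "\<phi> u \<noteq> \<phi> v"
      using G.wellformed[OF arcs(1)] G.no_loops[OF arcs(1)] by simp_all
    then show False using G arcs unfolding tournament_def by blast
  qed
  then show ?thesis by (simp add: hom_density_def)
qed

lemma pair_digraph_converse: "pair_digraph F \<Longrightarrow> pair_digraph (converse_digraph F)"
proof -
  assume "pair_digraph F"
  then interpret pair_digraph F .
  show ?thesis
    by standard (auto simp: converse_digraph_def dest: wellformed no_loops)
qed

lemma oriented_converse: "oriented (E\<inverse>) \<longleftrightarrow> oriented E"
  by (auto simp: oriented_def)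

lemma kernel_density_converse:
  "kernel_density (converse_digraph F) W = kernel_density F (\<lambda>x y. W y x)"
proof -
  have "(\<Prod>(i, j)\<in>(parcs F)\<inverse>. W (x i) (x j)) = (\<Prod>(i, j)\<in>parcs F. W (x j) (x i))" for x :: "nat \<Rightarrow> real"
    by (rule prod.reindex_bij_witness[where i = prod.swap and j = prod.swap]) auto
  then show ?thesis by (simp add: kernel_density_def converse_digraph_def)
qed

lemma exists_tournament_limit:
  assumes W: "tournament_kernel W"
  shows "tournament_limit (\<lambda>F. if oriented (parcs F) then kernel_density F W else 0)"
proof -
  \<comment> \<open>\<open>W\<close> is complementary only almost everywhere. The exceptional set is
    symmetric, so the value 1/2 there makes \<open>V\<close> complementary at every pair.\<close>
  define V where "V x y = (if W x y + W y x = 1 then W x y else 1 / 2)" for x y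
  have m: "(\<lambda>(x, y). W x y) \<in> borel_measurable (unit_lebesgue \<Otimes>\<^sub>M unit_lebesgue)"
    using W by (simp add: tournament_kernel_def)
  then have [measurable]: "(\<lambda>z. W (fst z) (snd z)) \<in> borel_measurable (unit_lebesgue \<Otimes>\<^sub>M unit_lebesgue)"
    by (simp add: case_prod_beta')
  have [measurable]: "(\<lambda>z. W (snd z) (fst z)) \<in> borel_measurable (unit_lebesgue \<Otimes>\<^sub>M unit_lebesgue)"
    using measurable_compose[OF measurable_pair_swap' m] by (simp add: case_prod_beta')
  have mV: "(\<lambda>(x, y). V x y) \<in> borel_measurable (unit_lebesgue \<Otimes>\<^sub>M unit_lebesgue)"
    unfolding V_def case_prod_beta' by measurable
  interpret complementary_kernel V
  proof
    show "V x y \<in> {0..1}" if "x \<in> {0..1}" "y \<in> {0..1}" for x y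
      using W that by (auto simp: V_def tournament_kernel_def)
    show "V x y + V y x = 1" for x y
      by (auto simp: V_def)
  qed (rule mV)
  have "AE (x, y) in unit_lebesgue \<Otimes>\<^sub>M unit_lebesgue. W x y + W y x = 1"
    using W by (simp add: tournament_kernel_def)
  then have "AE (x, y) in unit_lebesgue \<Otimes>\<^sub>M unit_lebesgue. V x y = W x y"
    by eventually_elim (auto simp: V_def)
  then have eq: "kernel_density F V = kernel_density F W" if "pair_digraph F" for F
    using that by (rule kernel_density_cong_AE[OF mV m])
  obtain G where G: "\<forall>m. tournament (G m)" "filterlim (\<lambda>m. card (pverts (G m))) at_top sequentially"
     "\<forall>F. pair_digraph F \<longrightarrow> oriented (parcs F) \<longrightarrow> (\<lambda>m. hom_density F (G m)) \<longlonglongrightarrow> kernel_density F V"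
    using exists_sampled_sequence by blast
  have "(\<lambda>m. hom_density F (G m)) \<longlonglongrightarrow> (if oriented (parcs F) then kernel_density F W else 0)"
    if F: "pair_digraph F" for F
  proof (cases "oriented (parcs F)")
    case True
    then have "(\<lambda>m. hom_density F (G m)) \<longlonglongrightarrow> kernel_density F V" using G(3) F by blast
    then show ?thesis using True eq[OF F] by simp
  next
    case False
    then show ?thesis using hom_density_not_oriented[OF _ F] G(1) by simp
  qed
  then show ?thesis unfolding tournament_limit_def using G(1,2) by blast
qed

section \<open>Star densities of a kernel and its degree distribution\<close>

lemma oriented_S_digraph: "oriented (parcs (S_digraph m n))"
  by (auto simp: oriented_def S_digraph_def Let_def)

lemma kernel_section_measurable:
  fixes W :: "real \<Rightarrow> real \<Rightarrow> real"
  assumes m: "(\<lambda>(x, y). W x y) \<in> borel_measurable (unit_lebesgue \<Otimes>\<^sub>M unit_lebesgue)" and x: "x \<in> {0..1}"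
  shows "W x \<in> borel_measurable unit_lebesgue" "(\<lambda>y. W y x) \<in> borel_measurable unit_lebesgue"
proof -
  have "Pair x \<in> unit_lebesgue \<rightarrow>\<^sub>M unit_lebesgue \<Otimes>\<^sub>M unit_lebesgue"
    using x by (intro measurable_Pair1') simp
  from measurable_compose[OF this m] show "W x \<in> borel_measurable unit_lebesgue" by simp
  have "(\<lambda>y. (y, x)) \<in> unit_lebesgue \<rightarrow>\<^sub>M unit_lebesgue \<Otimes>\<^sub>M unit_lebesgue"
    using x by (intro measurable_Pair2') simp
  from measurable_compose[OF this m] show "(\<lambda>y. W y x) \<in> borel_measurable unit_lebesgue" by simp
qed

text \<open>Conditionally on the centre the leaves are independent: each in-neighbour contributes
  the column integral \<open>a\<close>, each out-neighbour the row integral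
  \<open>b\<close>.\<close>

lemma kernel_density_S_digraph:
  assumes W: "tournament_kernel W" and f: "score_function W f"
  shows "kernel_density (S_digraph m n) W = (LINT x|unit_lebesgue. (1 - f x) ^ m * f x ^ n)"
proof -
  interpret P: product_sigma_finite "\<lambda>_::nat. unit_lebesgue" ..
  have Wm: "(\<lambda>(x, y). W x y) \<in> borel_measurable (unit_lebesgue \<Otimes>\<^sub>M unit_lebesgue)"
    and Wr: "\<And>x y. x \<in> {0..1} \<Longrightarrow> y \<in> {0..1} \<Longrightarrow> W x y \<in> {0..1}"
    and Wf: "AE (x, y) in unit_lebesgue \<Otimes>\<^sub>M unit_lebesgue. W x y + W y x = 1"
    using W by (auto simp: tournament_kernel_def)
  interpret bounded_kernel W by (rule bounded_kernel.intro[OF Wm Wr])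
  define a where "a x = (LINT y|unit_lebesgue. W y x)" for x
  define b where "b x = (LINT y|unit_lebesgue. W x y)" for x
  note sec = kernel_section_measurable[OF Wm]
  have int: "integrable unit_lebesgue (W x)" "integrable unit_lebesgue (\<lambda>y. W y x)" if "x \<in> {0..1}" for x
  proof -
    have bnd: "\<bar>W x y\<bar> \<le> 1" "\<bar>W y x\<bar> \<le> 1" if "y \<in> {0..1}" for y
      using Wr[OF \<open>x \<in> {0..1}\<close> that] Wr[OF that \<open>x \<in> {0..1}\<close>] by simp_all
    show "integrable unit_lebesgue (W x)"
      by (rule integrable_unit_bounded[OF sec(1)[OF that] bnd(1)])
    show "integrable unit_lebesgue (\<lambda>y. W y x)"
      by (rule integrable_unit_bounded[OF sec(2)[OF that] bnd(2)])
  qed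
  have bm [measurable]: "b \<in> borel_measurable unit_lebesgue"
    unfolding b_def using Wm by (rule unit.borel_measurable_lebesgue_integral)
  have am [measurable]: "a \<in> borel_measurable unit_lebesgue"
    unfolding a_def
    by (rule unit.borel_measurable_lebesgue_integral)
      (use measurable_compose[OF measurable_pair_swap' Wm] in \<open>simp add: case_prod_beta'\<close>)
  have "AE x in unit_lebesgue. AE y in unit_lebesgue. W x y + W y x = 1"
    using unit_pair.AE_pair[OF Wf] by simp
  \<comment> \<open>The score function prescribes the rows only; complementarity determines the
    column integrals, and only for almost every x.\<close>
  then have ab: "AE x in unit_lebesgue. a x = 1 - b x"
    using AE_space
  proof eventually_elim
    case (elim x)
    then have x: "x \<in> {0..1}" by simp
    have "a x = (LINT y|unit_lebesgue. 1 - W x y)"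
      unfolding a_def using elim(1) sec[OF x] by (intro integral_cong_AE) auto
    then show ?case using int[OF x] unit.prob_space by (simp add: b_def)
  qed
  define J where "J = {..<m} \<union> {m<..m + n}"
  let ?E = "parcs (S_digraph m n)"
  have V: "pverts (S_digraph m n) = {m} \<union> J" by (auto simp: S_digraph_def Let_def J_def)
  have E: "?E = {..<m} \<times> {m} \<union> {m} \<times> {m<..m + n}" by (simp add: S_digraph_def Let_def)
  have J: "finite J" "{m} \<inter> J = {}" by (auto simp: J_def)
  \<comment> \<open>Vertices below the centre m are its in-neighbours and those above are its
    out-neighbours, so one formula serves both kinds of leaves.\<close>
  let ?w = "\<lambda>z j y. if j < m then W y z else W z y"
  have prod: "(\<Prod>(i, j)\<in>?E. W (x i) (x j)) = (\<Prod>j\<in>J. ?w (x m) j (x j))" for x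
  proof -
    have "(\<Prod>(i, j)\<in>?E. W (x i) (x j)) = (\<Prod>(i, j)\<in>{..<m} \<times> {m}. W (x i) (x j)) * (\<Prod>(i, j)\<in>{m} \<times> {m<..m + n}. W (x i) (x j))"
      unfolding E by (rule prod.union_disjoint) auto
    also have "(\<Prod>(i, j)\<in>{..<m} \<times> {m}. W (x i) (x j)) = (\<Prod>j\<in>{..<m}. ?w (x m) j (x j))"
      by (simp add: prod.cartesian_product[symmetric])
    also have "(\<Prod>(i, j)\<in>{m} \<times> {m<..m + n}. W (x i) (x j)) = (\<Prod>j\<in>{m<..m + n}. ?w (x m) j (x j))"
      by (simp add: prod.cartesian_product[symmetric])
    finally show ?thesis
      unfolding J_def by (subst prod.union_disjoint) auto
  qed
  have "kernel_density (S_digraph m n) W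
      = (LINT x|PiM {m} (\<lambda>_. unit_lebesgue). LINT y|PiM J (\<lambda>_. unit_lebesgue). (\<Prod>j\<in>J. ?w (merge {m} J (x, y) m) j (merge {m} J (x, y) j)))"
    unfolding kernel_density_def prod V
  proof (rule P.product_integral_fold)
    show "integrable (PiM ({m} \<union> J) (\<lambda>_. unit_lebesgue)) (\<lambda>x. \<Prod>j\<in>J. ?w (x m) j (x j))"
      unfolding prod[symmetric] by (rule prod_integrable) (auto simp: E J_def)
  qed (use J in auto)
  also have "\<dots> = (LINT x|PiM {m} (\<lambda>_. unit_lebesgue). LINT y|PiM J (\<lambda>_. unit_lebesgue). (\<Prod>j\<in>J. ?w (x m) j (y j)))"
    by (intro Bochner_Integration.integral_cong refl prod.cong) (use J in \<open>auto simp: merge_def\<close>)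
  also have "\<dots> = (LINT x|PiM {m} (\<lambda>_. unit_lebesgue). (\<lambda>z. a z ^ m * b z ^ n) (x m))"
  proof (rule Bochner_Integration.integral_cong[OF refl])
    fix x assume "x \<in> space (PiM {m} (\<lambda>_::nat. unit_lebesgue))"
    then have x: "x m \<in> {0..1}" by (auto simp: space_PiM PiE_iff)
    have "(LINT y|PiM J (\<lambda>_. unit_lebesgue). (\<Prod>j\<in>J. ?w (x m) j (y j))) = (\<Prod>j\<in>J. LINT y|unit_lebesgue. ?w (x m) j y)"
    proof (rule P.product_integral_prod[OF J(1)])
      show "integrable unit_lebesgue (?w (x m) j)" for j
        using int[OF x] by (cases "j < m") simp_all
    qed
    also have "\<dots> = (\<Prod>j\<in>J. if j < m then a (x m) else b (x m))"
    proof (rule prod.cong[OF refl])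
      show "(LINT y|unit_lebesgue. ?w (x m) j y) = (if j < m then a (x m) else b (x m))" for j
        by (cases "j < m") (simp_all add: a_def b_def)
    qed
    also have "\<dots> = a (x m) ^ m * b (x m) ^ n"
      unfolding J_def by (subst prod.union_disjoint) auto
    finally show "(LINT y|PiM J (\<lambda>_. unit_lebesgue). (\<Prod>j\<in>J. ?w (x m) j (y j))) = (\<lambda>z. a z ^ m * b z ^ n) (x m)" .
  qed
  also have "\<dots> = (LINT z|unit_lebesgue. a z ^ m * b z ^ n)"
    by (rule P.product_integral_singleton) measurable
  also have "\<dots> = (LINT z|unit_lebesgue. (1 - b z) ^ m * b z ^ n)"
    using ab by (intro integral_cong_AE) (measurable, auto)
  also have "\<dots> = (LINT z|unit_lebesgue. (1 - f z) ^ m * f z ^ n)"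
    using f by (intro Bochner_Integration.integral_cong) (auto simp: b_def score_function_def)
  finally show ?thesis .
qed

text \<open>The degree distribution is the law of (1 - f U, f U), whose mixed moments
  \<open>kernel_density_S_digraph\<close> identifies as star densities.\<close>

lemma kernel_imp_limit:
  assumes W: "tournament_kernel W" "self_converse_kernel W" and f: "score_function W f"
  shows "\<exists>\<Gamma>. tournament_limit \<Gamma> \<and> self_converse_limit \<Gamma> \<and> outdegree_distribution \<Gamma> (distr unit_lebesgue borel f)"
proof (intro exI conjI)
  let ?\<Gamma> = "\<lambda>F. if oriented (parcs F) then kernel_density F W else 0"
  show "tournament_limit ?\<Gamma>" by (rule exists_tournament_limit[OF W(1)])
  show "self_converse_limit ?\<Gamma>"
    unfolding self_converse_limit_def kernel_density_converse
    using W(2) by (auto simp: converse_digraph_def oriented_converse self_converse_kernel_def equivalent_kernels_def)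
  have Wm: "(\<lambda>(x, y). W x y) \<in> borel_measurable (unit_lebesgue \<Otimes>\<^sub>M unit_lebesgue)"
    and Wr: "\<And>x y. x \<in> {0..1} \<Longrightarrow> y \<in> {0..1} \<Longrightarrow> W x y \<in> {0..1}"
    using W(1) by (auto simp: tournament_kernel_def)
  have "(\<lambda>x. LINT y|unit_lebesgue. W x y) \<in> borel_measurable unit_lebesgue"
    using Wm by (rule unit.borel_measurable_lebesgue_integral)
  then have fm [measurable]: "f \<in> borel_measurable unit_lebesgue"
    using f by (subst measurable_cong) (auto simp: score_function_def)
  have fr: "f x \<in> {0..1}" if x: "x \<in> {0..1}" for x
  proof -
    have i: "integrable unit_lebesgue (W x)"
      using x Wr[OF x] by (intro integrable_unit_bounded[where B = 1] kernel_section_measurable[OF Wm]) auto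
    have "0 \<le> (LINT y|unit_lebesgue. W x y)"
      by (rule integral_nonneg_AE, rule AE_unit_I) (use Wr[OF x] in auto)
    moreover have "(LINT y|unit_lebesgue. W x y) \<le> 1"
      by (rule unit.integral_le_const[OF i], rule AE_unit_I) (use Wr[OF x] in auto)
    ultimately show ?thesis using f x by (simp add: score_function_def)
  qed
  let ?p = "\<lambda>x. (1 - f x, f x)"
  have pm [measurable]: "?p \<in> unit_lebesgue \<rightarrow>\<^sub>M borel"
    by (intro borel_measurable_Pair) measurable
  let ?\<nu> = "distr unit_lebesgue borel ?p"
  have "degree_distribution ?\<Gamma> ?\<nu>"
    unfolding degree_distribution_def
  proof (intro conjI allI)
    show "prob_space ?\<nu>" by (rule unit.prob_space_distr[OF pm])
    have "closed ({0..1} \<times> {0..1::real} :: (real \<times> real) set)" by (intro closed_Times) auto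
    then have "{p. p \<in> {0..1} \<times> {0..1::real}} \<in> sets (borel :: (real \<times> real) measure)" by (simp add: borel_closed)
    then show "AE p in ?\<nu>. p \<in> {0..1} \<times> {0..1}"
    proof (subst AE_distr_iff[OF pm])
      show "AE x in unit_lebesgue. ?p x \<in> {0..1} \<times> {0..1}"
        by (rule AE_unit_I) (use fr in simp)
    qed simp
    fix m n
    have "(LINT p|?\<nu>. fst p ^ m * snd p ^ n) = (LINT x|unit_lebesgue. (1 - f x) ^ m * f x ^ n)"
      by (subst integral_distr[OF pm]) (auto intro!: borel_measurable_continuous_onI continuous_intros)
    then show "(LINT p|?\<nu>. fst p ^ m * snd p ^ n) = ?\<Gamma> (S_digraph m n)"
      using oriented_S_digraph kernel_density_S_digraph[OF W(1) f] by simp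
  qed simp
  moreover have "distr unit_lebesgue borel f = distr ?\<nu> borel snd"
    by (subst distr_distr) (auto simp: comp_def intro!: borel_measurable_continuous_onI continuous_intros)
  ultimately show "outdegree_distribution ?\<Gamma> (distr unit_lebesgue borel f)"
    unfolding outdegree_distribution_def by blast
qed

section \<open>Degrees in convergent sequences of tournaments\<close>

definition outs :: "dgraph \<Rightarrow> nat \<Rightarrow> nat set" where
  "outs G v = {w \<in> pverts G. (v, w) \<in> parcs G}"

definition ins :: "dgraph \<Rightarrow> nat \<Rightarrow> nat set" where
  "ins G v = {w \<in> pverts G. (w, v) \<in> parcs G}"

text \<open>Sorting the maps by the image v of the centre 0 leaves k free choices among the
  neighbours of v. \<open>R\<close> will be the arc relation or its converse.\<close>

lemma card_star:
  fixes V :: "'a set"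
  assumes V: "finite V"
  shows "card {\<phi> \<in> {..k} \<rightarrow>\<^sub>E V. \<forall>i\<in>{0<..k}. (\<phi> 0, \<phi> i) \<in> R} = (\<Sum>v\<in>V. card {w \<in> V. (v, w) \<in> R} ^ k)"
proof -
  let ?B = "\<lambda>v. PiE {..k} (\<lambda>i. if i = 0 then {v} else {w \<in> V. (v, w) \<in> R})"
  have "{\<phi> \<in> {..k} \<rightarrow>\<^sub>E V. \<forall>i\<in>{0<..k}. (\<phi> 0, \<phi> i) \<in> R} = (\<Union>v\<in>V. ?B v)"
  proof (intro equalityI subsetI)
    fix \<phi> assume "\<phi> \<in> {\<phi> \<in> {..k} \<rightarrow>\<^sub>E V. \<forall>i\<in>{0<..k}. (\<phi> 0, \<phi> i) \<in> R}"
    then have "\<phi> 0 \<in> V" "\<phi> \<in> ?B (\<phi> 0)" by (auto simp: PiE_iff)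
    then show "\<phi> \<in> (\<Union>v\<in>V. ?B v)" by blast
  next
    fix \<phi> assume "\<phi> \<in> (\<Union>v\<in>V. ?B v)"
    then obtain v where v: "v \<in> V" "\<phi> \<in> ?B v" by blast
    have 0: "\<phi> 0 = v" using PiE_mem[OF v(2), of 0] by simp
    have i: "\<phi> i \<in> V \<and> (v, \<phi> i) \<in> R" if "i \<in> {0<..k}" for i
      using PiE_mem[OF v(2), of i] that by simp
    have "\<phi> i \<in> V" if "i \<le> k" for i
      using 0 v(1) i[of i] that by (cases "i = 0") auto
    then show "\<phi> \<in> {\<phi> \<in> {..k} \<rightarrow>\<^sub>E V. \<forall>i\<in>{0<..k}. (\<phi> 0, \<phi> i) \<in> R}"
      using 0 i v(2) by (auto simp: PiE_iff)
  qed
  also have "card (\<Union>v\<in>V. ?B v) = (\<Sum>v\<in>V. card (?B v))"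
  proof (rule card_UN_disjoint[OF V])
    show "\<forall>v\<in>V. finite (?B v)" using V by (auto intro!: finite_PiE)
    show "\<forall>v\<in>V. \<forall>w\<in>V. v \<noteq> w \<longrightarrow> ?B v \<inter> ?B w = {}"
    proof (intro ballI impI, rule ccontr)
      fix v w assume "v \<noteq> w" "?B v \<inter> ?B w \<noteq> {}"
      then obtain \<phi> where \<phi>: "\<phi> \<in> ?B v" "\<phi> \<in> ?B w" by blast
      show False using PiE_mem[OF \<phi>(1), of 0] PiE_mem[OF \<phi>(2), of 0] \<open>v \<noteq> w\<close> by simp
    qed
  qed
  also have "\<dots> = (\<Sum>v\<in>V. card {w \<in> V. (v, w) \<in> R} ^ k)"
  proof (rule sum.cong[OF refl])
    fix v
    have "card (?B v) = (\<Prod>i\<le>k. if i = 0 then 1 else card {w \<in> V. (v, w) \<in> R})"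
      by (subst card_PiE) (auto intro!: prod.cong)
    also have "\<dots> = card {w \<in> V. (v, w) \<in> R} ^ k"
      by (simp add: prod.atMost_shift)
    finally show "card (?B v) = card {w \<in> V. (v, w) \<in> R} ^ k" .
  qed
  finally show ?thesis .
qed

lemma S_digraph_star: "pverts (S_digraph 0 k) = {..k}" "parcs (S_digraph 0 k) = {0} \<times> {0<..k}"
  by (auto simp: S_digraph_def Let_def)

text \<open>Star densities are the moments of the normalized outdegrees; the converse stars, next,
  give those of the indegrees.\<close>

lemma hom_density_out_star:
  assumes "pair_digraph G"
  shows "hom_density (S_digraph 0 k) G
    = (\<Sum>v\<in>pverts G. (card (outs G v) / card (pverts G)) ^ k) / card (pverts G)"
proof -
  interpret pair_digraph G by fact
  have "hom_set (S_digraph 0 k) G = {\<phi> \<in> {..k} \<rightarrow>\<^sub>E pverts G. \<forall>i\<in>{0<..k}. (\<phi> 0, \<phi> i) \<in> parcs G}"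
    by (auto simp: hom_set_def S_digraph_star)
  then show ?thesis
    using card_star[of "pverts G" k "parcs G"]
    by (simp add: hom_density_def S_digraph_star outs_def power_divide sum_divide_distrib[symmetric])
qed

lemma hom_density_in_star:
  assumes "pair_digraph G"
  shows "hom_density (converse_digraph (S_digraph 0 k)) G
    = (\<Sum>v\<in>pverts G. (card (ins G v) / card (pverts G)) ^ k) / card (pverts G)"
proof -
  interpret pair_digraph G by fact
  have "hom_set (converse_digraph (S_digraph 0 k)) G
      = {\<phi> \<in> {..k} \<rightarrow>\<^sub>E pverts G. \<forall>i\<in>{0<..k}. (\<phi> 0, \<phi> i) \<in> (parcs G)\<inverse>}"
    by (auto simp: hom_set_def S_digraph_star converse_digraph_def)
  then show ?thesis
    using card_star[of "pverts G" k "(parcs G)\<inverse>"]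
    by (simp add: hom_density_def S_digraph_star converse_digraph_def ins_def power_divide sum_divide_distrib[symmetric])
qed

lemma pair_digraph_S_digraph: "pair_digraph (S_digraph m n)"
  by standard (auto simp: S_digraph_def Let_def)

text \<open>The 1 accounts for v itself; it makes the two degree frequencies add up to 1 - 1/n and
  not to 1.\<close>

lemma card_outs_ins:
  assumes G: "tournament G" and v: "v \<in> pverts G"
  shows "card (outs G v) + card (ins G v) + 1 = card (pverts G)"
proof -
  interpret pair_digraph G using G by (simp add: tournament_def)
  have loop: "(v, v) \<notin> parcs G" using no_loops[of "(v, v)"] by auto
  have t: "(v, w) \<in> parcs G \<longleftrightarrow> (w, v) \<notin> parcs G" if "w \<in> pverts G" "w \<noteq> v" for w
    using G v that unfolding tournament_def by blast
  have "pverts G - {v} = outs G v \<union> ins G v"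
  proof (intro equalityI subsetI)
    fix w assume "w \<in> pverts G - {v}"
    then show "w \<in> outs G v \<union> ins G v" using t[of w] by (auto simp: outs_def ins_def)
  next
    fix w assume "w \<in> outs G v \<union> ins G v"
    then show "w \<in> pverts G - {v}" using loop by (cases "w = v") (auto simp: outs_def ins_def)
  qed
  moreover have "w \<notin> ins G v" if "w \<in> outs G v" for w
    using t[of w] loop that by (cases "w = v") (auto simp: outs_def ins_def)
  then have "outs G v \<inter> ins G v = {}" by blast
  moreover have "finite (outs G v)" "finite (ins G v)" by (auto simp: outs_def ins_def)
  ultimately have "card (pverts G - {v}) = card (outs G v) + card (ins G v)"
    by (simp add: card_Un_disjoint)
  then show ?thesis using v card_gt_0_iff[of "pverts G"] by (auto simp: card_Diff_singleton)
qed

text \<open>Every two vertices of S are joined by exactly one arc, so \<open>S \<times> S\<close>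
  splits into the arcs inside S, their reversals and the diagonal. For S the whole vertex set this
  also gives the mean outdegree.\<close>

lemma sum_internal_outdegrees:
  assumes G: "tournament G" and S: "S \<subseteq> pverts G"
  shows "(\<Sum>v\<in>S. real (card {w \<in> S. (v, w) \<in> parcs G})) = real (card S) * (real (card S) - 1) / 2"
proof -
  interpret pair_digraph G using G by (simp add: tournament_def)
  have finS: "finite S" by (rule finite_subset[OF S]) simp
  define A where "A = parcs G \<inter> S \<times> S"
  have loop: "(v, v) \<notin> parcs G" for v using no_loops[of "(v, v)"] by auto
  have t: "(u, w) \<in> parcs G \<longleftrightarrow> (w, u) \<notin> parcs G" if "u \<in> S" "w \<in> S" "u \<noteq> w" for u w
    using G that subsetD[OF S] unfolding tournament_def by blast
  have finA: "finite A" unfolding A_def using finS by blast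
  have S2: "S \<times> S = (A \<union> A\<inverse>) \<union> Id_on S"
  proof (intro equalityI subrelI)
    fix u w assume "(u, w) \<in> S \<times> S"
    then show "(u, w) \<in> (A \<union> A\<inverse>) \<union> Id_on S" using t[of u w] by (cases "u = w") (auto simp: A_def)
  qed (auto simp: A_def)
  have disj: "A \<inter> A\<inverse> = {}"
  proof (rule ccontr)
    assume "A \<inter> A\<inverse> \<noteq> {}"
    then obtain u w where "u \<in> S" "w \<in> S" "(u, w) \<in> parcs G" "(w, u) \<in> parcs G" by (auto simp: A_def)
    then show False using t[of u w] loop by auto
  qed
  have "card (S \<times> S) = card (A \<union> A\<inverse>) + card (Id_on S)"
    unfolding S2 using finS finA loop by (intro card_Un_disjoint) (auto simp: A_def Id_on_def)
  also have "card (A \<union> A\<inverse>) = card A + card A"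
    using disj finA by (subst card_Un_disjoint) (auto simp: card_inverse)
  also have "card (Id_on S) = card S"
  proof -
    have "Id_on S = (\<lambda>x. (x, x)) ` S" by (auto simp: Id_on_def)
    then show ?thesis by (simp add: card_image inj_on_def)
  qed
  finally have 2: "card S * card S = card A + card A + card S" by (simp add: card_cartesian_product)
  have "A = Sigma S (\<lambda>v. {w \<in> S. (v, w) \<in> parcs G})" by (auto simp: A_def)
  then have "card A = (\<Sum>v\<in>S. card {w \<in> S. (v, w) \<in> parcs G})"
    using finS by (simp add: card_SigmaI)
  then have "(\<Sum>v\<in>S. real (card {w \<in> S. (v, w) \<in> parcs G})) = real (card A)" by simp
  moreover have "real (card S) * real (card S) = 2 * real (card A) + real (card S)"
    using arg_cong[OF 2, of real] by simp
  ultimately show ?thesis by (simp add: algebra_simps)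
qed

lemma landau_inequality:
  assumes G: "tournament G" and S: "S \<subseteq> pverts G"
  shows "real (card S) * (real (card S) - 1) / 2 \<le> (\<Sum>v\<in>S. real (card (outs G v)))"
proof -
  interpret pair_digraph G using G by (simp add: tournament_def)
  have "(\<Sum>v\<in>S. real (card {w \<in> S. (v, w) \<in> parcs G})) \<le> (\<Sum>v\<in>S. real (card (outs G v)))"
    using S by (intro sum_mono of_nat_mono card_mono) (auto simp: outs_def)
  then show ?thesis using sum_internal_outdegrees[OF assms] by simp
qed

text \<open>Landau's inequality for the vertices of outdegree frequency below c. If they form the
  proportion r, the main term is r c - r^2/2, at most c^2/2 by completing the square; the term
  1/(2n) pays for s - 1 in place of s.\<close>

lemma mean_shortfall_le:
  assumes G: "tournament G" and N: "card (pverts G) > 0" and c: "c \<in> {0..1}"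
  shows "(\<Sum>v\<in>pverts G. max 0 (c - card (outs G v) / card (pverts G))) / card (pverts G)
    \<le> c\<^sup>2 / 2 + 1 / (2 * real (card (pverts G)))"
proof -
  define n where "n = real (card (pverts G))"
  have n: "n > 0" using N by (simp add: n_def)
  define S where "S = {v \<in> pverts G. card (outs G v) / n < c}"
  define s where "s = real (card S)"
  interpret pair_digraph G using G by (simp add: tournament_def)
  have S: "S \<subseteq> pverts G" by (auto simp: S_def)
  have s: "0 \<le> s" "s \<le> n" unfolding s_def n_def using card_mono[OF _ S] by auto
  have "(\<Sum>v\<in>pverts G. max 0 (c - card (outs G v) / n)) = (\<Sum>v\<in>S. max 0 (c - card (outs G v) / n))"
    using S by (intro sum.mono_neutral_right) (auto simp: S_def)
  also have "\<dots> = (\<Sum>v\<in>S. c - card (outs G v) / n)"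
    by (intro sum.cong) (auto simp: S_def)
  also have "\<dots> = s * c - (\<Sum>v\<in>S. real (card (outs G v))) / n"
    by (simp add: sum_subtractf s_def sum_divide_distrib)
  also have "\<dots> \<le> s * c - (s * (s - 1) / 2) / n"
    using landau_inequality[OF G S] n by (intro diff_left_mono divide_right_mono) (auto simp: s_def)
  finally have "(\<Sum>v\<in>pverts G. max 0 (c - card (outs G v) / n)) / n \<le> (s * c - (s * (s - 1) / 2) / n) / n"
    using n by (intro divide_right_mono) auto
  also have "\<dots> = (s / n) * c - (s / n)\<^sup>2 / 2 + (s / n) / (2 * n)"
    using n by (simp add: field_simps power2_eq_square)
  also have "\<dots> \<le> c\<^sup>2 / 2 + 1 / (2 * n)"
  proof -
    have "(s / n) / (2 * n) \<le> 1 / (2 * n)" using s n by (intro divide_right_mono) auto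
    moreover have "(s / n) * c - (s / n)\<^sup>2 / 2 \<le> c\<^sup>2 / 2"
      using sum_squares_ge_zero[of "s / n - c" 0] by (simp add: power2_eq_square algebra_simps)
    ultimately show ?thesis by linarith
  qed
  finally show ?thesis by (simp add: n_def)
qed

text \<open>The method of moments on [0,1]. A polynomial within r/3 of h costs r/3 in the averages
  and r/3 in the limit integral, and the moments take care of the polynomial itself.\<close>

lemma mean_tendsto_if_moments_tendsto:
  fixes V :: "nat \<Rightarrow> 'a set" and d :: "nat \<Rightarrow> 'a \<Rightarrow> real" and f :: "real \<Rightarrow> real"
  assumes d: "\<And>n v. v \<in> V n \<Longrightarrow> d n v \<in> {0..1}"
    and f: "f \<in> borel_measurable unit_lebesgue" "\<And>x. x \<in> {0..1} \<Longrightarrow> f x \<in> {0..1}"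
    and mom: "\<And>k. (\<lambda>n. (\<Sum>v\<in>V n. d n v ^ k) / card (V n)) \<longlonglongrightarrow> (LINT x|unit_lebesgue. f x ^ k)"
    and h: "continuous_on UNIV h"
  shows "(\<lambda>n. (\<Sum>v\<in>V n. h (d n v)) / card (V n)) \<longlonglongrightarrow> (LINT x|unit_lebesgue. h (f x))"
proof (rule LIMSEQ_I)
  fix r :: real assume r: "0 < r"
  have hc: "continuous_on {0..1} h" using h by (rule continuous_on_subset) simp
  obtain p where p: "real_polynomial_function p" "\<And>x. x \<in> {0..1} \<Longrightarrow> \<bar>h x - p x\<bar> < r / 3"
    using Stone_Weierstrass_real_polynomial_function[OF compact_Icc hc, of "r / 3"] r by auto
  obtain a m where am: "p = (\<lambda>x. \<Sum>i\<le>m. a i * x ^ i)"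
    using p(1) real_polynomial_function_iff_sum by blast
  let ?avg = "\<lambda>h n. (\<Sum>v\<in>V n. h (d n v)) / card (V n)"
  have pow: "integrable unit_lebesgue (\<lambda>x. f x ^ i)" for i
    by (rule integrable_unit_bounded[where B = 1]) (use f in \<open>auto intro: power_le_one\<close>)
  have intp: "(LINT x|unit_lebesgue. p (f x)) = (\<Sum>i\<le>m. a i * (LINT x|unit_lebesgue. f x ^ i))"
    and integrable_p: "integrable unit_lebesgue (\<lambda>x. p (f x))"
    unfolding am using pow by simp_all
  have "?avg p n = (\<Sum>i\<le>m. a i * ((\<Sum>v\<in>V n. d n v ^ i) / card (V n)))" for n
    unfolding am by (subst sum.swap) (simp add: sum_distrib_left sum_divide_distrib)
  then have "?avg p \<longlonglongrightarrow> (LINT x|unit_lebesgue. p (f x))"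
    unfolding intp by (simp only:) (intro tendsto_sum tendsto_mult tendsto_const mom)
  then obtain n0 where n0: "\<bar>?avg p n - (LINT x|unit_lebesgue. p (f x))\<bar> < r / 3" if "n \<ge> n0" for n
    using LIMSEQ_D[of "?avg p" _ "r / 3"] r by (auto simp: real_norm_def)
  have avg: "\<bar>?avg h n - ?avg p n\<bar> \<le> r / 3" for n
  proof -
    have "\<bar>?avg h n - ?avg p n\<bar> = \<bar>\<Sum>v\<in>V n. h (d n v) - p (d n v)\<bar> / card (V n)"
      by (simp add: sum_subtractf diff_divide_distrib[symmetric])
    also have "\<dots> \<le> (\<Sum>v\<in>V n. r / 3) / card (V n)"
    proof (intro divide_right_mono order.trans[OF sum_abs] sum_mono)
      fix v assume "v \<in> V n"
      from p(2)[OF d[OF this]] show "\<bar>h (d n v) - p (d n v)\<bar> \<le> r / 3" by simp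
    qed simp
    \<comment> \<open>If \<open>card (V n)\<close> is 0, the quotient is 0 by convention.\<close>
    also have "\<dots> \<le> r / 3" using r by (cases "card (V n) = 0") auto
    finally show ?thesis .
  qed
  have hm: "(\<lambda>x. h (f x)) \<in> borel_measurable unit_lebesgue"
    using measurable_compose[OF f(1) borel_measurable_continuous_onI[OF h]] .
  have integrable_h: "integrable unit_lebesgue (\<lambda>x. h (f x))"
  proof (rule Bochner_Integration.integrable_bound[OF _ hm])
    show "integrable unit_lebesgue (\<lambda>x. \<bar>p (f x)\<bar> + r / 3)" using integrable_p by simp
    show "AE x in unit_lebesgue. norm (h (f x)) \<le> norm (\<bar>p (f x)\<bar> + r / 3)"
    proof (rule AE_unit_I)
      fix x :: real assume "x \<in> {0..1}"
      from p(2)[OF f(2)[OF this]] show "norm (h (f x)) \<le> norm (\<bar>p (f x)\<bar> + r / 3)"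
        by (simp add: abs_if split: if_splits)
    qed
  qed
  have lim: "\<bar>(LINT x|unit_lebesgue. h (f x)) - (LINT x|unit_lebesgue. p (f x))\<bar> \<le> r / 3"
  proof -
    have "\<bar>(LINT x|unit_lebesgue. h (f x)) - (LINT x|unit_lebesgue. p (f x))\<bar> = \<bar>LINT x|unit_lebesgue. h (f x) - p (f x)\<bar>"
      using integrable_h integrable_p by simp
    also have "\<dots> \<le> (LINT x|unit_lebesgue. \<bar>h (f x) - p (f x)\<bar>)" by (rule integral_abs_bound)
    also have "\<dots> \<le> r / 3"
    proof (rule unit.integral_le_const)
      show "integrable unit_lebesgue (\<lambda>x. \<bar>h (f x) - p (f x)\<bar>)" using integrable_h integrable_p by simp
      show "AE x in unit_lebesgue. \<bar>h (f x) - p (f x)\<bar> \<le> r / 3"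
        by (rule AE_unit_I, rule less_imp_le, rule p(2), rule f(2))
    qed
    finally show ?thesis .
  qed
  show "\<exists>no. \<forall>n\<ge>no. norm (?avg h n - (LINT x|unit_lebesgue. h (f x))) < r"
  proof (intro exI allI impI)
    fix n assume "n \<ge> n0"
    from n0[OF this] avg[of n] lim show "norm (?avg h n - (LINT x|unit_lebesgue. h (f x))) < r"
      unfolding real_norm_def by linarith
  qed
qed

section \<open>Partial integrals and the shortfall function of a monotone function\<close>

lemma mono_on_unit_measurable:
  fixes f :: "real \<Rightarrow> real"
  assumes "mono_on {0..1} f"
  shows "f \<in> borel_measurable unit_lebesgue"
proof -
  define g where "g x = f (max 0 (min 1 x))" for x :: real
  have "mono g" by (rule monoI, unfold g_def, rule mono_onD[OF assms]) auto
  then have "g \<in> borel_measurable unit_lebesgue"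
    by (intro borel_imp_unit_measurable borel_measurable_mono)
  moreover have "g x = f x" if "x \<in> space unit_lebesgue" for x using that by (simp add: g_def)
  ultimately show ?thesis using measurable_cong[of unit_lebesgue g f borel] by blast
qed

lemma AE_unit_countable:
  assumes "countable N"
  shows "AE x in unit_lebesgue. x \<notin> N"
proof -
  have "AE x in lebesgue. x \<notin> N"
    by (rule AE_completion) (rule AE_not_in[OF countable_imp_null_set_lborel[OF assms]])
  then show ?thesis by (auto simp: AE_restrict_space_iff elim: eventually_mono)
qed

lemma unit_indicator:
  assumes B: "B \<in> sets unit_lebesgue"
  shows "integrable unit_lebesgue (\<lambda>x. c * indicator B x :: real)"
    and "(LINT x|unit_lebesgue. c * indicator B x) = c * measure unit_lebesgue B"
proof -
  have i: "integrable unit_lebesgue (indicator B :: real \<Rightarrow> real)"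
    using B by (intro integrable_real_indicator) (auto simp: unit.emeasure_eq_measure)
  then show "integrable unit_lebesgue (\<lambda>x. c * indicator B x)" by (rule integrable_mult_right)
  have "B \<inter> space unit_lebesgue = B" using sets.sets_into_space[OF B] by (rule Int_absorb2)
  then show "(LINT x|unit_lebesgue. c * indicator B x) = c * measure unit_lebesgue B"
    by (simp only: integral_mult_right_zero Bochner_Integration.integral_indicator)
qed

context
  fixes f :: "real \<Rightarrow> real"
  assumes mono: "mono_on {0..1} f" and range: "f \<in> {0..1} \<rightarrow> {0..1}"
begin

lemma integrable_mono_unit: "integrable unit_lebesgue f"
  by (rule integrable_unit_bounded[OF mono_on_unit_measurable[OF mono], where B = 1]) (use funcset_mem[OF range] in force)

lemma integrable_mono_indicator:
  assumes "A \<in> sets unit_lebesgue"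
  shows "integrable unit_lebesgue (\<lambda>x. f x * indicator A x)"
  using integrable_real_mult_indicator[OF assms integrable_mono_unit] .

lemma integrable_shortfall: "integrable unit_lebesgue (\<lambda>x. max 0 (c - f x))"
  using integrable_mono_unit by (intro integrable_max) auto

text \<open>Equality holds for \<open>B = {0..t}\<close> and \<open>c = f t\<close>, so the partial integrals of \<open>f\<close>
  are the Legendre transform of the shortfall function.\<close>

lemma partial_integral_ge:
  assumes B: "B \<in> sets unit_lebesgue"
  shows "c * measure unit_lebesgue B - (LINT x|unit_lebesgue. max 0 (c - f x)) \<le> (LINT x|unit_lebesgue. f x * indicator B x)"
proof -
  note iB = unit_indicator(1)[OF B, of c]
  have "c * measure unit_lebesgue B - (LINT x|unit_lebesgue. max 0 (c - f x))
      = (LINT x|unit_lebesgue. c * indicator B x - max 0 (c - f x))"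
    unfolding unit_indicator(2)[OF B, symmetric]
    by (rule Bochner_Integration.integral_diff[symmetric, OF iB integrable_shortfall])
  \<comment> \<open>Pointwise: on B the left integrand is the minimum of c and f x, off B it is at
    most 0.\<close>
  also have "\<dots> \<le> (LINT x|unit_lebesgue. f x * indicator B x)"
    by (rule integral_mono_AE, use iB integrable_shortfall[of c] in simp, rule integrable_mono_indicator[OF B], rule AE_unit_I)
      (auto simp: indicator_def)
  finally show ?thesis .
qed

lemma partial_integral_eq:
  assumes t: "t \<in> {0..1}"
  shows "(LINT x|unit_lebesgue. f x * indicator {0..t} x) = f t * t - (LINT x|unit_lebesgue. max 0 (f t - f x))"
proof -
  have B: "{0..t} \<in> sets unit_lebesgue" using t by (auto simp: sets_restrict_space_iff)
  have m: "measure unit_lebesgue {0..t} = t"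
    using t by (simp add: measure_restrict_space)
  have "(LINT x|unit_lebesgue. f x * indicator {0..t} x) = (LINT x|unit_lebesgue. f t * indicator {0..t} x - max 0 (f t - f x))"
  proof (rule Bochner_Integration.integral_cong[OF refl])
    fix x assume "x \<in> space unit_lebesgue"
    then have x: "x \<in> {0..1}" by simp
    \<comment> \<open>Left of t both sides are f x; right of t the shortfall vanishes.\<close>
    show "f x * indicator {0..t} x = f t * indicator {0..t} x - max 0 (f t - f x)"
      using mono_onD[OF mono x t] mono_onD[OF mono t x] x by (cases "x \<le> t") auto
  qed
  also have "\<dots> = f t * t - (LINT x|unit_lebesgue. max 0 (f t - f x))"
    by (subst Bochner_Integration.integral_diff[OF unit_indicator(1)[OF B] integrable_shortfall])
      (simp only: unit_indicator(2)[OF B] m)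
  finally show ?thesis .
qed

text \<open>The slope of the partial integral over [s,t] lies between f s and f t. This recovers f
  from its partial integrals without a differentiation theorem.\<close>

lemma partial_integral_increment:
  assumes "0 \<le> s" "s \<le> t" "t \<le> 1"
  shows "f s * (t - s) \<le> (LINT x|unit_lebesgue. f x * indicator {0..t} x) - (LINT x|unit_lebesgue. f x * indicator {0..s} x)"
    and "(LINT x|unit_lebesgue. f x * indicator {0..t} x) - (LINT x|unit_lebesgue. f x * indicator {0..s} x) \<le> f t * (t - s)"
proof -
  have S: "{s<..t} \<in> sets unit_lebesgue" "{0..t} \<in> sets unit_lebesgue" "{0..s} \<in> sets unit_lebesgue"
    using assms by (auto simp: sets_restrict_space_iff)
  have m: "measure unit_lebesgue {s<..t} = t - s"
    using emeasure_unit_Ioc[OF assms] assms by (simp add: measure_def)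
  note i = unit_indicator(1)[OF S(1)]
  have c: "(LINT x|unit_lebesgue. c * indicator {s<..t} x) = c * (t - s)" for c
    using unit_indicator(2)[OF S(1)] m by simp
  have "(LINT x|unit_lebesgue. f x * indicator {0..t} x) - (LINT x|unit_lebesgue. f x * indicator {0..s} x)
      = (LINT x|unit_lebesgue. f x * indicator {0..t} x - f x * indicator {0..s} x)"
    by (rule Bochner_Integration.integral_diff[symmetric, OF integrable_mono_indicator[OF S(2)] integrable_mono_indicator[OF S(3)]])
  also have "\<dots> = (LINT x|unit_lebesgue. f x * indicator {s<..t} x)"
    using assms by (intro Bochner_Integration.integral_cong) (auto simp: indicator_def)
  finally have d: "(LINT x|unit_lebesgue. f x * indicator {0..t} x) - (LINT x|unit_lebesgue. f x * indicator {0..s} x)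
      = (LINT x|unit_lebesgue. f x * indicator {s<..t} x)" .
  show "f s * (t - s) \<le> (LINT x|unit_lebesgue. f x * indicator {0..t} x) - (LINT x|unit_lebesgue. f x * indicator {0..s} x)"
    unfolding d c[symmetric]
  proof (rule integral_mono_AE[OF i integrable_mono_indicator[OF S(1)]], rule AE_unit_I)
    fix x :: real assume x: "x \<in> {0..1}"
    show "f s * indicator {s<..t} x \<le> f x * indicator {s<..t} x"
      using mono_onD[OF mono _ x, of s] assms by (auto simp: indicator_def)
  qed
  show "(LINT x|unit_lebesgue. f x * indicator {0..t} x) - (LINT x|unit_lebesgue. f x * indicator {0..s} x) \<le> f t * (t - s)"
    unfolding d c[symmetric]
  proof (rule integral_mono_AE[OF integrable_mono_indicator[OF S(1)] i], rule AE_unit_I)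
    fix x :: real assume x: "x \<in> {0..1}"
    show "f x * indicator {s<..t} x \<le> f t * indicator {s<..t} x"
      using mono_onD[OF mono x, of t] assms by (auto simp: indicator_def)
  qed
qed

end

text \<open>Equal shortfalls have equal Legendre transforms, that is, f and g have equal partial
  integrals. Comparing slopes gives f s \<le> g t and g s \<le> f t for s < t, which forces f = g
  wherever f is continuous.\<close>

lemma mono_shortfall_determines:
  assumes f: "mono_on {0..1} f" "f \<in> {0..1} \<rightarrow> {0..1::real}"
    and g: "mono_on {0..1} g" "g \<in> {0..1} \<rightarrow> {0..1::real}"
    and eq: "\<And>c. c \<in> {0..1} \<Longrightarrow> (LINT x|unit_lebesgue. max 0 (c - f x)) = (LINT x|unit_lebesgue. max 0 (c - g x))"
  shows "AE x in unit_lebesgue. f x = g x"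
proof -
  let ?I = "\<lambda>h t. LINT x|unit_lebesgue. h x * indicator {0..t} x"
  \<comment> \<open>At c = h t, \<open>partial_integral_eq\<close> is exact for h while
    \<open>partial_integral_ge\<close> bounds k; exchanging the roles of f and g then gives
    equality.\<close>
  have le: "?I h t \<le> ?I k t"
    if t: "t \<in> {0..1}" and h: "mono_on {0..1} h" "h \<in> {0..1} \<rightarrow> {0..1}" and k: "mono_on {0..1} k" "k \<in> {0..1} \<rightarrow> {0..1}"
      and hk: "\<And>c. c \<in> {0..1} \<Longrightarrow> (LINT x|unit_lebesgue. max 0 (c - h x)) = (LINT x|unit_lebesgue. max 0 (c - k x))"
    for h k :: "real \<Rightarrow> real" and t
  proof -
    have B: "{0..t} \<in> sets unit_lebesgue" using t by (auto simp: sets_restrict_space_iff)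
    have m: "measure unit_lebesgue {0..t} = t" using t by (simp add: measure_restrict_space)
    have ht: "h t \<in> {0..1}" using h(2) t by auto
    show ?thesis
      using partial_integral_eq[OF h t] partial_integral_ge[OF k B, of "h t"] hk[OF ht] m by simp
  qed
  have I: "?I f t = ?I g t" if "t \<in> {0..1}" for t
    using le[OF that f g eq] le[OF that g f eq[symmetric]] by (rule order.antisym)
  have fg: "f s \<le> g t" and gf: "g s \<le> f t" if "0 \<le> s" "s < t" "t \<le> 1" for s t
  proof -
    have I: "?I f s = ?I g s" "?I f t = ?I g t" using I[of s] I[of t] that by simp_all
    have st: "0 \<le> s" "s \<le> t" "t \<le> 1" using that by simp_all
    have "f s * (t - s) \<le> g t * (t - s)" "g s * (t - s) \<le> f t * (t - s)"
      using partial_integral_increment[OF f st] partial_integral_increment[OF g st] unfolding I by linarith+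
    then show "f s \<le> g t" "g s \<le> f t" using that by simp_all
  qed
  \<comment> \<open>A monotone function has countably many discontinuities. The endpoints are
    discarded because t needs neighbours s < t < u on both sides.\<close>
  define N where "N = {t \<in> {0..1}. \<not> continuous (at t within {0..1}) f} \<union> {0, 1}"
  have "countable N" using mono_on_ctble_discont[OF f(1)] by (simp add: N_def)
  from AE_unit_countable[OF this] show ?thesis
    using AE_space
  proof eventually_elim
    case (elim t)
    then have t: "0 < t" "t < 1" and cont: "continuous (at t within {0..1}) f" by (auto simp: N_def)
    have "\<bar>f t - g t\<bar> \<le> e" if e: "0 < e" for e
    proof -
      obtain \<delta> where \<delta>: "0 < \<delta>" "\<And>x. x \<in> {0..1} \<Longrightarrow> dist x t < \<delta> \<Longrightarrow> dist (f x) (f t) < e"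
        using cont e unfolding continuous_within_eps_delta by blast
      define s where "s = max (t / 2) (t - \<delta> / 2)"
      define u where "u = min ((t + 1) / 2) (t + \<delta> / 2)"
      have s: "0 \<le> s" "s < t" "dist s t < \<delta>" and u: "t < u" "u \<le> 1" "dist u t < \<delta>"
        using t \<delta>(1) by (auto simp: s_def u_def dist_real_def min_le_iff_disj)
      have "f s \<le> g t" "g t \<le> f u" using fg[of s t] gf[of t u] s u t by auto
      moreover have "\<bar>f s - f t\<bar> < e" "\<bar>f u - f t\<bar> < e"
        using \<delta>(2)[of s] \<delta>(2)[of u] s u t by (auto simp: dist_real_def)
      ultimately show ?thesis by linarith
    qed
    from field_le_epsilon[of "\<bar>f t - g t\<bar>" 0] this show "f t = g t" by simp
  qed
qed

text \<open>With c the measure of B, \<open>partial_integral_ge\<close> bounds the integral below by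
  c * c - c^2/2 = c^2/2.\<close>

lemma condition_I_if_shortfall:
  assumes f: "mono_on {0..1} f" "f \<in> {0..1} \<rightarrow> {0..1}"
    and short: "\<And>c. c \<in> {0..1} \<Longrightarrow> (LINT x|unit_lebesgue. max 0 (c - f x)) \<le> c\<^sup>2 / 2"
    and mean: "(LINT x|unit_lebesgue. f x) = 1 / 2"
  shows "condition_I f"
  unfolding condition_I_def
proof (intro ballI impI conjI)
  fix B :: "real set" assume B: "B \<in> sets lebesgue" "B \<subseteq> {0..1}"
  have B': "B \<in> sets unit_lebesgue" using B by (simp add: sets_restrict_space_iff)
  have m: "measure unit_lebesgue B = measure lebesgue B" using B by (simp add: measure_restrict_space)
  have I: "(LINT x:B|lebesgue. f x) = (LINT x|unit_lebesgue. f x * indicator B x)"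
    unfolding set_lebesgue_integral_def using B(2)
    by (subst integral_restrict_space) (auto intro!: Bochner_Integration.integral_cong simp: indicator_def)
  let ?c = "measure lebesgue B"
  have c: "?c \<in> {0..1}" using unit.prob_le_1[of B] m by simp
  show "(LINT x:B|lebesgue. f x) \<ge> ?c\<^sup>2 / 2"
    using partial_integral_ge[OF f B', of ?c] short[OF c] unfolding I m by (simp add: power2_eq_square)
  assume 1: "?c = 1"
  then have "AE x in unit_lebesgue. x \<in> B" using unit.AE_prob_1 m by simp
  then have "(LINT x|unit_lebesgue. f x * indicator B x) = (LINT x|unit_lebesgue. f x)"
    using integrable_mono_indicator[OF f B'] integrable_mono_unit[OF f]
    by (intro integral_cong_AE) (auto elim: eventually_mono)
  then show "(LINT x:B|lebesgue. f x) = ?c\<^sup>2 / 2" using I mean 1 by simp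
qed

section \<open>From a self-converse limit to conditions I and II\<close>

lemma limit_imp_conditions:
  assumes f: "mono_on {0..1} f" "f \<in> {0..1} \<rightarrow> {0..1}"
    and \<Gamma>: "tournament_limit \<Gamma>" "self_converse_limit \<Gamma>" "outdegree_distribution \<Gamma> (distr unit_lebesgue borel f)"
  shows "condition_I f" "condition_II f"
proof -
  note fm [measurable] = mono_on_unit_measurable[OF f(1)]
  have fr: "f x \<in> {0..1}" if "x \<in> {0..1}" for x using f(2) that by auto
  obtain G where G: "\<And>n. tournament (G n)" "filterlim (\<lambda>n. card (pverts (G n))) at_top sequentially"
      and lim: "\<And>F. pair_digraph F \<Longrightarrow> (\<lambda>n. hom_density F (G n)) \<longlonglongrightarrow> \<Gamma> F"
    using \<Gamma>(1) unfolding tournament_limit_def by blast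
  have Gd: "pair_digraph (G n)" for n using G(1) by (simp add: tournament_def)
  obtain \<nu> where \<nu>: "degree_distribution \<Gamma> \<nu>" "distr unit_lebesgue borel f = distr \<nu> borel snd"
    using \<Gamma>(3) unfolding outdegree_distribution_def by blast
  have "sets \<nu> = sets borel" using \<nu>(1) by (simp add: degree_distribution_def)
  then have snd_meas: "snd \<in> \<nu> \<rightarrow>\<^sub>M borel"
    by (subst measurable_cong_sets[of \<nu> borel borel borel]) (auto intro!: borel_measurable_continuous_onI continuous_intros)
  have mom: "(LINT x|unit_lebesgue. f x ^ k) = \<Gamma> (S_digraph 0 k)" for k
  proof -
    have "(LINT x|unit_lebesgue. f x ^ k) = (LINT y|distr unit_lebesgue borel f. y ^ k)"
      by (subst integral_distr) auto
    also have "\<dots> = (LINT p|\<nu>. snd p ^ k)"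
      unfolding \<nu>(2) by (subst integral_distr[OF snd_meas]) auto
    also have "\<dots> = \<Gamma> (S_digraph 0 k)"
      using \<nu>(1) unfolding degree_distribution_def by (metis (no_types, lifting) Bochner_Integration.integral_cong mult_1_left power_0)
    finally show ?thesis .
  qed
  define V where "V n = pverts (G n)" for n
  define d where "d n v = card (outs (G n) v) / real (card (V n))" for n v
  define e where "e n v = card (ins (G n) v) / real (card (V n))" for n v
  have finV: "finite (V n)" for n
  proof -
    interpret pair_digraph "G n" by (rule Gd)
    show ?thesis by (simp add: V_def)
  qed
  have sum1: "d n v + e n v = 1 - 1 / card (V n)" "0 < card (V n)" if "v \<in> V n" for n v
  proof -
    show c: "0 < card (V n)" using that finV[of n] card_gt_0_iff by blast
    have "real (card (outs (G n) v)) + real (card (ins (G n) v)) = card (V n) - 1"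
      using card_outs_ins[OF G(1), of v n] that c unfolding V_def by linarith
    then show "d n v + e n v = 1 - 1 / card (V n)"
      using c by (simp add: d_def e_def add_divide_distrib[symmetric] diff_divide_distrib)
  qed
  have d0: "0 \<le> d n v" "0 \<le> e n v" for n v by (simp_all add: d_def e_def)
  have d01: "d n v \<in> {0..1}" "e n v \<in> {0..1}" if "v \<in> V n" for n v
  proof -
    have "0 \<le> 1 / real (card (V n))" by simp
    then have "d n v \<le> 1" "e n v \<le> 1" using sum1(1)[OF that] d0[of n v] by linarith+
    then show "d n v \<in> {0..1}" "e n v \<in> {0..1}" using d0[of n v] by simp_all
  qed
  have md: "(\<lambda>n. (\<Sum>v\<in>V n. d n v ^ k) / card (V n)) \<longlonglongrightarrow> (LINT x|unit_lebesgue. f x ^ k)" for k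
    using lim[OF pair_digraph_S_digraph[of 0 k]] hom_density_out_star[OF Gd] unfolding mom d_def V_def by simp
  \<comment> \<open>Self-converseness of the limit enters here: in-stars are converses of out-stars,
    so the indegree frequencies have the same limiting moments as the outdegree frequencies.\<close>
  have me: "(\<lambda>n. (\<Sum>v\<in>V n. e n v ^ k) / card (V n)) \<longlonglongrightarrow> (LINT x|unit_lebesgue. f x ^ k)" for k
  proof -
    have "\<Gamma> (converse_digraph (S_digraph 0 k)) = \<Gamma> (S_digraph 0 k)"
      using \<Gamma>(2) pair_digraph_S_digraph[of 0 k] by (simp add: self_converse_limit_def)
    then show ?thesis
      using lim[OF pair_digraph_converse[OF pair_digraph_S_digraph[of 0 k]]] hom_density_in_star[OF Gd]
      unfolding mom e_def V_def by simp
  qed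
  have wd: "(\<lambda>n. (\<Sum>v\<in>V n. h (d n v)) / card (V n)) \<longlonglongrightarrow> (LINT x|unit_lebesgue. h (f x))"
    if "continuous_on UNIV h" for h :: "real \<Rightarrow> real"
    by (rule mean_tendsto_if_moments_tendsto[OF d01(1) fm fr md that])
  have we: "(\<lambda>n. (\<Sum>v\<in>V n. h (e n v)) / card (V n)) \<longlonglongrightarrow> (LINT x|unit_lebesgue. h (f x))"
    if "continuous_on UNIV h" for h :: "real \<Rightarrow> real"
    by (rule mean_tendsto_if_moments_tendsto[OF d01(2) fm fr me that])
  have Vtop: "filterlim (\<lambda>n. real (card (V n))) at_top sequentially"
    unfolding V_def by (rule filterlim_compose[OF filterlim_real_sequentially G(2)])
  have inv0: "(\<lambda>n. 1 / real (card (V n))) \<longlonglongrightarrow> 0"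
    using tendsto_divide_0[OF tendsto_const filterlim_at_top_imp_at_infinity[OF Vtop]] .
  have evpos: "eventually (\<lambda>n. 0 < card (V n)) sequentially"
    using filterlim_at_top_dense[THEN iffD1, OF Vtop, rule_format, of 0] by simp
  have short: "(LINT x|unit_lebesgue. max 0 (c - f x)) \<le> c\<^sup>2 / 2" if c: "c \<in> {0..1}" for c
  proof (rule tendsto_le[OF sequentially_bot])
    show "(\<lambda>n. (\<Sum>v\<in>V n. max 0 (c - d n v)) / card (V n)) \<longlonglongrightarrow> (LINT x|unit_lebesgue. max 0 (c - f x))"
      by (rule wd) (intro continuous_intros)
    have "(\<lambda>n. c\<^sup>2 / 2 + (1 / real (card (V n))) / 2) \<longlonglongrightarrow> c\<^sup>2 / 2 + 0 / 2"
      by (intro tendsto_intros inv0) simp_all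
    then show "(\<lambda>n. c\<^sup>2 / 2 + 1 / (2 * real (card (V n)))) \<longlonglongrightarrow> c\<^sup>2 / 2" by (simp add: mult.commute)
    show "\<forall>\<^sub>F n in sequentially. (\<Sum>v\<in>V n. max 0 (c - d n v)) / card (V n) \<le> c\<^sup>2 / 2 + 1 / (2 * real (card (V n)))"
      using evpos by eventually_elim (use mean_shortfall_le[OF G(1) _ c] in \<open>simp add: V_def d_def\<close>)
  qed
  \<comment> \<open>The mean outdegree of a tournament with n vertices is exactly (n - 1)/2. This
    supplies the equality case of condition I.\<close>
  have mean: "(LINT x|unit_lebesgue. f x) = 1 / 2"
  proof (rule LIMSEQ_unique)
    show "(\<lambda>n. (\<Sum>v\<in>V n. d n v) / card (V n)) \<longlonglongrightarrow> (LINT x|unit_lebesgue. f x)"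
      using md[of 1] by simp
    have "(\<lambda>n. 1 / 2 - (1 / real (card (V n))) / 2) \<longlonglongrightarrow> 1 / 2 - 0 / 2"
      by (intro tendsto_intros inv0) simp_all
    moreover have "\<forall>\<^sub>F n in sequentially. 1 / 2 - (1 / real (card (V n))) / 2 = (\<Sum>v\<in>V n. d n v) / card (V n)"
      using evpos
    proof eventually_elim
      case (elim n)
      have "(\<Sum>v\<in>V n. real (card (outs (G n) v))) = real (card (V n)) * (real (card (V n)) - 1) / 2"
        using sum_internal_outdegrees[OF G(1) order.refl, of n] by (simp add: V_def outs_def)
      then have "(\<Sum>v\<in>V n. d n v) = (real (card (V n)) * (real (card (V n)) - 1) / 2) / real (card (V n))"
        unfolding d_def by (simp flip: sum_divide_distrib)
      then show ?case using elim by (simp add: field_simps)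
    qed
    ultimately show "(\<lambda>n. (\<Sum>v\<in>V n. d n v) / card (V n)) \<longlonglongrightarrow> 1 / 2"
      using tendsto_cong by fastforce
  qed
  show "condition_I f" by (rule condition_I_if_shortfall[OF f short mean])
  \<comment> \<open>\<open>g\<close> is the nondecreasing rearrangement of 1 - f, and condition II
    says that f and \<open>g\<close> agree almost everywhere; hence it is enough to compare their
    shortfalls.\<close>
  define g where "g x = 1 - f (1 - x)" for x
  have g: "mono_on {0..1} g" "g \<in> {0..1} \<rightarrow> {0..1}"
    using f(2) by (auto simp: g_def intro!: mono_onI mono_onD[OF f(1)])
  have "AE x in unit_lebesgue. f x = g x"
  proof (rule mono_shortfall_determines[OF f g])
    fix c :: real
    \<comment> \<open>The averages over the indegree frequencies converge to both sides: to the left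
      one by self-converseness, to the right one because \<open>e n v\<close> is
      \<open>1 - d n v\<close> up to 1/n and the shortfall is 1-Lipschitz.\<close>
    have "(LINT x|unit_lebesgue. max 0 (c - f x)) = (LINT x|unit_lebesgue. max 0 (c - (1 - f x)))"
    proof (rule LIMSEQ_unique)
      show "(\<lambda>n. (\<Sum>v\<in>V n. max 0 (c - e n v)) / card (V n)) \<longlonglongrightarrow> (LINT x|unit_lebesgue. max 0 (c - f x))"
        by (rule we) (intro continuous_intros)
      have L: "(\<lambda>n. (\<Sum>v\<in>V n. max 0 (c - (1 - d n v))) / card (V n)) \<longlonglongrightarrow> (LINT x|unit_lebesgue. max 0 (c - (1 - f x)))"
        by (rule wd) (intro continuous_intros)
      have "(\<lambda>n. (\<Sum>v\<in>V n. max 0 (c - e n v)) / card (V n) - (\<Sum>v\<in>V n. max 0 (c - (1 - d n v))) / card (V n)) \<longlonglongrightarrow> 0"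
      proof (rule Lim_null_comparison[OF _ inv0], rule always_eventually, rule allI)
        fix n
        let ?N = "real (card (V n))"
        have "norm ((\<Sum>v\<in>V n. max 0 (c - e n v)) / ?N - (\<Sum>v\<in>V n. max 0 (c - (1 - d n v))) / ?N)
            = \<bar>\<Sum>v\<in>V n. max 0 (c - e n v) - max 0 (c - (1 - d n v))\<bar> / ?N"
          by (simp add: sum_subtractf diff_divide_distrib[symmetric])
        also have "\<dots> \<le> (\<Sum>v\<in>V n. 1 / ?N) / ?N"
        proof (intro divide_right_mono order.trans[OF sum_abs] sum_mono)
          fix v assume "v \<in> V n"
          then have "e n v = 1 - 1 / ?N - d n v" using sum1(1)[of v n] by simp
          moreover have "0 \<le> 1 / ?N" by simp
          ultimately show "\<bar>max 0 (c - e n v) - max 0 (c - (1 - d n v))\<bar> \<le> 1 / ?N" by linarith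
        qed simp
        also have "\<dots> \<le> 1 / ?N" by (cases "card (V n) = 0") auto
        finally show "norm ((\<Sum>v\<in>V n. max 0 (c - e n v)) / ?N - (\<Sum>v\<in>V n. max 0 (c - (1 - d n v))) / ?N) \<le> 1 / ?N" .
      qed
      from tendsto_add[OF this L]
      show "(\<lambda>n. (\<Sum>v\<in>V n. max 0 (c - e n v)) / card (V n)) \<longlonglongrightarrow> (LINT x|unit_lebesgue. max 0 (c - (1 - f x)))"
        by simp
    qed
    also have "\<dots> = (LINT x|unit_lebesgue. max 0 (c - g x))"
      unfolding g_def by (rule integral_reflect_unit[symmetric]) measurable
    finally show "(LINT x|unit_lebesgue. max 0 (c - f x)) = (LINT x|unit_lebesgue. max 0 (c - g x))" .
  qed
  then show "condition_II f"
    unfolding condition_II_def by eventually_elim (simp add: g_def)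
qed

theorem mainTheorem9:
  fixes f :: "real \<Rightarrow> real"
  assumes "f \<in> {0..1} \<rightarrow> {0..1}" and "mono_on {0..1} f"
  shows "((\<exists>\<Gamma>. tournament_limit \<Gamma> \<and> self_converse_limit \<Gamma> \<and>
             outdegree_distribution \<Gamma> (distr unit_lebesgue borel f))
          \<longleftrightarrow> (\<exists>W. tournament_kernel W \<and> self_converse_kernel W \<and> score_function W f))
       \<and> ((\<exists>W. tournament_kernel W \<and> self_converse_kernel W \<and> score_function W f)
          \<longleftrightarrow> condition_I f \<and> condition_II f)"
  using kernel_imp_limit[of _ f] limit_imp_conditions[OF assms(2,1)] exists_self_converse_kernel[OF assms]
  by blast

end
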